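(* (a) The normalized Haar system $(h_I/\|h_I\|_{L^1})_{I\in\mathcal D^+}$ of $L^1[0,1]$ has the factorization property. (b) The normalized bi-parameter Haar system $\big(h_I\otimes h_J/\|h_I\otimes h_J\|_{L^1}\big)_{I,J\in\mathcal D^+}$ of $L^1([0,1]^2)$ has the factorization property. (c) For every $1\le p<\infty$, the tensor product of the unit vector basis $(u_n)_{n\in\mathbb N}$ of $\ell^p$ with the normalized Haar system of $L^1[0,1]$, i.e. the system $\big(u_n\otimes (h_I/\|h_I\|_{L^1})\big)_{n\in\mathbb N,\,I\in\mathcal D^+}$ in $\ell^p(L^1)$, has the factorization property.
   Context: All Banach spaces are real. $\mathcal D$ is the set of dyadic intervals $[\frac{i-1}{2^j},\frac{i}{2^j})$, $j\ge 0$, $1\le i\le 2^j$. For $I\in\mathcal D$ with left half $I^+$ and right half $I^-$ put $h_I=\chi_{I^+}-\chi_{I^-}$. Put $\mathcal D^+=\mathcal D\cup\{\emptyset\}$ and $h_\emptyset=\chi_{[0,1)}$. $(h_I\otimes h_J)(s,t)=h_I(s)h_J(t)$. The space $\ell^p(L^1)$ consists of sequences $(f_n)_n$ in $L^1[0,1]$ with norm $(\sum_n\|f_n\|_{L^1}^p)^{1/p}<\infty$, and $u_n\otimes f$ is the sequence whose $n$-th coordinate is $f$ and whose other coordinates are $0$. Each of these systems, suitably linearly ordered, is a normalized Schauder basis. A normalized Schauder basis $(e_k)_k$ of a Banach space $X$ with biorthogonal functionals $(e_k^* )_k$ has the factorization property if for every bounded linear operator $T:X\to X$ with $\inf_k|e_k^*(Te_k)|>0$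 the identity of $X$ factors through $T$, i.e. there are bounded linear operators $R,S:X\to X$ with $I=STR$. (This property does not depend on the order of the basis, only on the biorthogonal functionals.) *)

theory Defs
  imports "HOL-Analysis.Analysis" "HOL-Library.Function_Algebras"
begin

section \<open>The space \<open>L\<^sup>1\<close> of the unit cube\<close>

text \<open>The domain is a Euclidean type, so that \<open>real L1\<close> is \<open>L\<^sup>1[0,1]\<close> and
  \<open>(real \<times> real) L1\<close> is \<open>L\<^sup>1([0,1]\<^sup>2)\<close>.\<close>

definition unit_cube :: "'a::euclidean_space measure" where
  "unit_cube = restrict_space lborel (cbox 0 One)"

quotient_type (overloaded) 'a L1 = "'a::euclidean_space \<Rightarrow> real" / partial:
  "\<lambda>f g. integrable unit_cube f \<and> integrable unit_cube g \<and> (AE x in unit_cube. f x = g x)"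
  morphisms rep_L1 to_L1
proof (rule part_equivpI)
  show "\<exists>f::'a \<Rightarrow> real. integrable unit_cube f \<and> integrable unit_cube f \<and> (AE x in unit_cube. f x = f x)"
    by (rule exI[of _ "\<lambda>_. 0"]) simp
  show "symp (\<lambda>f (g::'a \<Rightarrow> real). integrable unit_cube f \<and> integrable unit_cube g \<and> (AE x in unit_cube. f x = g x))"
    by (auto simp: symp_def)
  show "transp (\<lambda>f (g::'a \<Rightarrow> real). integrable unit_cube f \<and> integrable unit_cube g \<and> (AE x in unit_cube. f x = g x))"
    by (auto simp: transp_def)
qed

instantiation L1 :: (euclidean_space) real_vector
begin

lift_definition zero_L1 :: "'a L1" is "\<lambda>_. 0" by simp
lift_definition plus_L1 :: "'a L1 \<Rightarrow> 'a L1 \<Rightarrow> 'a L1" is "\<lambda>f g x. f x + g x" by auto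
lift_definition minus_L1 :: "'a L1 \<Rightarrow> 'a L1 \<Rightarrow> 'a L1" is "\<lambda>f g x. f x - g x" by auto
lift_definition uminus_L1 :: "'a L1 \<Rightarrow> 'a L1" is "\<lambda>f x. - f x" by auto
lift_definition scaleR_L1 :: "real \<Rightarrow> 'a L1 \<Rightarrow> 'a L1" is "\<lambda>c f x. c * f x" by auto

instance
  by standard (transfer; auto simp: algebra_simps)+

end

instantiation L1 :: (euclidean_space) real_normed_vector
begin

lift_definition norm_L1 :: "'a L1 \<Rightarrow> real" is "\<lambda>f. \<integral>x. \<bar>f x\<bar> \<partial>unit_cube"
  by (auto intro!: integral_cong_AE)

definition dist_L1 :: "'a L1 \<Rightarrow> 'a L1 \<Rightarrow> real" where "dist_L1 f g = norm (f - g)"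
definition sgn_L1 :: "'a L1 \<Rightarrow> 'a L1" where "sgn_L1 f = f /\<^sub>R norm f"
definition uniformity_L1 :: "('a L1 \<times> 'a L1) filter" where
  "uniformity_L1 = (INF e\<in>{0 <..}. principal {(f, g). dist f g < e})"
definition open_L1 :: "'a L1 set \<Rightarrow> bool" where
  "open_L1 U \<longleftrightarrow> (\<forall>f\<in>U. eventually (\<lambda>(f', g). f' = f \<longrightarrow> g \<in> U) uniformity)"

instance
proof
  fix f g :: "'a L1" and c :: real
  show "norm f = 0 \<longleftrightarrow> f = 0"
    by transfer (auto simp: integral_nonneg_eq_0_iff_AE)
  show "norm (f + g) \<le> norm f + norm g"
  proof transfer
    fix f g :: "'a \<Rightarrow> real"
    assume "integrable unit_cube f \<and> integrable unit_cube f \<and> (AE x in unit_cube. f x = f x)"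
      and "integrable unit_cube g \<and> integrable unit_cube g \<and> (AE x in unit_cube. g x = g x)"
    then have "(\<integral>x. \<bar>f x + g x\<bar> \<partial>unit_cube) \<le> (\<integral>x. \<bar>f x\<bar> + \<bar>g x\<bar> \<partial>unit_cube)"
      by (intro integral_mono) auto
    also have "\<dots> = (\<integral>x. \<bar>f x\<bar> \<partial>unit_cube) + (\<integral>x. \<bar>g x\<bar> \<partial>unit_cube)"
      using \<open>integrable unit_cube f \<and> _\<close> \<open>integrable unit_cube g \<and> _\<close> by simp
    finally show "(\<integral>x. \<bar>f x + g x\<bar> \<partial>unit_cube)
      \<le> (\<integral>x. \<bar>f x\<bar> \<partial>unit_cube) + (\<integral>x. \<bar>g x\<bar> \<partial>unit_cube)" .
  qed
  show "norm (c *\<^sub>R f) = \<bar>c\<bar> * norm f"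
    by transfer (simp add: abs_mult)
qed (simp_all add: dist_L1_def sgn_L1_def uniformity_L1_def open_L1_def)

end

lemma norm_to_L1: "integrable unit_cube f \<Longrightarrow> norm (to_L1 f) = (\<integral>x. \<bar>f x\<bar> \<partial>unit_cube)"
  by (simp add: norm_L1.abs_eq)

lemma rep_L1_integrable: "integrable unit_cube (rep_L1 f)"
  using Quotient_rep_reflp[OF Quotient_L1, of f] by blast

lemma to_L1_rep_L1: "to_L1 (rep_L1 f) = f"
  by (rule Quotient_abs_rep[OF Quotient_L1])

lemma norm_to_L1_diff:
  assumes "integrable unit_cube f" "integrable unit_cube g"
  shows "norm (to_L1 f - to_L1 g) = (\<integral>x. \<bar>f x - g x\<bar> \<partial>unit_cube)"
  using assms by (simp add: minus_L1.abs_eq norm_to_L1)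

instance L1 :: (euclidean_space) banach
proof
  fix X :: "nat \<Rightarrow> 'a L1"
  assume "Cauchy X"
  define s where "s n = rep_L1 (X n)" for n
  have s_int [measurable, simp]: "integrable unit_cube (s n)" for n
    by (simp add: s_def rep_L1_integrable)
  have X: "X n = to_L1 (s n)" for n
    by (simp add: s_def to_L1_rep_L1)
  have dist: "norm (X m - X n) = (\<integral>x. norm (s m x - s n x) \<partial>unit_cube)" for m n
    by (simp add: X norm_to_L1_diff)
  have s_Cauchy: "\<exists>N. \<forall>i\<ge>N. \<forall>j\<ge>N. (\<integral>x. norm (s i x - s j x) \<partial>unit_cube) < e" if "e > 0" for e
    using CauchyD[OF \<open>Cauchy X\<close> that] by (simp add: dist)
  obtain r where r: "strict_mono r" "AE x in unit_cube. Cauchy (\<lambda>i. s (r i) x)"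
    using cauchy_L1_AE_cauchy_subseq[of unit_cube s, OF s_int s_Cauchy] by blast
  define g where "g x = lim (\<lambda>i. s (r i) x)" for x
  have g: "AE x in unit_cube. (\<lambda>i. s (r i) x) \<longlonglongrightarrow> g x"
    using r(2) by eventually_elim (simp add: g_def Cauchy_convergent_iff convergent_LIMSEQ_iff)
  have [measurable]: "g \<in> borel_measurable unit_cube"
    unfolding g_def by measurable
  have bound: "(\<integral>\<^sup>+x. ennreal (norm (g x - s n x)) \<partial>unit_cube) \<le> ennreal e"
    if "e > 0" and N: "\<forall>i\<ge>N. \<forall>j\<ge>N. norm (X i - X j) < e" and "n \<ge> N" for e N n
  proof -
    have "(\<integral>\<^sup>+x. ennreal (norm (g x - s n x)) \<partial>unit_cube)
        = (\<integral>\<^sup>+x. liminf (\<lambda>i. ennreal (norm (s (r i) x - s n x))) \<partial>unit_cube)"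
    proof (rule nn_integral_cong_AE, use g in eventually_elim)
      case (elim x)
      have "(\<lambda>i. ennreal (norm (s (r i) x - s n x))) \<longlonglongrightarrow> ennreal (norm (g x - s n x))"
        by (intro tendsto_intros elim)
      then show ?case
        by (rule lim_imp_Liminf[OF trivial_limit_sequentially, symmetric])
    qed
    also have "\<dots> \<le> liminf (\<lambda>i. \<integral>\<^sup>+x. ennreal (norm (s (r i) x - s n x)) \<partial>unit_cube)"
      by (rule nn_integral_liminf) auto
    also have "(\<lambda>i. \<integral>\<^sup>+x. ennreal (norm (s (r i) x - s n x)) \<partial>unit_cube)
        = (\<lambda>i. ennreal (norm (X (r i) - X n)))"
      by (subst nn_integral_eq_integral) (auto simp: dist)
    also have "liminf \<dots> \<le> liminf (\<lambda>i. ennreal e)"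
    proof (rule Liminf_mono)
      have "ennreal (norm (X (r i) - X n)) \<le> ennreal e" if "i \<ge> N" for i
        using N \<open>n \<ge> N\<close> that seq_suble[OF r(1), of i] by (intro ennreal_leI) (meson le_trans less_imp_le)
      then show "\<forall>\<^sub>F i in sequentially. ennreal (norm (X (r i) - X n)) \<le> ennreal e"
        by (auto simp: eventually_sequentially)
    qed
    finally show ?thesis
      by (simp add: Liminf_const)
  qed
  have int: "integrable unit_cube g"
  proof -
    obtain N where N: "\<forall>i\<ge>N. \<forall>j\<ge>N. norm (X i - X j) < 1"
      using CauchyD[OF \<open>Cauchy X\<close>, of 1] by auto
    have "(\<integral>\<^sup>+x. ennreal (norm (g x - s N x)) \<partial>unit_cube) < \<infinity>"
      using bound[OF _ N, of N] by (simp add: order_le_less_trans)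
    then have "integrable unit_cube (\<lambda>x. g x - s N x)"
      by (intro integrableI_bounded) auto
    then have "integrable unit_cube (\<lambda>x. (g x - s N x) + s N x)"
      by (rule Bochner_Integration.integrable_add) simp
    then show ?thesis
      by simp
  qed
  have "X \<longlonglongrightarrow> to_L1 g"
  proof (rule LIMSEQ_I)
    fix e :: real assume "e > 0"
    then obtain N where N: "\<forall>i\<ge>N. \<forall>j\<ge>N. norm (X i - X j) < e / 2"
      using CauchyD[OF \<open>Cauchy X\<close>, of "e / 2"] by auto
    have "norm (X n - to_L1 g) < e" if "n \<ge> N" for n
    proof -
      have "ennreal (\<integral>x. norm (g x - s n x) \<partial>unit_cube) \<le> ennreal (e / 2)"
        using bound[OF _ N that] \<open>e > 0\<close> int by (subst nn_integral_eq_integral[symmetric]) auto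
      then have "(\<integral>x. \<bar>g x - s n x\<bar> \<partial>unit_cube) \<le> e / 2"
        using \<open>e > 0\<close> by simp
      then show ?thesis
        using \<open>e > 0\<close> int by (simp add: X norm_minus_commute[of "to_L1 (s n)"] norm_to_L1_diff)
    qed
    then show "\<exists>N. \<forall>n\<ge>N. norm (X n - to_L1 g) < e"
      by blast
  qed
  then show "convergent X"
    by (auto simp: convergent_def)
qed


section \<open>Sequences of vectors and \<open>\<ell>\<^sup>p\<close>-sums\<close>

instantiation "fun" :: (type, real_vector) real_vector
begin

definition scaleR_fun :: "real \<Rightarrow> ('a \<Rightarrow> 'b) \<Rightarrow> 'a \<Rightarrow> 'b" where
  "scaleR_fun c f = (\<lambda>x. c *\<^sub>R f x)"

instance
  by standard (auto simp: scaleR_fun_def fun_eq_iff scaleR_add_right scaleR_add_left)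

end

definition lp_space :: "real \<Rightarrow> (nat \<Rightarrow> 'a::real_normed_vector) set" where
  "lp_space p = {f. summable (\<lambda>n. norm (f n) powr p)}"

definition lp_norm :: "real \<Rightarrow> (nat \<Rightarrow> 'a::real_normed_vector) \<Rightarrow> real" where
  "lp_norm p f = (\<Sum>n. norm (f n) powr p) powr (1 / p)"

definition unit_tensor :: "nat \<Rightarrow> 'a::zero \<Rightarrow> nat \<Rightarrow> 'a" where
  "unit_tensor n f = (\<lambda>m. if m = n then f else 0)"


section \<open>Bounded operators, bases and the factorization property\<close>

text \<open>A Banach space is given as a linear subspace \<open>X\<close> of a real vector space together with a
  norm \<open>N\<close> on \<open>X\<close>, because the exponent \<open>p\<close> of \<open>\<ell>\<^sup>p(L\<^sup>1)\<close> cannot be a parameter of a type.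
  Values of operators and functionals outside \<open>X\<close> are irrelevant.\<close>

definition bounded_operator ::
  "'v::real_vector set \<Rightarrow> ('v \<Rightarrow> real) \<Rightarrow> ('v \<Rightarrow> 'v) \<Rightarrow> bool" where
  "bounded_operator X N T \<longleftrightarrow>
     (\<forall>x\<in>X. T x \<in> X) \<and>
     (\<forall>x\<in>X. \<forall>y\<in>X. T (x + y) = T x + T y) \<and>
     (\<forall>c. \<forall>x\<in>X. T (c *\<^sub>R x) = c *\<^sub>R T x) \<and>
     (\<exists>C. \<forall>x\<in>X. N (T x) \<le> C * N x)"

definition bounded_functional ::
  "'v::real_vector set \<Rightarrow> ('v \<Rightarrow> real) \<Rightarrow> ('v \<Rightarrow> real) \<Rightarrow> bool" where
  "bounded_functional X N \<phi> \<longleftrightarrow>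
     (\<forall>x\<in>X. \<forall>y\<in>X. \<phi> (x + y) = \<phi> x + \<phi> y) \<and>
     (\<forall>c. \<forall>x\<in>X. \<phi> (c *\<^sub>R x) = c * \<phi> x) \<and>
     (\<exists>C. \<forall>x\<in>X. \<bar>\<phi> x\<bar> \<le> C * N x)"

lemma bounded_operator_UNIV: "bounded_operator UNIV norm T \<longleftrightarrow> bounded_linear T"
  unfolding bounded_operator_def bounded_linear_def bounded_linear_axioms_def linear_iff
  by (auto simp: mult.commute)

lemma bounded_functional_UNIV: "bounded_functional UNIV norm \<phi> \<longleftrightarrow> bounded_linear \<phi>"
  unfolding bounded_functional_def bounded_linear_def bounded_linear_axioms_def linear_iff
  by (auto simp: mult.commute)

definition normalized_schauder_basis ::
  "'v::real_vector set \<Rightarrow> ('v \<Rightarrow> real) \<Rightarrow> (nat \<Rightarrow> 'v) \<Rightarrow> bool" where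
  "normalized_schauder_basis X N b \<longleftrightarrow>
     (\<forall>k. b k \<in> X \<and> N (b k) = 1) \<and>
     (\<forall>x\<in>X. \<exists>!a. (\<lambda>n. N (x - (\<Sum>k<n. a k *\<^sub>R b k))) \<longlonglongrightarrow> 0)"

definition biorthogonal_functionals ::
  "'v::real_vector set \<Rightarrow> ('v \<Rightarrow> real) \<Rightarrow> 'i set \<Rightarrow> ('i \<Rightarrow> 'v) \<Rightarrow> ('i \<Rightarrow> 'v \<Rightarrow> real) \<Rightarrow> bool" where
  "biorthogonal_functionals X N K e e' \<longleftrightarrow>
     (\<forall>k\<in>K. bounded_functional X N (e' k)) \<and>
     (\<forall>k\<in>K. \<forall>l\<in>K. e' k (e l) = (if k = l then 1 else 0))"

text \<open>The systems below carry no canonical linear order, so the basis is a countable family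
  \<open>(e k)\<^bsub>k \<in> K\<^esub>\<close> that is a normalized Schauder basis in some enumeration. Since its span is then
  dense, the functionals \<open>e' k\<close> are uniquely determined on \<open>X\<close>.\<close>

definition factorization_property ::
  "'v::real_vector set \<Rightarrow> ('v \<Rightarrow> real) \<Rightarrow> 'i set \<Rightarrow> ('i \<Rightarrow> 'v) \<Rightarrow> bool" where
  "factorization_property X N K e \<longleftrightarrow>
     (\<exists>\<pi>. bij_betw \<pi> (UNIV :: nat set) K \<and> normalized_schauder_basis X N (e \<circ> \<pi>)) \<and>
     (\<exists>e'. biorthogonal_functionals X N K e e' \<and>
       (\<forall>T. bounded_operator X N T \<and> (INF k\<in>K. \<bar>e' k (T (e k))\<bar>) > 0 \<longrightarrow>
         (\<exists>R S. bounded_operator X N R \<and> bounded_operator X N S \<and>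
           (\<forall>x\<in>X. x = S (T (R x))))))"


section \<open>The Haar system\<close>

definition dyadic_intervals :: "real set set" where
  "dyadic_intervals =
     {{(real i - 1) / 2 ^ j ..< real i / 2 ^ j} | i j :: nat. 1 \<le> i \<and> i \<le> 2 ^ j}"

definition dyadic_intervals_plus :: "real set set" where
  "dyadic_intervals_plus = insert {} dyadic_intervals"

definition left_half :: "real set \<Rightarrow> real set" where
  "left_half I = {Inf I ..< (Inf I + Sup I) / 2}"

definition right_half :: "real set \<Rightarrow> real set" where
  "right_half I = {(Inf I + Sup I) / 2 ..< Sup I}"

definition haar :: "real set \<Rightarrow> real \<Rightarrow> real" where
  "haar I = (if I = {} then indicator {0..<1}
     else (\<lambda>s. indicator (left_half I) s - indicator (right_half I) s))"

definition haar2 :: "real set \<Rightarrow> real set \<Rightarrow> real \<times> real \<Rightarrow> real" where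
  "haar2 I J = (\<lambda>(s, t). haar I s * haar J t)"

lemma haar_measurable [measurable]: "haar I \<in> borel_measurable borel"
  unfolding haar_def left_half_def right_half_def by (cases "I = {}") simp_all

lemma haar_bounded: "\<bar>haar I s\<bar> \<le> 1"
  by (auto simp: haar_def left_half_def right_half_def indicator_def)

lemma integrable_unit_cube_bounded:
  fixes f :: "'a::euclidean_space \<Rightarrow> real"
  assumes "f \<in> borel_measurable borel" "\<And>x. \<bar>f x\<bar> \<le> B"
  shows "integrable unit_cube f"
proof -
  have "finite_measure (unit_cube :: 'a measure)"
    unfolding unit_cube_def
    by (rule finite_measureI)
       (simp add: emeasure_restrict_space space_restrict_space emeasure_lborel_cbox_eq)
  moreover have "f \<in> borel_measurable unit_cube"
    using assms(1) by (simp add: unit_cube_def measurable_restrict_space1)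
  ultimately show ?thesis
    using assms(2) by (intro finite_measure.integrable_const_bound[where B = B]) auto
qed

lemma integrable_haar: "integrable unit_cube (haar I)"
  by (rule integrable_unit_cube_bounded[where B = 1]) (simp_all add: haar_bounded)

lemma integrable_haar2: "integrable unit_cube (haar2 I J)"
proof (rule integrable_unit_cube_bounded[where B = 1])
  show "haar2 I J \<in> borel_measurable borel"
    unfolding haar2_def borel_prod[symmetric] by measurable
  show "\<bar>haar2 I J x\<bar> \<le> 1" for x
    using mult_mono[OF haar_bounded[of I "fst x"] haar_bounded[of J "snd x"]]
    by (simp add: haar2_def abs_mult split_beta)
qed

definition normalized_haar :: "real set \<Rightarrow> real L1" where
  "normalized_haar I = to_L1 (haar I) /\<^sub>R norm (to_L1 (haar I))"

definition normalized_haar2 :: "real set \<times> real set \<Rightarrow> (real \<times> real) L1" where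
  "normalized_haar2 = (\<lambda>(I, J). to_L1 (haar2 I J) /\<^sub>R norm (to_L1 (haar2 I J)))"

end

theory Submission
  imports Defs
begin

text \<open>
  All three statements come from one fact about operators on an \<open>L\<^sup>1\<close> space that carries a dyadic
  tree of sets.  Let \<open>T\<close> be such an operator and suppose that its Haar diagonal is at least \<open>\<delta>\<close> in
  modulus.  Keep from \<open>T\<close> only what it sends from a cell of generation \<open>n\<close> to the same cell:
  \<open>D n = (\<Sum>K. 1\<^sub>K T 1\<^sub>K)\<close>.  Refining the cells increases the total mass \<open>\<Sum>K. \<parallel>T 1\<^sub>K\<parallel>\<close>, which
  stays below \<open>\<parallel>T\<parallel>\<close>, and decreases the mass moved within single cells; both are monotone and
  bounded, and their increments dominate the off-diagonal mass, which therefore tends to \<open>0\<close>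
  (\<open>offdiag_mass_tendsto_0\<close>).  Hence \<open>D n\<close> converges in \<open>L\<^sup>1\<close> to some \<open>g\<close>: the operator is
  multiplication by \<open>g\<close> plus a part without diagonal.  A Haar function is \<open>\<plusminus>1\<close> on subcells, so its
  diagonal coefficient also differs from the integral of \<open>g\<close> only by off-diagonal mass.  Therefore
  \<open>\<bar>g\<bar> \<ge> \<delta>\<close> almost everywhere, and multiplying \<open>T\<close> by \<open>1 / g\<close> makes its diagonal exactly \<open>1\<close>
  (\<open>diag_normalization\<close>).  This is the step that removes signs and fluctuations of the Haar
  diagonal, which matter because the Haar system is not unconditional in \<open>L\<^sup>1\<close>.

  Now each Haar function is replaced by a block, a sum of Haar functions with signs over a very
  fine generation of cells that fills the support.  For suitable signs a block \<open>\<beta>\<close> with support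
  \<open>C\<close> satisfies \<open>\<langle>\<beta>, T \<beta>\<rangle> \<approx> \<bar>C\<bar>\<close>, by a second moment estimate, and it is almost annihilated by
  finitely many given functionals and almost orthogonal to finitely many given functions
  (\<open>exists_block\<close>).  Choosing blocks one after another along the tree produces a distributional
  copy of the Haar system; the maps \<open>R\<close> from the Haar system to its copy and \<open>S\<close> back are
  contractions, because truncated they are averaging operators (\<open>haar_transfer_eq_leaves\<close>), and
  \<open>S T R\<close> differs from the identity by a matrix with small absolutely summable entries.  The same
  choice can serve a whole matrix \<open>T c d\<close> of operators at once (\<open>simultaneous_factorization\<close>).
  A Neumann series then gives the factorization of the identity of \<open>L\<^sup>1\<close> and, with the matrix
  of the operator between the coordinates, that of \<open>\<ell>\<^sup>p(L\<^sup>1)\<close>.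

  For the bi-parameter system the tree consists of dyadic rectangles obtained by halving the two
  sides alternately.  The functions \<open>h\<^sub>I \<otimes> h\<^sub>J\<close> with \<open>\<bar>I\<bar> = \<bar>J\<bar>\<close> are \<open>\<plusminus>1\<close> on subcells of the squares of
  the tree, and this is all that the lower bound for \<open>g\<close> uses, so the one-parameter argument
  applies (\<open>large_diagonal_haar_tensor\<close>).

  That the systems are bases rests on the same averaging identity: a partial sum of the Haar
  expansion is a conditional expectation.  In the bi-parameter case the terms are enumerated in
  square shells, and a partial sum is a combination of three expectations over rectangular grids
  (\<open>norm_shell_sum_le\<close>).
\<close>

section \<open>Multiplication and integration in \<open>L\<^sup>1\<close>\<close>

lemma finite_measure_unit_cube: "finite_measure (unit_cube :: 'a::euclidean_space measure)"
  unfolding unit_cube_def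
  by (rule finite_measureI)
     (simp add: emeasure_restrict_space space_restrict_space emeasure_lborel_cbox_eq)

definition bounded_measurable :: "('a::euclidean_space \<Rightarrow> real) \<Rightarrow> bool" where
  "bounded_measurable \<phi> \<longleftrightarrow> \<phi> \<in> borel_measurable unit_cube \<and> (\<exists>B. \<forall>x. \<bar>\<phi> x\<bar> \<le> B)"

lemma bounded_measurableI:
  "\<phi> \<in> borel_measurable unit_cube \<Longrightarrow> (\<And>x. \<bar>\<phi> x\<bar> \<le> B) \<Longrightarrow> bounded_measurable \<phi>"
  by (auto simp: bounded_measurable_def)

lemma bounded_measurable_measurable:
  "bounded_measurable \<phi> \<Longrightarrow> \<phi> \<in> borel_measurable unit_cube"
  by (simp add: bounded_measurable_def)

lemma bounded_measurable_const [simp]: "bounded_measurable (\<lambda>x. c)"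
  by (rule bounded_measurableI[where B = "\<bar>c\<bar>"]) auto

lemma bounded_measurable_add [intro]:
  assumes "bounded_measurable f" "bounded_measurable g"
  shows "bounded_measurable (\<lambda>x. f x + g x)"
proof -
  obtain B C where "\<And>x. \<bar>f x\<bar> \<le> B" "\<And>x. \<bar>g x\<bar> \<le> C"
    using assms by (auto simp: bounded_measurable_def)
  then have "\<bar>f x + g x\<bar> \<le> B + C" for x
    by (meson abs_triangle_ineq add_mono order_trans)
  then show ?thesis
    using assms by (auto intro!: bounded_measurableI simp: bounded_measurable_def)
qed

lemma bounded_measurable_mult [intro]:
  assumes "bounded_measurable f" "bounded_measurable g"
  shows "bounded_measurable (\<lambda>x. f x * g x)"
proof -
  obtain B C where *: "\<And>x. \<bar>f x\<bar> \<le> B" "\<And>x. \<bar>g x\<bar> \<le> C"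
    using assms by (auto simp: bounded_measurable_def)
  then have "\<bar>f x * g x\<bar> \<le> B * C" for x
    unfolding abs_mult using *[of x] order_trans[OF abs_ge_zero *(1)[of x]]
    by (intro mult_mono) auto
  then show ?thesis
    using assms by (auto intro!: bounded_measurableI simp: bounded_measurable_def)
qed

lemma bounded_measurable_diff [intro]:
  assumes "bounded_measurable f" "bounded_measurable g"
  shows "bounded_measurable (\<lambda>x. f x - g x)"
  using bounded_measurable_add[OF assms(1) bounded_measurable_mult[OF bounded_measurable_const[of "-1"] assms(2)]]
  by simp

lemma bounded_measurable_sum [intro]:
  assumes "\<And>i. i \<in> I \<Longrightarrow> bounded_measurable (f i)"
  shows "bounded_measurable (\<lambda>x. \<Sum>i\<in>I. f i x)"
  using assms
proof (induction I rule: infinite_finite_induct)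
  case (insert i I)
  then show ?case
    using bounded_measurable_add[of "f i" "\<lambda>x. \<Sum>i\<in>I. f i x"] by simp
qed simp_all

lemma bounded_measurable_indicator [intro]:
  assumes "A \<in> sets borel"
  shows "bounded_measurable (indicator A)"
proof (rule bounded_measurableI[where B = 1])
  show "indicator A \<in> borel_measurable (unit_cube :: 'a measure)"
    unfolding unit_cube_def using assms by (auto intro!: measurable_restrict_space1)
qed (auto simp: indicator_def)

lemma integrable_bounded_measurable_mult:
  assumes "bounded_measurable \<phi>" "integrable unit_cube f"
  shows "integrable unit_cube (\<lambda>x. \<phi> x * f x)"
proof -
  obtain B where B: "\<And>x. \<bar>\<phi> x\<bar> \<le> B"
    using assms by (auto simp: bounded_measurable_def)
  have [measurable]: "\<phi> \<in> borel_measurable unit_cube" "f \<in> borel_measurable unit_cube"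
    using assms by (auto simp: bounded_measurable_def)
  show ?thesis
  proof (rule Bochner_Integration.integrable_bound)
    show "integrable unit_cube (\<lambda>x. B * f x)"
      using assms by simp
    show "AE x in unit_cube. norm (\<phi> x * f x) \<le> norm (B * f x)"
      using B by (intro AE_I2) (auto simp: abs_mult intro!: mult_right_mono intro: order_trans[OF _ abs_ge_self])
  qed measurable
qed

lemma integrable_bounded_measurable: "bounded_measurable f \<Longrightarrow> integrable unit_cube f"
  using integrable_bounded_measurable_mult[of f "\<lambda>_. 1",
      OF _ finite_measure.integrable_const[OF finite_measure_unit_cube]] by simp

lemma to_L1_eq_iff:
  assumes "integrable unit_cube f" "integrable unit_cube g"
  shows "to_L1 f = to_L1 g \<longleftrightarrow> (AE x in unit_cube. f x = g x)"
  using Quotient_rel[OF Quotient_L1, of f g] assms by auto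

lemma rep_to_L1: "integrable unit_cube f \<Longrightarrow> AE x in unit_cube. rep_L1 (to_L1 f) x = f x"
  using to_L1_eq_iff[OF rep_L1_integrable, of f "to_L1 f"] by (simp add: to_L1_rep_L1)

lemma to_L1_add:
  "integrable unit_cube f \<Longrightarrow> integrable unit_cube g \<Longrightarrow>
     to_L1 f + to_L1 g = to_L1 (\<lambda>x. f x + g x)"
  by (simp add: plus_L1.abs_eq)

lemma to_L1_diff:
  "integrable unit_cube f \<Longrightarrow> integrable unit_cube g \<Longrightarrow>
     to_L1 f - to_L1 g = to_L1 (\<lambda>x. f x - g x)"
  by (simp add: minus_L1.abs_eq)

lemma to_L1_scaleR: "integrable unit_cube f \<Longrightarrow> c *\<^sub>R to_L1 f = to_L1 (\<lambda>x. c * f x)"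
  by (simp add: scaleR_L1.abs_eq)

lemma to_L1_zero: "to_L1 (\<lambda>x. 0) = 0"
  by (simp add: zero_L1_def)

lemma to_L1_sum:
  "(\<And>i. i \<in> I \<Longrightarrow> integrable unit_cube (f i)) \<Longrightarrow>
     (\<Sum>i\<in>I. to_L1 (f i)) = to_L1 (\<lambda>x. \<Sum>i\<in>I. f i x)"
proof (induction I rule: infinite_finite_induct)
  case (insert i I)
  then show ?case
    by (simp add: to_L1_add)
qed (simp_all add: to_L1_zero)

lemma rep_L1_add: "AE x in unit_cube. rep_L1 (u + v) x = rep_L1 u x + rep_L1 v x"
  using rep_to_L1[of "\<lambda>x. rep_L1 u x + rep_L1 v x"]
  by (simp add: to_L1_add[symmetric] rep_L1_integrable to_L1_rep_L1)

lemma rep_L1_scaleR: "AE x in unit_cube. rep_L1 (c *\<^sub>R u) x = c * rep_L1 u x"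
  using rep_to_L1[of "\<lambda>x. c * rep_L1 u x"]
  by (simp add: to_L1_scaleR[symmetric] rep_L1_integrable to_L1_rep_L1)

lemma norm_L1_eq: "norm u = (\<integral>x. \<bar>rep_L1 u x\<bar> \<partial>unit_cube)"
  using norm_to_L1[OF rep_L1_integrable, of u] by (simp add: to_L1_rep_L1)

definition mult_L1 :: "('a::euclidean_space \<Rightarrow> real) \<Rightarrow> 'a L1 \<Rightarrow> 'a L1" where
  "mult_L1 \<phi> u = to_L1 (\<lambda>x. \<phi> x * rep_L1 u x)"

definition pairing :: "('a::euclidean_space \<Rightarrow> real) \<Rightarrow> 'a L1 \<Rightarrow> real" where
  "pairing \<phi> u = (\<integral>x. \<phi> x * rep_L1 u x \<partial>unit_cube)"

lemma integrable_mult_rep_L1: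
  "bounded_measurable \<phi> \<Longrightarrow> integrable unit_cube (\<lambda>x. \<phi> x * rep_L1 u x)"
  by (intro integrable_bounded_measurable_mult rep_L1_integrable)

lemma mult_L1_to_L1:
  assumes "bounded_measurable \<phi>" "integrable unit_cube f"
  shows "mult_L1 \<phi> (to_L1 f) = to_L1 (\<lambda>x. \<phi> x * f x)"
  unfolding mult_L1_def
  using rep_to_L1[OF assms(2)] assms
  by (subst to_L1_eq_iff)
     (auto intro: integrable_mult_rep_L1 integrable_bounded_measurable_mult)

lemma norm_mult_L1:
  "bounded_measurable \<phi> \<Longrightarrow> norm (mult_L1 \<phi> u) = (\<integral>x. \<bar>\<phi> x\<bar> * \<bar>rep_L1 u x\<bar> \<partial>unit_cube)"
  unfolding mult_L1_def by (simp add: norm_to_L1 integrable_mult_rep_L1 abs_mult)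

lemma norm_mult_L1_le:
  assumes "bounded_measurable \<phi>" "\<And>x. \<bar>\<phi> x\<bar> \<le> B"
  shows "norm (mult_L1 \<phi> u) \<le> B * norm u"
proof -
  have "(\<integral>x. \<bar>\<phi> x\<bar> * \<bar>rep_L1 u x\<bar> \<partial>unit_cube) \<le> (\<integral>x. B * \<bar>rep_L1 u x\<bar> \<partial>unit_cube)"
    using assms integrable_abs[OF integrable_mult_rep_L1[OF assms(1)], of u]
    by (intro integral_mono) (auto simp: rep_L1_integrable abs_mult intro!: mult_right_mono)
  then show ?thesis
    using norm_mult_L1[OF assms(1), of u] norm_L1_eq[of u] by simp
qed

lemma bounded_linear_mult_L1:
  assumes "bounded_measurable \<phi>"
  shows "bounded_linear (mult_L1 \<phi>)"
proof -
  obtain B where B: "\<And>x. \<bar>\<phi> x\<bar> \<le> B"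
    using assms by (auto simp: bounded_measurable_def)
  show ?thesis
  proof (rule bounded_linear_intro[where K = B])
    fix u v :: "'a L1" and c :: real
    show "mult_L1 \<phi> (u + v) = mult_L1 \<phi> u + mult_L1 \<phi> v"
      unfolding mult_L1_def
      by (subst to_L1_add, auto intro!: integrable_mult_rep_L1 assms, subst to_L1_eq_iff)
         (use rep_L1_add[of u v] in \<open>auto intro!: integrable_mult_rep_L1
           Bochner_Integration.integrable_add assms simp: algebra_simps\<close>)
    show "mult_L1 \<phi> (c *\<^sub>R u) = c *\<^sub>R mult_L1 \<phi> u"
      unfolding mult_L1_def
      by (subst to_L1_scaleR, auto intro!: integrable_mult_rep_L1 assms, subst to_L1_eq_iff)
         (use rep_L1_scaleR[of c u] in \<open>auto intro!: integrable_mult_rep_L1 assms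
           integrable_mult_right simp: algebra_simps\<close>)
    show "norm (mult_L1 \<phi> u) \<le> norm u * B"
      using norm_mult_L1_le[OF assms B] by (simp add: mult.commute)
  qed
qed

lemma mult_L1_mult_L1:
  assumes "bounded_measurable \<phi>" "bounded_measurable \<psi>"
  shows "mult_L1 \<phi> (mult_L1 \<psi> u) = mult_L1 (\<lambda>x. \<phi> x * \<psi> x) u"
  using assms unfolding mult_L1_def[of \<psi>] mult_L1_def[of "\<lambda>x. \<phi> x * \<psi> x"]
  by (subst mult_L1_to_L1) (auto intro: integrable_mult_rep_L1 simp: mult.assoc)

lemma mult_L1_add_left:
  assumes "bounded_measurable \<phi>" "bounded_measurable \<psi>"
  shows "mult_L1 (\<lambda>x. \<phi> x + \<psi> x) u = mult_L1 \<phi> u + mult_L1 \<psi> u"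
  using assms unfolding mult_L1_def
  by (subst to_L1_add) (auto intro: integrable_mult_rep_L1 simp: algebra_simps)

lemma pairing_eq_mult_L1:
  assumes "bounded_measurable \<phi>"
  shows "pairing \<phi> u = pairing (\<lambda>_. 1) (mult_L1 \<phi> u)"
  unfolding pairing_def mult_L1_def
  using rep_to_L1[OF integrable_mult_rep_L1[OF assms, of u]]
    integrable_mult_rep_L1[OF assms, of u] rep_L1_integrable
  by (auto intro!: integral_cong_AE borel_measurable_integrable)

lemma abs_pairing_le: "bounded_measurable \<phi> \<Longrightarrow> \<bar>pairing \<phi> u\<bar> \<le> norm (mult_L1 \<phi> u)"
  using integral_abs_bound[of unit_cube "\<lambda>x. \<phi> x * rep_L1 u x"]
  by (simp add: pairing_def norm_mult_L1 abs_mult)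

lemma pairing_mult_L1:
  assumes "bounded_measurable \<phi>" "bounded_measurable \<psi>"
  shows "pairing \<phi> (mult_L1 \<psi> u) = pairing (\<lambda>x. \<phi> x * \<psi> x) u"
  using pairing_eq_mult_L1[OF assms(1), of "mult_L1 \<psi> u"] mult_L1_mult_L1[OF assms]
    pairing_eq_mult_L1[OF bounded_measurable_mult[OF assms], of u] by simp

lemma pairing_to_L1:
  assumes "bounded_measurable \<phi>" "integrable unit_cube f"
  shows "pairing \<phi> (to_L1 f) = (\<integral>x. \<phi> x * f x \<partial>unit_cube)"
  unfolding pairing_def using rep_to_L1[OF assms(2)]
  by (intro integral_cong_AE)
     (auto intro!: borel_measurable_integrable integrable_mult_rep_L1
        integrable_bounded_measurable_mult assms)

lemma bounded_linear_pairing: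
  fixes \<phi> :: "'a::euclidean_space \<Rightarrow> real"
  assumes "bounded_measurable \<phi>"
  shows "bounded_linear (pairing \<phi>)"
proof -
  have eq: "pairing (\<lambda>_. 1) = (\<lambda>u :: 'a L1. \<integral>x. rep_L1 u x \<partial>unit_cube)"
    by (simp add: pairing_def fun_eq_iff)
  have "bounded_linear (pairing (\<lambda>_. 1 :: real) :: 'a L1 \<Rightarrow> real)"
    unfolding eq
  proof (rule bounded_linear_intro[where K = 1])
    fix u v :: "'a L1" and c :: real
    have "(\<integral>x. rep_L1 (u + v) x \<partial>unit_cube) = (\<integral>x. rep_L1 u x + rep_L1 v x \<partial>unit_cube)"
      using rep_L1_add[of u v] by (intro integral_cong_AE)
        (auto intro!: borel_measurable_integrable borel_measurable_add simp: rep_L1_integrable)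
    then show "(\<integral>x. rep_L1 (u + v) x \<partial>unit_cube)
        = (\<integral>x. rep_L1 u x \<partial>unit_cube) + (\<integral>x. rep_L1 v x \<partial>unit_cube)"
      by (simp add: rep_L1_integrable)
    have "(\<integral>x. rep_L1 (c *\<^sub>R u) x \<partial>unit_cube) = (\<integral>x. c * rep_L1 u x \<partial>unit_cube)"
      using rep_L1_scaleR[of c u] by (intro integral_cong_AE)
        (auto intro!: borel_measurable_integrable borel_measurable_times simp: rep_L1_integrable)
    then show "(\<integral>x. rep_L1 (c *\<^sub>R u) x \<partial>unit_cube) = c *\<^sub>R (\<integral>x. rep_L1 u x \<partial>unit_cube)"
      by simp
    show "norm (\<integral>x. rep_L1 u x \<partial>unit_cube) \<le> norm u * 1"
      using integral_abs_bound[of unit_cube "rep_L1 u"] norm_L1_eq[of u] by simp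
  qed
  moreover have "pairing \<phi> = (\<lambda>u. pairing (\<lambda>_. 1) (mult_L1 \<phi> u))"
    by (intro ext pairing_eq_mult_L1 assms)
  ultimately show ?thesis
    using bounded_linear_compose[OF _ bounded_linear_mult_L1[OF assms]] by metis
qed

lemma pairing_add_left:
  assumes "bounded_measurable \<phi>" "bounded_measurable \<psi>"
  shows "pairing (\<lambda>x. \<phi> x + \<psi> x) u = pairing \<phi> u + pairing \<psi> u"
  unfolding pairing_def using assms
  by (simp add: algebra_simps integrable_mult_rep_L1)

lemma pairing_diff_left:
  assumes "bounded_measurable \<phi>" "bounded_measurable \<psi>"
  shows "pairing (\<lambda>x. \<phi> x - \<psi> x) u = pairing \<phi> u - pairing \<psi> u"
  unfolding pairing_def using assms
  by (simp add: algebra_simps integrable_mult_rep_L1)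

lemma pairing_cmult_left: "pairing (\<lambda>x. c * \<phi> x) u = c * pairing \<phi> u"
  by (simp add: pairing_def mult.assoc)

lemma pairing_sum_left:
  assumes "\<And>i. i \<in> I \<Longrightarrow> bounded_measurable (\<phi> i)"
  shows "pairing (\<lambda>x. \<Sum>i\<in>I. \<phi> i x) u = (\<Sum>i\<in>I. pairing (\<phi> i) u)"
  unfolding pairing_def using assms
  by (simp add: sum_distrib_right integrable_mult_rep_L1 Bochner_Integration.integral_sum)

lemma norm_mult_mono:
  assumes "bounded_measurable \<phi>" "bounded_measurable \<psi>" "\<And>x. \<bar>\<phi> x\<bar> \<le> \<bar>\<psi> x\<bar>"
  shows "norm (mult_L1 \<phi> u) \<le> norm (mult_L1 \<psi> u)"
  unfolding norm_mult_L1[OF assms(1)] norm_mult_L1[OF assms(2)]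
  using integrable_abs[OF integrable_mult_rep_L1[OF assms(1), of u]]
    integrable_abs[OF integrable_mult_rep_L1[OF assms(2), of u]] assms(3)
  by (intro integral_mono) (auto simp: abs_mult intro: mult_right_mono)

section \<open>Dyadic systems of sets and their Haar functions\<close>

text \<open>The nodes of the binary tree are numbered like a heap: the root is \<open>1\<close> and the children of \<open>i\<close> are \<open>2 * i\<close> and
  \<open>Suc (2 * i)\<close>.  The Haar function with index \<open>i \<ge> 1\<close> lives on node \<open>i\<close>, index \<open>0\<close> is the constant function, and the
  usual order of the Haar system is the order of the natural numbers.\<close>

definition mass :: "nat \<Rightarrow> real" where
  "mass i = 1 / 2 ^ floor_log i"

lemma mass_pos [simp]: "mass i > 0"
  by (simp add: mass_def)

lemma mass_nonneg [simp]: "mass i \<ge> 0"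
  by (simp add: mass_def)

lemma mass_nonzero [simp]: "mass i \<noteq> 0"
  by (simp add: mass_def)

lemma mass_0 [simp]: "mass 0 = 1" and mass_1 [simp]: "mass 1 = 1" "mass (Suc 0) = 1"
  by (simp_all add: mass_def)

lemma floor_log_twice_Suc [simp]: "i \<ge> 1 \<Longrightarrow> floor_log (Suc (2 * i)) = Suc (floor_log i)"
  using floor_log_rec[of "Suc (2 * i)"] by simp

lemma mass_twice [simp]: "i \<ge> 1 \<Longrightarrow> mass (2 * i) = mass i / 2"
  and mass_twice_Suc [simp]: "i \<ge> 1 \<Longrightarrow> mass (Suc (2 * i)) = mass i / 2"
  by (simp_all add: mass_def)

text \<open>The nodes \<open>n, \<dots>, 2 * n - 1\<close> are the leaves of the heap with inner nodes \<open>1, \<dots>, n - 1\<close>.  Passing to \<open>n + 1\<close> replaces the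
  leaf \<open>n\<close> by its two children, and the new summand is what this changes.  With \<open>a\<close> the integrals over the nodes and \<open>v\<close> their
  indicators this says that a Haar partial sum is an average over leaves.\<close>

lemma heap_telescope:
  fixes a :: "nat \<Rightarrow> real" and v :: "nat \<Rightarrow> 'v::real_vector"
  assumes a: "\<And>i. i \<ge> 1 \<Longrightarrow> a i = a (2 * i) + a (Suc (2 * i))"
    and v: "\<And>i. i \<ge> 1 \<Longrightarrow> v i = v (2 * i) + v (Suc (2 * i))"
    and "n \<ge> 1"
  shows "a 1 *\<^sub>R v 1 + (\<Sum>i=1..<n. ((a (2 * i) - a (Suc (2 * i))) / mass i) *\<^sub>R (v (2 * i) - v (Suc (2 * i))))
     = (\<Sum>i=n..<2*n. (a i / mass i) *\<^sub>R v i)"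
  using \<open>n \<ge> 1\<close>
proof (induction n rule: nat_induct_at_least)
  case base
  have "{1..<2*1::nat} = {1}" by auto
  then show ?case
    by simp
next
  case (Suc n)
  define x y where "x = v (2 * n)" and "y = v (Suc (2 * n))"
  have leaf: "{n..<2*n} = insert n {Suc n..<2*n}"
    and leaf': "{Suc n..<2*Suc n} = insert (2*n) (insert (Suc (2*n)) {Suc n..<2*n})"
    using Suc.hyps by auto
  have alg: "(P + Q) *\<^sub>R (x + y) + (P - Q) *\<^sub>R (x - y) = (P + P) *\<^sub>R x + (Q + Q) *\<^sub>R y" for P Q :: real
    by (simp only: scaleR_add_left scaleR_left_diff_distrib scaleR_add_right
        scaleR_right_diff_distrib) (simp add: algebra_simps)
  have "(a n / mass n) *\<^sub>R v n + ((a (2 * n) - a (Suc (2 * n))) / mass n) *\<^sub>R (x - y)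
      = (a (2*n) / mass (2*n)) *\<^sub>R x + (a (Suc (2*n)) / mass (Suc (2*n))) *\<^sub>R y"
    using alg[of "a (2*n) / mass n" "a (Suc (2*n)) / mass n"] a[OF Suc.hyps] v[OF Suc.hyps]
    by (simp add: x_def y_def add_divide_distrib diff_divide_distrib
        mass_twice[OF Suc.hyps] mass_twice_Suc[OF Suc.hyps] mult.commute[of _ 2])
  moreover define F where "F i = ((a (2 * i) - a (Suc (2 * i))) / mass i) *\<^sub>R (v (2 * i) - v (Suc (2 * i)))" for i
  moreover define G where "G i = (a i / mass i) *\<^sub>R v i" for i
  ultimately have step: "G n + F n = G (2 * n) + G (Suc (2 * n))"
    by (simp add: x_def y_def)
  have "a 1 *\<^sub>R v 1 + sum F {1..<n} = G n + sum G {Suc n..<2*n}"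
    using Suc.IH Suc.hyps unfolding leaf F_def[symmetric] G_def[symmetric] by simp
  then have "a 1 *\<^sub>R v 1 + sum F {1..<Suc n} = sum G {Suc n..<2*Suc n}"
    using step Suc.hyps unfolding leaf' by (simp add: add.assoc[symmetric])
  then show ?case
    unfolding F_def G_def .
qed

lemma heap_leaves_sum:
  fixes a :: "nat \<Rightarrow> 'v::ab_group_add"
  assumes a: "\<And>i. i \<ge> 1 \<Longrightarrow> a i = a (2 * i) + a (Suc (2 * i))" and "n \<ge> 1"
  shows "(\<Sum>i=n..<2*n. a i) = a 1"
  using \<open>n \<ge> 1\<close>
proof (induction n rule: nat_induct_at_least)
  case base
  have "{1..<2*1::nat} = {1}" by auto
  then show ?case
    by simp
next
  case (Suc n)
  have leaf: "{n..<2*n} = insert n {Suc n..<2*n}"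
    and leaf': "{Suc n..<2*Suc n} = insert (2*n) (insert (Suc (2*n)) {Suc n..<2*n})"
    using Suc.hyps by auto
  show ?case
    using Suc.IH Suc.hyps a[of n] unfolding leaf leaf' by (simp add: algebra_simps)
qed

locale dyadic_sets =
  fixes C :: "nat \<Rightarrow> 'a::euclidean_space set"
  assumes borel: "\<And>i. i \<ge> 1 \<Longrightarrow> C i \<in> sets borel"
    and split: "\<And>i. i \<ge> 1 \<Longrightarrow> C i = C (2 * i) \<union> C (Suc (2 * i))"
    and disjoint: "\<And>i. i \<ge> 1 \<Longrightarrow> C (2 * i) \<inter> C (Suc (2 * i)) = {}"
    and measure: "\<And>i. i \<ge> 1 \<Longrightarrow> (\<integral>x. indicator (C i) x \<partial>unit_cube) = mass i"
begin

lemma bounded_measurable_ind: "i \<ge> 1 \<Longrightarrow> bounded_measurable (indicator (C i))"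
  by (intro bounded_measurable_indicator borel)

lemma indicator_split:
  "i \<ge> 1 \<Longrightarrow> indicator (C i) x = indicator (C (2 * i)) x + (indicator (C (Suc (2 * i))) x :: real)"
  using split[of i] disjoint[of i] by (auto simp: indicator_def)

end

text \<open>The sign function \<open>\<rho>\<close> is a factor of the whole system.  It lets a copy of the Haar system map the constant
  function to an oscillating one.\<close>

definition signed_haar :: "(nat \<Rightarrow> 'a set) \<Rightarrow> ('a \<Rightarrow> real) \<Rightarrow> nat \<Rightarrow> 'a \<Rightarrow> real" where
  "signed_haar C \<rho> i x = \<rho> x * (if i = 0 then indicator (C 1) x
     else indicator (C (2 * i)) x - indicator (C (Suc (2 * i))) x)"

locale signed_dyadic = dyadic_sets C for C :: "nat \<Rightarrow> 'a::euclidean_space set" +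
  fixes \<rho> :: "'a \<Rightarrow> real"
  assumes sign_measurable: "bounded_measurable \<rho>"
    and sign_bound: "\<And>x. \<bar>\<rho> x\<bar> \<le> 1"
begin

lemma bounded_measurable_signed_ind:
  "i \<ge> 1 \<Longrightarrow> bounded_measurable (\<lambda>x. \<rho> x * indicator (C i) x)"
  by (intro bounded_measurable_mult sign_measurable bounded_measurable_ind)

lemma bounded_measurable_signed_haar: "bounded_measurable (signed_haar C \<rho> i)"
  unfolding signed_haar_def
  by (cases "i = 0") (auto intro!: bounded_measurable_mult sign_measurable
      bounded_measurable_ind bounded_measurable_diff)

lemma abs_signed_haar_le: "\<bar>signed_haar C \<rho> i x\<bar> \<le> 1"
  using sign_bound[of x] unfolding signed_haar_def abs_mult
  by (auto simp: indicator_def)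

lemma signed_haar_pos: "i \<ge> 1 \<Longrightarrow> signed_haar C \<rho> i
    = (\<lambda>x. \<rho> x * indicator (C (2 * i)) x - \<rho> x * indicator (C (Suc (2 * i))) x)"
  by (auto simp: signed_haar_def algebra_simps)

lemma signed_haar_0: "signed_haar C \<rho> 0 = (\<lambda>x. \<rho> x * indicator (C 1) x)"
  by (simp add: signed_haar_def fun_eq_iff)

lemma norm_mult_split:
  assumes "i \<ge> 1"
  shows "norm (mult_L1 (\<lambda>x. \<rho> x * indicator (C i) x) u)
      = norm (mult_L1 (\<lambda>x. \<rho> x * indicator (C (2*i)) x) u)
      + norm (mult_L1 (\<lambda>x. \<rho> x * indicator (C (Suc (2*i))) x) u)"
proof -
  have int: "integrable unit_cube (\<lambda>x. \<bar>\<rho> x\<bar> * indicator (C j) x * \<bar>rep_L1 u x\<bar>)" if "j \<ge> 1" for j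
    using integrable_abs[OF integrable_mult_rep_L1[OF bounded_measurable_signed_ind[OF that], of u]]
    by (simp add: abs_mult)
  have "(\<integral>x. \<bar>\<rho> x * indicator (C i) x\<bar> * \<bar>rep_L1 u x\<bar> \<partial>unit_cube)
      = (\<integral>x. \<bar>\<rho> x\<bar> * indicator (C (2*i)) x * \<bar>rep_L1 u x\<bar>
          + \<bar>\<rho> x\<bar> * indicator (C (Suc (2*i))) x * \<bar>rep_L1 u x\<bar> \<partial>unit_cube)"
    by (intro Bochner_Integration.integral_cong)
       (simp, simp add: abs_mult, subst indicator_split[OF assms], simp add: algebra_simps)
  also have "\<dots> = (\<integral>x. \<bar>\<rho> x\<bar> * indicator (C (2*i)) x * \<bar>rep_L1 u x\<bar> \<partial>unit_cube)
      + (\<integral>x. \<bar>\<rho> x\<bar> * indicator (C (Suc (2*i))) x * \<bar>rep_L1 u x\<bar> \<partial>unit_cube)"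
    using assms by (intro Bochner_Integration.integral_add int) auto
  finally show ?thesis
    using assms by (simp add: norm_mult_L1 bounded_measurable_signed_ind abs_mult)
qed

lemma sum_norm_leaves_le:
  assumes "n \<ge> 1"
  shows "(\<Sum>i=n..<2*n. norm (mult_L1 (\<lambda>x. \<rho> x * indicator (C i) x) u)) \<le> norm u"
proof -
  from heap_leaves_sum[of "\<lambda>i. norm (mult_L1 (\<lambda>x. \<rho> x * indicator (C i) x) u)", OF norm_mult_split assms]
  have "(\<Sum>i=n..<2*n. norm (mult_L1 (\<lambda>x. \<rho> x * indicator (C i) x) u))
      = norm (mult_L1 (\<lambda>x. \<rho> x * indicator (C 1) x) u)" .
  also have "\<dots> \<le> 1 * norm u"
    using sign_bound
    by (intro norm_mult_L1_le bounded_measurable_signed_ind) (auto simp: abs_mult indicator_def)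
  finally show ?thesis
    by simp
qed

lemma norm_signed_ind_le:
  assumes "i \<ge> 1"
  shows "norm (to_L1 (\<lambda>x. \<rho> x * indicator (C i) x)) \<le> mass i"
proof -
  have "norm (to_L1 (\<lambda>x. \<rho> x * indicator (C i) x)) = (\<integral>x. \<bar>\<rho> x * indicator (C i) x\<bar> \<partial>unit_cube)"
    by (intro norm_to_L1 integrable_bounded_measurable bounded_measurable_signed_ind assms)
  also have "\<dots> \<le> (\<integral>x. indicator (C i) x \<partial>unit_cube)"
    using assms sign_bound
    by (intro integral_mono integrable_abs integrable_bounded_measurable
        bounded_measurable_signed_ind bounded_measurable_ind)
       (auto simp: abs_mult indicator_def)
  finally show ?thesis
    using measure[OF assms] by simp
qed

end

text \<open>The first \<open>n\<close> terms of the linear map that sends one Haar system to another one.  It serves as Haar expansion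
  (both systems equal), as embedding of \<open>L\<^sup>1\<close> onto a copy, and as its left inverse.\<close>

definition haar_transfer ::
  "(nat \<Rightarrow> 'a::euclidean_space set) \<Rightarrow> ('a \<Rightarrow> real) \<Rightarrow> (nat \<Rightarrow> 'a set) \<Rightarrow> ('a \<Rightarrow> real) \<Rightarrow> nat \<Rightarrow> 'a L1 \<Rightarrow> 'a L1"
  where "haar_transfer C \<rho> C' \<rho>' n u =
    (\<Sum>i<n. (pairing (signed_haar C \<rho> i) u / mass i) *\<^sub>R to_L1 (signed_haar C' \<rho>' i))"

lemma bounded_linear_haar_transfer:
  assumes "signed_dyadic C \<rho>"
  shows "bounded_linear (haar_transfer C \<rho> C' \<rho>' n)"
  unfolding haar_transfer_def divide_inverse
  by (intro bounded_linear_sum bounded_linear_scaleR_const bounded_linear_mult_const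
      bounded_linear_pairing signed_dyadic.bounded_measurable_signed_haar assms)

lemma haar_transfer_eq_leaves:
  assumes "signed_dyadic C \<rho>" "signed_dyadic C' \<rho>'" "n \<ge> 1"
  shows "haar_transfer C \<rho> C' \<rho>' n u = (\<Sum>i=n..<2*n.
    (pairing (\<lambda>x. \<rho> x * indicator (C i) x) u / mass i) *\<^sub>R to_L1 (\<lambda>x. \<rho>' x * indicator (C' i) x))"
proof -
  interpret S: signed_dyadic C \<rho> by fact
  interpret S': signed_dyadic C' \<rho>' by fact
  define a where "a i = pairing (\<lambda>x. \<rho> x * indicator (C i) x) u" for i
  define v where "v i = to_L1 (\<lambda>x. \<rho>' x * indicator (C' i) x)" for i
  have a: "a i = a (2 * i) + a (Suc (2 * i))" if "i \<ge> 1" for i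
    unfolding a_def using that
    by (subst pairing_add_left[symmetric])
       (auto simp: S.indicator_split[OF that] algebra_simps intro!: S.bounded_measurable_signed_ind)
  have v: "v i = v (2 * i) + v (Suc (2 * i))" if "i \<ge> 1" for i
    unfolding v_def using that
    by (subst to_L1_add)
       (auto simp: S'.indicator_split[OF that] algebra_simps
        intro!: integrable_bounded_measurable S'.bounded_measurable_signed_ind)
  have coef: "pairing (signed_haar C \<rho> i) u = a (2 * i) - a (Suc (2 * i))" if "i \<ge> 1" for i
    unfolding a_def S.signed_haar_pos[OF that] using that
    by (intro pairing_diff_left S.bounded_measurable_signed_ind) auto
  have vec: "to_L1 (signed_haar C' \<rho>' i) = v (2 * i) - v (Suc (2 * i))" if "i \<ge> 1" for i
    unfolding v_def S'.signed_haar_pos[OF that] using that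
    by (subst to_L1_diff) (auto intro!: integrable_bounded_measurable S'.bounded_measurable_signed_ind)
  have "haar_transfer C \<rho> C' \<rho>' n u
      = a 1 *\<^sub>R v 1 + (\<Sum>i=1..<n. (pairing (signed_haar C \<rho> i) u / mass i) *\<^sub>R to_L1 (signed_haar C' \<rho>' i))"
  proof -
    have "{..<n} = insert 0 {1..<n}"
      using assms by auto
    then show ?thesis
      by (simp add: haar_transfer_def S.signed_haar_0 S'.signed_haar_0 a_def v_def)
  qed
  also have "\<dots> = (\<Sum>i=n..<2*n. (a i / mass i) *\<^sub>R v i)"
    using assms by (subst heap_telescope[of a v n, OF a v, symmetric]) (auto simp: coef vec)
  finally show ?thesis
    by (simp add: a_def v_def)
qed

text \<open>By the previous identity the map takes averages over the disjoint leaves of one system and places them on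
  leaves of the same measure of the other one.\<close>

lemma norm_haar_transfer_le:
  assumes "signed_dyadic C \<rho>" "signed_dyadic C' \<rho>'"
  shows "norm (haar_transfer C \<rho> C' \<rho>' n u) \<le> norm u"
proof (cases "n = 0")
  case True
  then show ?thesis
    by (simp add: haar_transfer_def)
next
  case False
  interpret S: signed_dyadic C \<rho> by fact
  interpret S': signed_dyadic C' \<rho>' by fact
  have "haar_transfer C \<rho> C' \<rho>' n u = (\<Sum>i=n..<2*n.
      (pairing (\<lambda>x. \<rho> x * indicator (C i) x) u / mass i) *\<^sub>R to_L1 (\<lambda>x. \<rho>' x * indicator (C' i) x))"
    using False by (intro haar_transfer_eq_leaves assms) auto
  also have "norm \<dots> \<le> (\<Sum>i=n..<2*n. norm (mult_L1 (\<lambda>x. \<rho> x * indicator (C i) x) u))"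
  proof (rule sum_norm_le)
    fix i assume "i \<in> {n..<2*n}"
    then have i: "i \<ge> 1"
      using False by auto
    have "norm ((pairing (\<lambda>x. \<rho> x * indicator (C i) x) u / mass i) *\<^sub>R to_L1 (\<lambda>x. \<rho>' x * indicator (C' i) x))
        \<le> \<bar>pairing (\<lambda>x. \<rho> x * indicator (C i) x) u\<bar> / mass i * mass i"
      using S'.norm_signed_ind_le[OF i] by (simp add: divide_simps mult_left_mono)
    then show "norm ((pairing (\<lambda>x. \<rho> x * indicator (C i) x) u / mass i) *\<^sub>R to_L1 (\<lambda>x. \<rho>' x * indicator (C' i) x))
        \<le> norm (mult_L1 (\<lambda>x. \<rho> x * indicator (C i) x) u)"
      using abs_pairing_le[OF S.bounded_measurable_signed_ind[OF i], of u] by simp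
  qed
  also have "\<dots> \<le> norm u"
    using False by (intro S.sum_norm_leaves_le) auto
  finally show ?thesis .
qed

lemma closed_subspace_convergent:
  fixes U :: "nat \<Rightarrow> 'v::real_normed_vector \<Rightarrow> 'w::banach"
  assumes lin: "\<And>n. bounded_linear (U n)" and bound: "\<And>n u. norm (U n u) \<le> norm u"
  shows "closed {u. convergent (\<lambda>n. U n u)}" "subspace {u. convergent (\<lambda>n. U n u)}"
proof -
  interpret bounded_linear "U n" for n by (rule lin)
  show "subspace {u. convergent (\<lambda>n. U n u)}"
    by (auto simp: subspace_def add zero scaleR convergent_const
        intro!: convergent_add bounded_linear.convergent[OF bounded_linear_scaleR_right])
  show "closed {u. convergent (\<lambda>n. U n u)}"
    unfolding closed_sequential_limits
  proof safe
    fix f u assume f: "\<forall>k. f k \<in> {u. convergent (\<lambda>n. U n u)}" and "f \<longlonglongrightarrow> u"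
    have "Cauchy (\<lambda>n. U n u)"
      unfolding Cauchy_def
    proof safe
      fix e :: real assume "e > 0"
      then obtain k where k: "norm (f k - u) < e / 3"
        using LIMSEQ_D[OF \<open>f \<longlonglongrightarrow> u\<close>, of "e / 3"] by auto
      obtain N where N: "\<forall>m\<ge>N. \<forall>n\<ge>N. norm (U m (f k) - U n (f k)) < e / 3"
        using f \<open>e > 0\<close> CauchyD[OF convergent_Cauchy[of "\<lambda>n. U n (f k)"], of "e / 3"] by auto
      show "\<exists>M. \<forall>m\<ge>M. \<forall>n\<ge>M. dist (U m u) (U n u) < e"
      proof (intro exI allI impI)
        fix m n assume "N \<le> m" "N \<le> n"
        have "U m u - U n u = U m (u - f k) + (U m (f k) - U n (f k)) + U n (f k - u)"
          by (simp add: diff)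
        also have "norm \<dots> \<le> norm (U m (u - f k)) + norm (U m (f k) - U n (f k)) + norm (U n (f k - u))"
          by (meson norm_triangle_mono norm_triangle_ineq order_refl)
        also have "\<dots> < e"
          using bound[of m "u - f k"] bound[of n "f k - u"] k N[rule_format, OF \<open>N \<le> m\<close> \<open>N \<le> n\<close>]
          unfolding norm_minus_commute[of u] by linarith
        finally show "dist (U m u) (U n u) < e"
          by (simp add: dist_norm)
      qed
    qed
    then show "convergent (\<lambda>n. U n u)"
      by (rule Cauchy_convergent)
  qed
qed

text \<open>The step functions of a tree span a dense subspace; the form given here is the one in which density is used.\<close>

locale dyadic_tree = dyadic_sets A for A :: "nat \<Rightarrow> 'a::euclidean_space set" +
  assumes dense: "\<And>V u. closed V \<Longrightarrow> subspace V \<Longrightarrow>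
    (\<And>i. i \<ge> 1 \<Longrightarrow> to_L1 (indicator (A i)) \<in> V) \<Longrightarrow> u \<in> V"
begin

sublocale unsigned: signed_dyadic A "\<lambda>_. 1"
  by unfold_locales auto

abbreviation chi :: "nat \<Rightarrow> 'a L1" where
  "chi i \<equiv> to_L1 (indicator (A i))"

abbreviation h :: "nat \<Rightarrow> 'a \<Rightarrow> real" where
  "h \<equiv> signed_haar A (\<lambda>_. 1)"

lemma limit_operator:
  fixes U :: "nat \<Rightarrow> 'a L1 \<Rightarrow> 'a L1"
  assumes lin: "\<And>n. bounded_linear (U n)" and bound: "\<And>n u. norm (U n u) \<le> norm u"
    and conv: "\<And>i. i \<ge> 1 \<Longrightarrow> convergent (\<lambda>n. U n (chi i))"
  obtains V where "bounded_linear V" "\<And>u. norm (V u) \<le> norm u" "\<And>u. (\<lambda>n. U n u) \<longlonglongrightarrow> V u"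
proof
  interpret bounded_linear "U n" for n by (rule lin)
  have "convergent (\<lambda>n. U n u)" for u
    using dense[OF closed_subspace_convergent[of U, OF lin bound], of u] conv by simp
  then show lim: "(\<lambda>n. U n u) \<longlonglongrightarrow> lim (\<lambda>n. U n u)" for u
    by (simp add: convergent_LIMSEQ_iff)
  show le: "norm (lim (\<lambda>n. U n u)) \<le> norm u" for u
    by (rule LIMSEQ_le_const2[OF tendsto_norm[OF lim]]) (auto simp: bound)
  show "bounded_linear (\<lambda>u. lim (\<lambda>n. U n u))"
  proof (rule bounded_linear_intro[where K = 1])
    show "lim (\<lambda>n. U n (u + v)) = lim (\<lambda>n. U n u) + lim (\<lambda>n. U n v)" for u v
      using tendsto_add[OF lim[of u] lim[of v]] by (intro limI) (simp add: add)
    show "lim (\<lambda>n. U n (c *\<^sub>R u)) = c *\<^sub>R lim (\<lambda>n. U n u)" for c u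
      using tendsto_scaleR[OF tendsto_const[of c] lim[of u]] by (intro limI) (simp add: scaleR)
  qed (use le in simp)
qed

end

section \<open>Functions adapted to a dyadic tree\<close>

lemma sum_eq_1_disjoint:
  fixes f :: "nat \<Rightarrow> 'a set"
  assumes "finite I" "(\<Sum>i\<in>I. indicator (f i) x) = (1::real)" "i \<in> I" "j \<in> I" "x \<in> f i" "x \<in> f j"
  shows "i = j"
proof (rule ccontr)
  assume "i \<noteq> j"
  have "(\<Sum>k\<in>{i, j}. indicator (f k) x) \<le> (\<Sum>k\<in>I. indicator (f k) x :: real)"
    using assms by (intro sum_mono2) auto
  then show False
    using assms \<open>i \<noteq> j\<close> by simp
qed

context dyadic_sets
begin

lemma sum_indicator_leaves:
  assumes "n \<ge> 1"
  shows "(\<Sum>i=n..<2*n. indicator (C i) x) = (indicator (C 1) x :: real)"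
  using heap_leaves_sum[of "\<lambda>i. indicator (C i) x :: real", OF indicator_split assms] by simp

lemma measure_space: "i \<ge> 1 \<Longrightarrow> Sigma_Algebra.measure unit_cube (C i \<inter> space unit_cube) = mass i"
  using measure[of i] by simp

lemma subset_parent: "i \<ge> 2 \<Longrightarrow> C i \<subseteq> C (i div 2)"
  using split[of "i div 2"] by (cases "even i") (auto elim!: evenE oddE)

lemma subset_root: "i \<ge> 1 \<Longrightarrow> C i \<subseteq> C 1"
proof (induction i rule: less_induct)
  case (less i)
  show ?case
  proof (cases "i = 1")
    case False
    then show ?thesis
      using subset_parent[of i] less.IH[of "i div 2"] less.prems by force
  qed simp
qed

lemma leaves_disjoint:
  assumes "n \<ge> 1" "i \<in> {n..<2*n}" "j \<in> {n..<2*n}" "i \<noteq> j"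
  shows "C i \<inter> C j = {}"
proof (rule ccontr)
  assume "C i \<inter> C j \<noteq> {}"
  then obtain x where x: "x \<in> C i" "x \<in> C j"
    by auto
  then have "x \<in> C 1"
    using subset_root[of i] assms by auto
  then show False
    using sum_eq_1_disjoint[of "{n..<2*n}" C x i j] sum_indicator_leaves[OF assms(1), of x] x assms
    by simp
qed

text \<open>An index \<open>j < 2 * i\<close> is a leaf beside \<open>i\<close>; a larger one lies below its parent, to which induction applies.\<close>

lemma nested:
  assumes "1 \<le> i" "i \<le> j"
  shows "C j \<subseteq> C i \<or> C i \<inter> C j = {}"
  using assms(2)
proof (induction j rule: less_induct)
  case (less j)
  show ?case
  proof (cases "j < 2 * i")
    case True
    then show ?thesis
      using leaves_disjoint[of i i j] less.prems assms by (cases "i = j") auto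
  next
    case False
    then show ?thesis
      using less.IH[of "j div 2"] subset_parent[of j] assms by force
  qed
qed

lemma leaf_exists:
  assumes "n \<ge> 1" "x \<in> C 1"
  obtains i where "i \<in> {n..<2*n}" "x \<in> C i"
proof -
  have "(\<Sum>i=n..<2*n. indicator (C i) x) \<noteq> (0::real)"
    using assms by (simp add: sum_indicator_leaves)
  then obtain i where "i \<in> {n..<2*n}" "indicator (C i) x \<noteq> (0::real)"
    by (rule sum.not_neutral_contains_not_neutral)
  then show ?thesis
    by (intro that[of i]) (auto simp: indicator_def split: if_splits)
qed

end

context dyadic_tree
begin

text \<open>Measurability with respect to the partition of the root into the leaves \<open>n, \<dots>, 2 * n - 1\<close>.  Every node with an
  index \<open>\<ge> n\<close> lies below such a leaf; asking for constancy on all of them makes monotonicity in \<open>n\<close> evident.\<close>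

definition adapted :: "nat \<Rightarrow> ('a \<Rightarrow> real) \<Rightarrow> bool" where
  "adapted n f \<longleftrightarrow> (\<forall>x. x \<notin> A 1 \<longrightarrow> f x = 0) \<and> (\<forall>i\<ge>n. \<forall>x\<in>A i. \<forall>y\<in>A i. f x = f y)"

lemma adaptedI:
  assumes "\<And>x. x \<notin> A 1 \<Longrightarrow> f x = 0"
    and "\<And>i x y. i \<ge> n \<Longrightarrow> x \<in> A i \<Longrightarrow> y \<in> A i \<Longrightarrow> f x = f y"
  shows "adapted n f"
  using assms unfolding adapted_def by blast

lemma adaptedD1: "adapted n f \<Longrightarrow> x \<notin> A 1 \<Longrightarrow> f x = 0"
  and adaptedD2: "adapted n f \<Longrightarrow> i \<ge> n \<Longrightarrow> x \<in> A i \<Longrightarrow> y \<in> A i \<Longrightarrow> f x = f y"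
  unfolding adapted_def by blast+

lemma adapted_mono: "adapted n f \<Longrightarrow> n \<le> m \<Longrightarrow> adapted m f"
  unfolding adapted_def using order_trans by blast

lemma adapted_indicator:
  assumes "i \<ge> 1"
  shows "adapted i (indicator (A i))"
proof (rule adaptedI)
  show "indicator (A i) x = (0::real)" if "x \<notin> A 1" for x
    using subset_root[OF assms] that by (auto simp: indicator_def)
  show "indicator (A i) x = (indicator (A i) y :: real)" if "j \<ge> i" "x \<in> A j" "y \<in> A j" for j x y
    using nested[OF assms that(1)] that by (auto simp: indicator_def)
qed

lemma h_pos: "i \<ge> 1 \<Longrightarrow> h i = (\<lambda>x. indicator (A (2 * i)) x - indicator (A (Suc (2 * i))) x)"
  and h_0: "h 0 = indicator (A 1)"
  by (auto simp: signed_haar_def fun_eq_iff)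

lemma adapted_comp:
  assumes "adapted n f" "F 0 = 0"
  shows "adapted n (\<lambda>x. F (f x))"
proof (rule adaptedI)
  show "F (f x) = 0" if "x \<notin> A 1" for x
    using adaptedD1[OF assms(1) that] assms(2) by simp
  show "F (f x) = F (f y)" if "i \<ge> n" "x \<in> A i" "y \<in> A i" for i x y
    using adaptedD2[OF assms(1) that] by simp
qed

lemma adapted_comp2:
  assumes "adapted n f" "adapted n g" "F 0 0 = 0"
  shows "adapted n (\<lambda>x. F (f x) (g x))"
proof (rule adaptedI)
  show "F (f x) (g x) = 0" if "x \<notin> A 1" for x
    using adaptedD1[OF assms(1) that] adaptedD1[OF assms(2) that] assms(3) by simp
  show "F (f x) (g x) = F (f y) (g y)" if "i \<ge> n" "x \<in> A i" "y \<in> A i" for i x y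
    using adaptedD2[OF assms(1) that] adaptedD2[OF assms(2) that] by simp
qed

lemma adapted_sum:
  assumes "\<And>i. i \<in> I \<Longrightarrow> adapted n (f i)"
  shows "adapted n (\<lambda>x. \<Sum>i\<in>I. f i x)"
  by (rule adaptedI) (auto intro!: sum.cong sum.neutral intro: adaptedD1[OF assms] adaptedD2[OF assms])

text \<open>On later leaves \<open>i < j < 2 * i\<close> the function vanishes.  On deeper nodes it is a combination of the indicators of \<open>A (2 * i)\<close>
  and \<open>A i\<close>, which avoids the index \<open>Suc (2 * i)\<close>.\<close>

lemma adapted_h: "adapted (Suc i) (h i)"
proof (cases "i = 0")
  case True
  then show ?thesis
    using adapted_indicator[of 1] h_0 by simp
next
  case False
  have sub: "A (2 * i) \<subseteq> A i" "A (Suc (2 * i)) \<subseteq> A i"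
    using subset_parent[of "2 * i"] subset_parent[of "Suc (2 * i)"] False by auto
  have "h i x = h i y" if j: "j \<ge> Suc i" and xy: "x \<in> A j" "y \<in> A j" for j x y
  proof (cases "j < 2 * i")
    case True
    then have "A i \<inter> A j = {}"
      using leaves_disjoint[of i i j] j False by auto
    then show ?thesis
      using sub xy False by (auto simp: h_pos indicator_def)
  next
    case jge: False
    have "h i z = 2 * indicator (A (2 * i)) z - indicator (A i) z" for z
      using False by (simp add: h_pos indicator_split[of i])
    moreover have "indicator (A (2 * i)) x = (indicator (A (2 * i)) y :: real)"
      using adaptedD2[OF adapted_indicator[of "2 * i"] _ xy] jge False by simp
    moreover have "indicator (A i) x = (indicator (A i) y :: real)"
      using adaptedD2[OF adapted_indicator[of i] _ xy] jge False by simp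
    ultimately show ?thesis
      by simp
  qed
  moreover have "h i x = 0" if "x \<notin> A 1" for x
    using that sub subset_root[of i] False by (auto simp: h_pos indicator_def)
  ultimately show ?thesis
    by (intro adaptedI)
qed

lemma adapted_eq_sum:
  assumes "adapted n f" "n \<ge> 1"
  shows "f x = (\<Sum>i=n..<2*n. f (SOME y. y \<in> A i) * indicator (A i) x)"
proof (cases "x \<in> A 1")
  case True
  have "(\<Sum>i=n..<2*n. f (SOME y. y \<in> A i) * indicator (A i) x) = (\<Sum>i=n..<2*n. f x * indicator (A i) x)"
  proof (intro sum.cong refl)
    fix i assume "i \<in> {n..<2*n}"
    then show "f (SOME y. y \<in> A i) * indicator (A i) x = f x * indicator (A i) x"
      using adaptedD2[OF assms(1), of i x "SOME y. y \<in> A i"] someI[of "\<lambda>y. y \<in> A i" x]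
      by (cases "x \<in> A i") auto
  qed
  also have "\<dots> = f x"
    using True sum_indicator_leaves[OF assms(2), of x] by (simp flip: sum_distrib_left)
  finally show ?thesis
    by simp
next
  case False
  then have "f x = 0"
    by (rule adaptedD1[OF assms(1)])
  moreover have "x \<notin> A i" if "i \<in> {n..<2*n}" for i
    using False subset_root[of i] assms(2) that by auto
  ultimately show ?thesis
    by simp
qed

lemma adapted_bounded_measurable:
  assumes "adapted n f"
  shows "bounded_measurable f"
proof -
  have "adapted (Suc n) f"
    using assms by (rule adapted_mono) simp
  then have eq: "f = (\<lambda>x. \<Sum>i=Suc n..<2*Suc n. f (SOME y. y \<in> A i) * indicator (A i) x)"
    by (intro ext adapted_eq_sum) simp_all
  show ?thesis
    by (subst eq) (intro bounded_measurable_sum bounded_measurable_mult bounded_measurable_const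
        bounded_measurable_ind, auto)
qed

lemma integral_h_zero: "i \<ge> 1 \<Longrightarrow> (\<integral>x. h i x \<partial>unit_cube) = 0"
  using measure[of "2 * i"] measure[of "Suc (2 * i)"]
  by (simp add: h_pos integrable_bounded_measurable bounded_measurable_ind)

lemma h_eq_0: "i \<ge> 1 \<Longrightarrow> x \<notin> A i \<Longrightarrow> h i x = 0"
  using split[of i] by (auto simp: h_pos indicator_def)

lemma abs_h: "i \<ge> 1 \<Longrightarrow> \<bar>h i x\<bar> = indicator (A i) x"
  using split[of i] disjoint[of i] by (auto simp: h_pos indicator_def)

lemma integral_h_adapted:
  assumes "adapted n s" "i \<ge> n" "i \<ge> 1"
  shows "(\<integral>x. h i x * s x \<partial>unit_cube) = 0"
proof -
  have eq: "h i x * s x = s (SOME y. y \<in> A i) * h i x" for x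
    using adaptedD2[OF assms(1,2), of x "SOME y. y \<in> A i"] h_eq_0[OF assms(3), of x]
      someI[of "\<lambda>y. y \<in> A i" x]
    by (cases "x \<in> A i") auto
  then show ?thesis
    unfolding eq using assms by (simp add: integral_h_zero del: One_nat_def)
qed

lemma integral_h_h:
  "(\<integral>x. h i x * h j x \<partial>unit_cube) = (if i = j then mass i else 0)"
proof (cases i j rule: linorder_cases)
  case less
  then show ?thesis
    using integral_h_adapted[OF adapted_h[of i], of j] by (simp add: mult.commute)
next
  case greater
  then show ?thesis
    using integral_h_adapted[OF adapted_h[of j], of i] by simp
next
  case equal
  have "h i x * h i x = indicator (A (max 1 i)) x" for x
  proof (cases "i = 0")
    case False
    then have "h i x * h i x = indicator (A i) x * indicator (A i) x"
      using abs_h[of i x] by (metis abs_mult_self_eq less_one not_le)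
    then show ?thesis
      using False by (simp add: indicator_def max_def)
  qed (simp add: h_0 indicator_def)
  then have "(\<integral>x. h i x * h i x \<partial>unit_cube) = mass (max 1 i)"
    using measure[of "max 1 i"] by simp
  then show ?thesis
    using equal by (cases "i = 0") (simp_all add: max_def)
qed

abbreviation e :: "nat \<Rightarrow> 'a L1" where
  "e i \<equiv> to_L1 (h i)"

lemma integrable_h: "integrable unit_cube (h i)"
  by (intro integrable_bounded_measurable unsigned.bounded_measurable_signed_haar)

lemma integrable_ind: "i \<ge> 1 \<Longrightarrow> integrable unit_cube (indicator (A i) :: 'a \<Rightarrow> real)"
  by (intro integrable_bounded_measurable bounded_measurable_ind)

lemma pairing_h_e: "pairing (h i) (e j) = (if i = j then mass i else 0)"
  by (simp add: pairing_to_L1 unsigned.bounded_measurable_signed_haar integrable_h integral_h_h)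

lemma norm_chi: "i \<ge> 1 \<Longrightarrow> norm (chi i) = mass i"
  using measure[of i] by (simp add: norm_to_L1 integrable_ind)

lemma norm_e: "norm (e i) = mass i"
proof (cases "i = 0")
  case True
  then show ?thesis
    using norm_chi[of 1] h_0 by simp
next
  case False
  then show ?thesis
    using measure[of i] by (simp add: norm_to_L1 integrable_h abs_h)
qed

lemma chi_split:
  assumes "i \<ge> 1"
  shows "chi i = chi (2 * i) + chi (Suc (2 * i))"
proof -
  have "indicator (A i) = (\<lambda>x. indicator (A (2 * i)) x + indicator (A (Suc (2 * i))) x :: real)"
    by (intro ext indicator_split assms)
  moreover have "chi (2 * i) + chi (Suc (2 * i))
      = to_L1 (\<lambda>x. indicator (A (2 * i)) x + indicator (A (Suc (2 * i))) x)"
    using assms by (intro to_L1_add integrable_ind) auto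
  ultimately show ?thesis
    by metis
qed

lemma e_split:
  assumes "i \<ge> 1"
  shows "e i = chi (2 * i) - chi (Suc (2 * i))"
  unfolding h_pos[OF assms] using assms by (intro to_L1_diff[symmetric] integrable_ind) auto

abbreviation expansion :: "nat \<Rightarrow> 'a L1 \<Rightarrow> 'a L1" where
  "expansion \<equiv> haar_transfer A (\<lambda>_. 1) A (\<lambda>_. 1)"

lemma expansion_eq_leaves:
  "n \<ge> 1 \<Longrightarrow> expansion n u = (\<Sum>i=n..<2*n. (pairing (indicator (A i)) u / mass i) *\<^sub>R chi i)"
  using haar_transfer_eq_leaves[OF unsigned.signed_dyadic_axioms unsigned.signed_dyadic_axioms, of n u]
  by simp

lemma pairing_h_chi: "j \<ge> 1 \<Longrightarrow> i \<ge> j \<Longrightarrow> pairing (h i) (chi j) = 0"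
  using integral_h_adapted[OF adapted_indicator[of j], of i]
  by (simp add: pairing_to_L1 unsigned.bounded_measurable_signed_haar integrable_ind)

lemma expansion_chi:
  assumes "1 \<le> j" "j \<le> n"
  shows "expansion n (chi j) = chi j"
proof -
  have ind: "pairing (indicator (A i)) (chi j) = (if i = j then mass j else 0)" if "i \<in> {j..<2*j}" for i
  proof -
    have "pairing (indicator (A i)) (chi j) = (\<integral>x. indicator (A i) x * indicator (A j) x \<partial>unit_cube)"
      using that assms by (intro pairing_to_L1 bounded_measurable_ind integrable_ind) auto
    also have "(\<lambda>x. indicator (A i) x * indicator (A j) x :: real) = (if i = j then indicator (A j) else (\<lambda>_. 0))"
      using leaves_disjoint[of j i j] that assms by (auto simp: indicator_def fun_eq_iff)
    finally show ?thesis
      using assms by (auto simp: measure_space)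
  qed
  have "expansion j (chi j) = (\<Sum>i=j..<2*j. if i = j then chi i else 0)"
    using assms unfolding expansion_eq_leaves[OF assms(1)] by (intro sum.cong) (auto simp: ind)
  also have "\<dots> = chi j"
    using assms by simp
  finally have "expansion j (chi j) = chi j" .
  moreover have "expansion n (chi j) = expansion j (chi j)"
    unfolding haar_transfer_def using assms
    by (intro sum.mono_neutral_right) (auto simp: pairing_h_chi)
  ultimately show ?thesis
    by simp
qed

lemma bounded_linear_expansion: "bounded_linear (expansion n)"
  by (intro bounded_linear_haar_transfer unsigned.signed_dyadic_axioms)

lemma norm_expansion_le: "norm (expansion n u) \<le> norm u"
  by (intro norm_haar_transfer_le unsigned.signed_dyadic_axioms)

text \<open>The set where the maps agree is a closed subspace.\<close>

lemma bounded_linear_eqI: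
  assumes "bounded_linear F" "bounded_linear G" "\<And>i. i \<ge> 1 \<Longrightarrow> F (chi i) = G (chi i)"
  shows "F u = G u"
proof -
  interpret F: bounded_linear F by fact
  interpret G: bounded_linear G by fact
  have "closed {u. F u = G u}"
    by (intro closed_Collect_eq F.continuous_on G.continuous_on continuous_on_id)
  moreover have "subspace {u. F u = G u}"
    by (auto simp: subspace_def F.add G.add F.scaleR G.scaleR F.zero G.zero)
  ultimately show ?thesis
    using dense[of "{u. F u = G u}" u] assms(3) by auto
qed

lemma expansion_tendsto: "(\<lambda>n. expansion n u) \<longlonglongrightarrow> u"
proof -
  have lim: "(\<lambda>n. expansion n (chi i)) \<longlonglongrightarrow> chi i" if "i \<ge> 1" for i
    by (rule tendsto_eventually) (use that expansion_chi in \<open>auto simp: eventually_sequentially\<close>)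
  obtain V where V: "bounded_linear V" "\<And>u. (\<lambda>n. expansion n u) \<longlonglongrightarrow> V u"
    using limit_operator[of expansion, OF bounded_linear_expansion norm_expansion_le]
      lim convergentI by metis
  have "V (chi i) = chi i" if "i \<ge> 1" for i
    using LIMSEQ_unique[OF V(2) lim[OF that]] .
  then have "V u = u"
    using bounded_linear_eqI[OF V(1) bounded_linear_ident] by simp
  then show ?thesis
    using V(2)[of u] by simp
qed

text \<open>The conditional expectations \<open>expansion n u\<close> are nonpositive, so the positive part of \<open>u\<close> is at most its distance to
  them, which tends to \<open>0\<close>.\<close>

lemma nonpos_if_averages_nonpos:
  assumes "\<And>i. i \<ge> 1 \<Longrightarrow> pairing (indicator (A i)) u \<le> 0"
  shows "AE x in unit_cube. rep_L1 u x \<le> 0"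
proof -
  define f where "f x = max 0 (rep_L1 u x)" for x
  have f: "integrable unit_cube f"
    unfolding f_def by (intro integrable_max rep_L1_integrable integrable_zero)
  have "norm (to_L1 f) \<le> norm (u - expansion n u)" if "n \<ge> 1" for n
  proof -
    define s where "s x = (\<Sum>i=n..<2*n. pairing (indicator (A i)) u / mass i * indicator (A i) x)" for x
    have s: "integrable unit_cube s"
      unfolding s_def using that
      by (intro Bochner_Integration.integrable_sum integrable_mult_right integrable_ind) auto
    have "expansion n u = to_L1 s"
      unfolding expansion_eq_leaves[OF that] s_def using that
      by (subst to_L1_sum[symmetric])
         (auto simp: to_L1_scaleR integrable_ind intro!: integrable_mult_right)
    then have "u - expansion n u = to_L1 (\<lambda>x. rep_L1 u x - s x)"
      using to_L1_diff[OF rep_L1_integrable s, of u] by (simp add: to_L1_rep_L1)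
    moreover have "s x \<le> 0" for x
      unfolding s_def using assms that
      by (intro sum_nonpos mult_nonpos_nonneg divide_nonpos_pos) auto
    then have "\<bar>f x\<bar> \<le> \<bar>rep_L1 u x - s x\<bar>" for x
      unfolding f_def using \<open>s x \<le> 0\<close> by (auto simp: max_def abs_if not_le) (smt (verit))
    then have "(\<integral>x. \<bar>f x\<bar> \<partial>unit_cube) \<le> (\<integral>x. \<bar>rep_L1 u x - s x\<bar> \<partial>unit_cube)"
      by (intro integral_mono integrable_abs f Bochner_Integration.integrable_diff rep_L1_integrable s)
    ultimately show ?thesis
      by (simp add: norm_to_L1 f s rep_L1_integrable)
  qed
  moreover have "(\<lambda>n. norm (u - expansion n u)) \<longlonglongrightarrow> norm (u - u)"
    by (intro tendsto_intros expansion_tendsto)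
  ultimately have "norm (to_L1 f) \<le> norm (u - u)"
    by (intro LIMSEQ_le_const[of "\<lambda>n. norm (u - expansion n u)"]) auto
  then have "to_L1 f = to_L1 (\<lambda>_. 0)"
    by (simp add: to_L1_zero)
  then have "AE x in unit_cube. f x = 0"
    using to_L1_eq_iff[OF f integrable_zero] by simp
  then show ?thesis
    by eventually_elim (simp add: f_def max_def split: if_splits)
qed

lemma AE_lower_bound:
  assumes "\<And>i. i \<ge> 1 \<Longrightarrow> \<delta> * mass i \<le> norm (mult_L1 (indicator (A i)) g)"
  shows "AE x in unit_cube. \<delta> \<le> \<bar>rep_L1 g x\<bar>"
proof -
  define f where "f x = \<delta> - \<bar>rep_L1 g x\<bar>" for x
  have f: "integrable unit_cube f"
    unfolding f_def by (intro Bochner_Integration.integrable_diff integrable_abs rep_L1_integrable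
      finite_measure.integrable_const finite_measure_unit_cube)
  have "pairing (indicator (A i)) (to_L1 f) \<le> 0" if "i \<ge> 1" for i
  proof -
    have "pairing (indicator (A i)) (to_L1 f) = (\<integral>x. indicator (A i) x * f x \<partial>unit_cube)"
      by (intro pairing_to_L1 bounded_measurable_ind that f)
    also have "\<dots> = (\<integral>x. \<delta> * indicator (A i) x - \<bar>indicator (A i) x * rep_L1 g x\<bar> \<partial>unit_cube)"
      by (intro Bochner_Integration.integral_cong) (simp_all add: f_def abs_mult algebra_simps)
    also have "\<dots> = (\<integral>x. \<delta> * indicator (A i) x \<partial>unit_cube)
        - (\<integral>x. \<bar>indicator (A i) x * rep_L1 g x\<bar> \<partial>unit_cube)"
      by (intro Bochner_Integration.integral_diff integrable_mult_right integrable_ind that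
          integrable_abs integrable_mult_rep_L1 bounded_measurable_ind)
    also have "\<dots> = \<delta> * mass i - norm (mult_L1 (indicator (A i)) g)"
      using that by (simp add: norm_mult_L1 bounded_measurable_ind abs_mult measure_space)
    also have "\<dots> \<le> 0"
      using assms[OF that] by simp
    finally show ?thesis .
  qed
  then have "AE x in unit_cube. rep_L1 (to_L1 f) x \<le> 0"
    by (rule nonpos_if_averages_nonpos)
  then show ?thesis
    using rep_to_L1[OF f] by eventually_elim (simp add: f_def)
qed

end

section \<open>The diagonal of an operator\<close>

lemma sum_pairs:
  fixes f :: "nat \<Rightarrow> 'b::comm_monoid_add"
  assumes "a \<le> b"
  shows "sum f {2*a..<2*b} = (\<Sum>i=a..<b. f (2*i) + f (Suc (2*i)))"
  using assms
proof (induction b rule: dec_induct)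
  case (step b)
  have "{2*a..<2*Suc b} = insert (Suc (2*b)) (insert (2*b) {2*a..<2*b})"
    using step by auto
  then show ?case
    using step by (simp add: ac_simps)
qed simp

definition lev :: "nat \<Rightarrow> nat set" where
  "lev n = {2^n..<2*2^n}"

lemma finite_lev [simp]: "finite (lev n)"
  by (simp add: lev_def)

lemma lev_ge_1: "i \<in> lev n \<Longrightarrow> i \<ge> 1"
  unfolding lev_def by (metis atLeastLessThan_iff le_trans one_le_numeral one_le_power)

lemma sum_lev_Suc:
  "sum f (lev (Suc n)) = (\<Sum>i\<in>lev n. f (2*i) + f (Suc (2*i)))"
  using sum_pairs[of "2^n" "2*2^n" f] by (simp add: lev_def)

lemma div_power_twice:
  assumes "n \<le> m"
  shows "(2 * L) div 2 ^ (Suc m - n) = L div (2::nat) ^ (m - n)"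
    and "Suc (2 * L) div 2 ^ (Suc m - n) = L div (2::nat) ^ (m - n)"
  using assms by (simp_all add: Suc_diff_le div_mult2_eq)

lemma ancestor_lev:
  assumes "L \<in> lev m" "n \<le> m"
  shows "L div 2 ^ (m - n) \<in> lev n"
proof -
  have "2 ^ m = 2 ^ n * (2 ^ (m - n) :: nat)"
    using assms by (simp flip: power_add)
  then show ?thesis
    using assms unfolding lev_def
    by (auto simp: less_mult_imp_div_less div_le_mono le_div_geq less_eq_div_iff_mult_less_eq ac_simps)
qed

lemma sum_lev_ancestor:
  fixes F :: "nat \<Rightarrow> nat \<Rightarrow> 'b::comm_monoid_add"
  assumes F: "\<And>K L. K \<ge> 1 \<Longrightarrow> L \<ge> 1 \<Longrightarrow> F K L = F K (2*L) + F K (Suc (2*L))" and "n \<le> m"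
  shows "(\<Sum>L\<in>lev m. F (L div 2 ^ (m - n)) L) = (\<Sum>K\<in>lev n. F K K)"
  using assms(2)
proof (induction m rule: dec_induct)
  case (step m)
  have "(\<Sum>L\<in>lev (Suc m). F (L div 2 ^ (Suc m - n)) L)
      = (\<Sum>L\<in>lev m. F (L div 2 ^ (m - n)) (2*L) + F (L div 2 ^ (m - n)) (Suc (2*L)))"
    using step by (simp only: sum_lev_Suc div_power_twice)
  also have "\<dots> = (\<Sum>L\<in>lev m. F (L div 2 ^ (m - n)) L)"
  proof (intro sum.cong refl F[symmetric])
    fix L assume L: "L \<in> lev m"
    show "L div 2 ^ (m - n) \<ge> 1" "L \<ge> 1"
      using lev_ge_1[OF L] lev_ge_1[OF ancestor_lev[OF L step.hyps(1)]] by auto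
  qed
  finally show ?case
    using step by simp
qed simp

lemma sum_descendants:
  fixes f :: "nat \<Rightarrow> 'b::comm_monoid_add"
  assumes f: "\<And>L. L \<ge> 1 \<Longrightarrow> f L = f (2*L) + f (Suc (2*L))" and "n \<le> m" "K \<in> lev n"
  shows "(\<Sum>L | L \<in> lev m \<and> L div 2 ^ (m - n) = K. f L) = f K"
proof -
  have "(\<Sum>L | L \<in> lev m \<and> L div 2 ^ (m - n) = K. f L)
      = (\<Sum>L\<in>lev m. if L div 2 ^ (m - n) = K then f L else 0)"
    by (subst sum.inter_filter) auto
  also have "\<dots> = (\<Sum>L\<in>lev n. if L = K then f L else 0)"
  proof (rule sum_lev_ancestor[of "\<lambda>K' L. if K' = K then f L else 0" n m, OF _ assms(2)])
    fix K' L :: nat assume "L \<ge> 1"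
    then show "(if K' = K then f L else 0) = (if K' = K then f (2*L) else 0) + (if K' = K then f (Suc (2*L)) else 0)"
      using f[of L] by (cases "K' = K") simp_all
  qed
  finally show ?thesis
    using assms(3) by simp
qed

context dyadic_tree
begin

lemma nonempty: "i \<ge> 1 \<Longrightarrow> A i \<noteq> {}"
  using measure[of i] by auto

lemma subset_ancestor: "L div 2 ^ k \<ge> 1 \<Longrightarrow> A L \<subseteq> A (L div 2 ^ k)"
proof (induction k)
  case (Suc k)
  have eq: "L div 2 ^ Suc k = (L div 2 ^ k) div 2"
    by (simp only: power_Suc2 div_mult2_eq)
  then have "L div 2 ^ k \<ge> 2"
    using Suc.prems by (metis div_less not_le not_one_le_zero)
  then show ?case
    using Suc.IH subset_parent[of "L div 2 ^ k"] unfolding eq by force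
qed simp

lemma lev_disjoint: "i \<in> lev n \<Longrightarrow> j \<in> lev n \<Longrightarrow> i \<noteq> j \<Longrightarrow> A i \<inter> A j = {}"
  using leaves_disjoint[of "2^n" i j] by (simp add: lev_def)

lemma lev_nested:
  assumes "L \<in> lev m" "n \<le> m" "K \<in> lev n"
  shows "L div 2 ^ (m - n) = K \<Longrightarrow> A L \<subseteq> A K"
    and "L div 2 ^ (m - n) \<noteq> K \<Longrightarrow> A L \<inter> A K = {}"
proof -
  have sub: "A L \<subseteq> A (L div 2 ^ (m - n))"
    by (intro subset_ancestor lev_ge_1[of _ n] ancestor_lev assms)
  then show "L div 2 ^ (m - n) = K \<Longrightarrow> A L \<subseteq> A K"
    by simp
  show "L div 2 ^ (m - n) \<noteq> K \<Longrightarrow> A L \<inter> A K = {}"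
    using sub lev_disjoint[OF ancestor_lev[OF assms(1,2)] assms(3)] by auto
qed

abbreviation restr :: "nat \<Rightarrow> 'a L1 \<Rightarrow> 'a L1" where
  "restr i \<equiv> mult_L1 (indicator (A i))"

lemma bounded_linear_restr: "i \<ge> 1 \<Longrightarrow> bounded_linear (restr i)"
  by (intro bounded_linear_mult_L1 bounded_measurable_ind)

lemma norm_restr_split:
  "i \<ge> 1 \<Longrightarrow> norm (restr i u) = norm (restr (2*i) u) + norm (restr (Suc (2*i)) u)"
  using unsigned.norm_mult_split[of i u] by simp

lemma norm_restr_parent: "i \<ge> 2 \<Longrightarrow> norm (restr i u) \<le> norm (restr (i div 2) u)"
  using norm_restr_split[of "i div 2" u] by (cases "even i") (auto elim!: evenE oddE)

lemma norm_restr_le: "i \<ge> 1 \<Longrightarrow> norm (restr i u) \<le> norm u"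
  using norm_mult_L1_le[OF bounded_measurable_ind[of i], where B = 1] by (simp add: indicator_def)

lemma norm_restr_diff:
  assumes "i \<ge> 1" "j \<ge> 1" "A i \<subseteq> A j"
  shows "norm (mult_L1 (\<lambda>x. indicator (A j) x - indicator (A i) x) u) = norm (restr j u) - norm (restr i u)"
proof -
  have int: "integrable unit_cube (\<lambda>x. \<bar>indicator (A k) x\<bar> * \<bar>rep_L1 u x\<bar>)" if "k \<ge> 1" for k
    using integrable_abs[OF integrable_mult_rep_L1[OF bounded_measurable_ind[OF that], of u]]
    by (simp add: abs_mult)
  have "norm (mult_L1 (\<lambda>x. indicator (A j) x - indicator (A i) x) u)
      = (\<integral>x. \<bar>indicator (A j) x - indicator (A i) x\<bar> * \<bar>rep_L1 u x\<bar> \<partial>unit_cube)"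
    using assms by (intro norm_mult_L1 bounded_measurable_diff bounded_measurable_ind)
  also have "\<dots> = (\<integral>x. \<bar>indicator (A j) x\<bar> * \<bar>rep_L1 u x\<bar> - \<bar>indicator (A i) x\<bar> * \<bar>rep_L1 u x\<bar> \<partial>unit_cube)"
    using assms by (intro Bochner_Integration.integral_cong) (auto simp: indicator_def)
  also have "\<dots> = (\<integral>x. \<bar>indicator (A j) x\<bar> * \<bar>rep_L1 u x\<bar> \<partial>unit_cube)
      - (\<integral>x. \<bar>indicator (A i) x\<bar> * \<bar>rep_L1 u x\<bar> \<partial>unit_cube)"
    using assms by (intro Bochner_Integration.integral_diff int)
  also have "\<dots> = norm (restr j u) - norm (restr i u)"
    using assms by (simp only: norm_mult_L1 bounded_measurable_ind)
  finally show ?thesis .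
qed

lemma restr_diff:
  assumes "i \<ge> 1" "j \<ge> 1"
  shows "restr j u - restr i u = mult_L1 (\<lambda>x. indicator (A j) x - indicator (A i) x) u"
proof -
  have "mult_L1 (\<lambda>x. (indicator (A j) x - indicator (A i) x) + indicator (A i) x) u
      = mult_L1 (\<lambda>x. indicator (A j) x - indicator (A i) x) u + restr i u"
    using assms by (intro mult_L1_add_left bounded_measurable_diff bounded_measurable_ind)
  then show ?thesis
    by (simp add: algebra_simps)
qed

text \<open>In \<open>L\<^sup>1\<close> the norm that leaves a node is a difference of norms, and it is subadditive in \<open>u\<close>; this gives the
  monotonicity in the comparison of masses below.\<close>

lemma norm_compl_restr:
  assumes "i \<ge> 1"
  shows "norm (u - restr i u) = norm u - norm (restr i u)"
proof -
  have int: "integrable unit_cube (\<lambda>x. \<bar>indicator (A i) x\<bar> * \<bar>rep_L1 u x\<bar>)"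
    using integrable_abs[OF integrable_mult_rep_L1[OF bounded_measurable_ind[OF assms], of u]]
    by (simp add: abs_mult)
  have "u - restr i u = to_L1 (\<lambda>x. rep_L1 u x - indicator (A i) x * rep_L1 u x)"
    unfolding mult_L1_def using to_L1_diff[OF rep_L1_integrable integrable_mult_rep_L1[OF bounded_measurable_ind[OF assms]], of u u]
    by (simp add: to_L1_rep_L1)
  also have "norm \<dots> = (\<integral>x. \<bar>rep_L1 u x - indicator (A i) x * rep_L1 u x\<bar> \<partial>unit_cube)"
    by (intro norm_to_L1 Bochner_Integration.integrable_diff rep_L1_integrable
        integrable_mult_rep_L1 bounded_measurable_ind assms)
  also have "\<dots> = (\<integral>x. \<bar>rep_L1 u x\<bar> - \<bar>indicator (A i) x\<bar> * \<bar>rep_L1 u x\<bar> \<partial>unit_cube)"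
    by (intro Bochner_Integration.integral_cong) (auto simp: indicator_def)
  also have "\<dots> = (\<integral>x. \<bar>rep_L1 u x\<bar> \<partial>unit_cube) - (\<integral>x. \<bar>indicator (A i) x\<bar> * \<bar>rep_L1 u x\<bar> \<partial>unit_cube)"
    by (intro Bochner_Integration.integral_diff int integrable_abs rep_L1_integrable)
  finally show ?thesis
    using norm_mult_L1[OF bounded_measurable_ind[OF assms], of u] norm_L1_eq[of u] by simp
qed

lemma mass_split: "L \<ge> 1 \<Longrightarrow> mass L = mass (2*L) + mass (Suc (2*L))"
  by simp

lemma sum_mass_lev: "(\<Sum>L\<in>lev n. mass L) = 1"
  using heap_leaves_sum[of mass "2^n", OF mass_split] by (simp add: lev_def)

text \<open>What \<open>T\<close> sends from each cell of generation \<open>n\<close> to itself, evaluated on the constant function.\<close>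

definition diag :: "('a L1 \<Rightarrow> 'a L1) \<Rightarrow> nat \<Rightarrow> 'a L1" where
  "diag T n = (\<Sum>L\<in>lev n. restr L (T (chi L)))"

text \<open>The mass of the images of the cells of generation \<open>m\<close>, counted only inside the ancestors of generation \<open>n\<close>.\<close>

definition block_mass :: "('a L1 \<Rightarrow> 'a L1) \<Rightarrow> nat \<Rightarrow> nat \<Rightarrow> real" where
  "block_mass T n m = (\<Sum>L\<in>lev m. norm (restr (L div 2 ^ (m - n)) (T (chi L))))"

definition offdiag_mass :: "('a L1 \<Rightarrow> 'a L1) \<Rightarrow> nat \<Rightarrow> nat \<Rightarrow> real" where
  "offdiag_mass T n m = block_mass T n m - block_mass T m m"

lemma sum_norm_T_chi_le:
  assumes "\<And>u. norm (T u) \<le> norm u * M"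
  shows "(\<Sum>L\<in>lev m. norm (T (chi L))) \<le> M"
proof -
  have "(\<Sum>L\<in>lev m. norm (T (chi L))) \<le> (\<Sum>L\<in>lev m. mass L * M)"
    using assms by (intro sum_mono) (metis norm_chi lev_ge_1)
  also have "\<dots> = M"
    by (simp add: sum_mass_lev flip: sum_distrib_right)
  finally show ?thesis .
qed

text \<open>Let \<open>w m\<close> be the total mass of the images of generation \<open>m\<close>.  Splitting cells shows that \<open>w m\<close>,
  \<open>block_mass T n m\<close> and \<open>w m - block_mass T n m\<close> increase with \<open>m\<close>, while \<open>block_mass T n m\<close> decreases with \<open>n\<close>.  With
  \<open>P n\<close> the limit of \<open>block_mass T n m\<close> for large \<open>m\<close> and \<open>W\<close> that of \<open>w\<close>, the off-diagonal mass is at most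
  \<open>(P n - P m) + (W - w m)\<close>, and both sequences converge.\<close>

lemma offdiag_mass_tendsto_0:
  assumes T: "bounded_linear T" and "\<epsilon> > 0"
  shows "\<exists>N. \<forall>n\<ge>N. \<forall>m\<ge>n. offdiag_mass T n m < \<epsilon>"
proof -
  interpret T: bounded_linear T by fact
  obtain M where M: "\<And>u. norm (T u) \<le> norm u * M"
    using T.bounded by blast
  define w where "w m = (\<Sum>L\<in>lev m. norm (T (chi L)))" for m
  have T_split: "T (chi L) = T (chi (2*L)) + T (chi (Suc (2*L)))" if "L \<ge> 1" for L
    using chi_split[OF that] by (simp add: T.add)
  have w_Suc: "w m \<le> w (Suc m)" for m
    unfolding w_def sum_lev_Suc
    by (intro sum_mono) (metis T_split lev_ge_1 norm_triangle_ineq)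
  have w_le: "w m \<le> M" for m
    unfolding w_def by (rule sum_norm_T_chi_le[OF M])
  have p_le_w: "block_mass T n m \<le> w m" if "n \<le> m" for n m
    unfolding block_mass_def w_def using that
    by (intro sum_mono norm_restr_le lev_ge_1[of _ n] ancestor_lev)
  have p_Suc: "block_mass T n m \<le> block_mass T n (Suc m)" if "n \<le> m" for n m
    unfolding block_mass_def sum_lev_Suc div_power_twice[OF that]
  proof (intro sum_mono)
    fix L assume L: "L \<in> lev m"
    interpret R: bounded_linear "restr (L div 2 ^ (m - n))"
      by (intro bounded_linear_restr lev_ge_1[of _ n] ancestor_lev L that)
    show "norm (restr (L div 2 ^ (m - n)) (T (chi L))) \<le>
        norm (restr (L div 2 ^ (m - n)) (T (chi (2 * L)))) + norm (restr (L div 2 ^ (m - n)) (T (chi (Suc (2 * L)))))"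
      unfolding T_split[OF lev_ge_1[OF L]] R.add by (rule norm_triangle_ineq)
  qed
  have w_p_Suc: "w m - block_mass T n m \<le> w (Suc m) - block_mass T n (Suc m)" if "n \<le> m" for n m
    unfolding w_def block_mass_def sum_lev_Suc div_power_twice[OF that] sum_subtractf[symmetric]
  proof (intro sum_mono)
    fix L assume L: "L \<in> lev m"
    have anc: "L div 2 ^ (m - n) \<ge> 1"
      by (intro lev_ge_1[of _ n] ancestor_lev L that)
    interpret R: bounded_linear "restr (L div 2 ^ (m - n))"
      by (intro bounded_linear_restr anc)
    let ?a = "T (chi (2 * L))" and ?b = "T (chi (Suc (2 * L)))" and ?R = "restr (L div 2 ^ (m - n))"
    have "norm ((?a - ?R ?a) + (?b - ?R ?b)) \<le> norm (?a - ?R ?a) + norm (?b - ?R ?b)"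
      by (rule norm_triangle_ineq)
    moreover have "(?a - ?R ?a) + (?b - ?R ?b) = T (chi L) - ?R (T (chi L))"
      unfolding T_split[OF lev_ge_1[OF L]] R.add by simp
    ultimately show "norm (T (chi L)) - norm (?R (T (chi L)))
        \<le> norm ?a + norm ?b - (norm (?R ?a) + norm (?R ?b))"
      by (simp add: norm_compl_restr[OF anc])
  qed
  have p_anti: "block_mass T (Suc n) m \<le> block_mass T n m" if "Suc n \<le> m" for n m
    unfolding block_mass_def
  proof (intro sum_mono)
    fix L assume L: "L \<in> lev m"
    have "m - n = Suc (m - Suc n)"
      using that by simp
    then have eq: "L div 2 ^ (m - n) = (L div 2 ^ (m - Suc n)) div 2"
      by (simp only: power_Suc2 div_mult2_eq)
    have "L div 2 ^ (m - Suc n) \<in> lev (Suc n)"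
      by (intro ancestor_lev L that)
    then have "L div 2 ^ (m - Suc n) \<ge> 2 ^ Suc n"
      by (simp add: lev_def)
    then have "L div 2 ^ (m - Suc n) \<ge> 2"
      using order_trans[of 2 "2 ^ Suc n" "L div 2 ^ (m - Suc n)"] by simp
    then show "norm (restr (L div 2 ^ (m - Suc n)) (T (chi L))) \<le> norm (restr (L div 2 ^ (m - n)) (T (chi L)))"
      unfolding eq by (rule norm_restr_parent)
  qed
  have w_mono: "w m \<le> w l" if "m \<le> l" for m l
    using lift_Suc_mono_le[of w, OF w_Suc that] .
  obtain W where W: "w \<longlonglongrightarrow> W" "\<And>m. w m \<le> W"
    using incseq_convergent[of w M] w_le w_mono by (auto simp: incseq_def)
  define P where "P n = lim (\<lambda>k. block_mass T n (n + k))" for n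
  have P: "(\<lambda>k. block_mass T n (n + k)) \<longlonglongrightarrow> P n" "\<And>m. n \<le> m \<Longrightarrow> block_mass T n m \<le> P n" for n
  proof -
    have inc: "incseq (\<lambda>k. block_mass T n (n + k))"
      using p_Suc by (intro incseq_SucI) simp
    obtain L where L: "(\<lambda>k. block_mass T n (n + k)) \<longlonglongrightarrow> L" "\<And>k. block_mass T n (n + k) \<le> L"
      using incseq_convergent[OF inc, of M] p_le_w w_le by (metis le_add1 order_trans)
    then have "L = P n"
      unfolding P_def by (simp add: limI)
    with L show "(\<lambda>k. block_mass T n (n + k)) \<longlonglongrightarrow> P n"
      by simp
    show "block_mass T n m \<le> P n" if "n \<le> m" for m
      using L(2)[of "m - n"] that \<open>L = P n\<close> by simp
  qed
  have P_w: "P n - block_mass T n n \<le> W - w n" for n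
  proof -
    have "w n - block_mass T n n \<le> w (n + k) - block_mass T n (n + k)" for k
      using lift_Suc_mono_le[of "\<lambda>k. w (n + k) - block_mass T n (n + k)" 0 k] w_p_Suc[of n] by simp
    moreover have "(\<lambda>k. w (n + k) - block_mass T n (n + k)) \<longlonglongrightarrow> W - P n"
      using LIMSEQ_ignore_initial_segment[OF W(1), of n] unfolding add.commute[of _ n]
      by (intro tendsto_diff P(1))
    ultimately have "w n - block_mass T n n \<le> W - P n"
      by (intro LIMSEQ_le_const) auto
    then show ?thesis
      by simp
  qed
  have P_Suc: "P (Suc n) \<le> P n" for n
    by (rule LIMSEQ_le_const2[OF P(1)[of "Suc n"]])
       (use p_anti[of n] P(2)[of n] in \<open>auto intro!: exI[of _ 0] order_trans[OF p_anti]\<close>)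
  have "decseq P"
    using P_Suc by (rule decseq_SucI)
  moreover have "0 \<le> P n" for n
    using P(2)[of n n] sum_nonneg[of "lev n" "\<lambda>L. norm (restr (L div 2 ^ (n - n)) (T (chi L)))"]
    unfolding block_mass_def by simp
  ultimately obtain Q where Q: "P \<longlonglongrightarrow> Q" "\<And>n. Q \<le> P n"
    using decseq_convergent[of P 0] by blast
  have "(\<lambda>n. (P n - Q) + (W - w n)) \<longlonglongrightarrow> (Q - Q) + (W - W)"
    by (intro tendsto_intros Q W)
  then have "\<forall>\<^sub>F n in sequentially. (P n - Q) + (W - w n) < \<epsilon>"
    using \<open>\<epsilon> > 0\<close> by (intro order_tendstoD(2)[of _ "(Q - Q) + (W - W)"]) auto
  then obtain N where N: "\<And>n. n \<ge> N \<Longrightarrow> (P n - Q) + (W - w n) < \<epsilon>"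
    by (auto simp: eventually_sequentially)
  have "offdiag_mass T n m < \<epsilon>" if "n \<ge> N" "m \<ge> n" for n m
    unfolding offdiag_mass_def
    using N[OF that(1)] P(2)[OF that(2)] P_w[of m] Q(2)[of m] w_mono[OF that(2)] by linarith
  then show ?thesis
    by blast
qed

lemma diag_ancestor:
  assumes T: "bounded_linear T" and "n \<le> m"
  shows "diag T n = (\<Sum>L\<in>lev m. restr (L div 2 ^ (m - n)) (T (chi L)))"
proof -
  interpret T: bounded_linear T by fact
  have "restr K (T (chi L)) = restr K (T (chi (2*L))) + restr K (T (chi (Suc (2*L))))"
    if "K \<ge> 1" "L \<ge> 1" for K L
    unfolding chi_split[OF that(2)] T.add
    by (rule bounded_linear.linear[OF bounded_linear_restr[OF that(1)], THEN linear_add])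
  from sum_lev_ancestor[of "\<lambda>K L. restr K (T (chi L))", OF this assms(2)]
  show ?thesis
    by (simp add: diag_def)
qed

text \<open>Written over the cells of generation \<open>m\<close>, the two diagonals differ in the part of each image between the cell
  and its ancestor.\<close>

lemma norm_diag_diff_le:
  assumes T: "bounded_linear T" and "n \<le> m"
  shows "norm (diag T n - diag T m) \<le> offdiag_mass T n m"
proof -
  have "diag T n - diag T m = (\<Sum>L\<in>lev m. restr (L div 2 ^ (m - n)) (T (chi L)) - restr L (T (chi L)))"
    using diag_ancestor[OF assms] diag_ancestor[OF T, of m m] by (simp add: sum_subtractf)
  also have "norm \<dots> \<le> (\<Sum>L\<in>lev m. norm (restr (L div 2 ^ (m - n)) (T (chi L))) - norm (restr L (T (chi L))))"
  proof (rule sum_norm_le)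
    fix L assume L: "L \<in> lev m"
    have "L \<ge> 1" "L div 2 ^ (m - n) \<ge> 1" "A L \<subseteq> A (L div 2 ^ (m - n))"
      using lev_ge_1[OF L] lev_ge_1[OF ancestor_lev[OF L assms(2)]] subset_ancestor by auto
    then show "norm (restr (L div 2 ^ (m - n)) (T (chi L)) - restr L (T (chi L)))
        \<le> norm (restr (L div 2 ^ (m - n)) (T (chi L))) - norm (restr L (T (chi L)))"
      by (simp add: restr_diff norm_restr_diff)
  qed
  also have "\<dots> = offdiag_mass T n m"
    by (simp add: offdiag_mass_def block_mass_def sum_subtractf)
  finally show ?thesis .
qed

lemma diag_convergent:
  assumes T: "bounded_linear T"
  shows "convergent (diag T)"
proof (rule Cauchy_convergent, rule CauchyI')
  fix \<epsilon> :: real assume "\<epsilon> > 0"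
  then obtain N where "\<forall>n\<ge>N. \<forall>m\<ge>n. offdiag_mass T n m < \<epsilon>"
    using offdiag_mass_tendsto_0[OF T] by blast
  then have "\<forall>n\<ge>N. \<forall>m>n. dist (diag T n) (diag T m) < \<epsilon>"
    using norm_diag_diff_le[OF T] unfolding dist_norm by (meson less_imp_le order_le_less_trans)
  then show "\<exists>N. \<forall>n\<ge>N. \<forall>m>n. dist (diag T n) (diag T m) < \<epsilon>"
    by blast
qed

end

section \<open>Operators with large Haar diagonal\<close>

context dyadic_tree
begin

text \<open>If \<open>s\<close> equals \<open>c L\<close> on the subcell \<open>L\<close>, then \<open>c L * s\<close> is \<open>1\<close> on \<open>L\<close> and bounded by \<open>1\<close> on \<open>K\<close>.  Hence the
  coefficient of \<open>s\<close> is the integral of the diagonal up to the mass that leaves the subcells.\<close>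

lemma block_diag_close:
  assumes T: "bounded_linear T" and "n \<le> m" "K \<in> lev n"
    and s: "adapted (2 ^ m) s" "\<And>x. \<bar>s x\<bar> = indicator (A K) x"
  shows "\<bar>pairing s (T (to_L1 s)) - pairing (indicator (A K)) (diag T m)\<bar>
    \<le> (\<Sum>L | L \<in> lev m \<and> L div 2 ^ (m - n) = K.
          norm (restr K (T (chi L))) - norm (restr L (T (chi L))))"
proof -
  interpret T: bounded_linear T by fact
  define D where "D = {L \<in> lev m. L div 2 ^ (m - n) = K}"
  define c where "c L = s (SOME y. y \<in> A L)" for L
  have K: "K \<ge> 1"
    using assms lev_ge_1 by blast
  have bm: "bounded_measurable s" "bounded_measurable (indicator (A K))"
    using adapted_bounded_measurable[OF s(1)] bounded_measurable_ind[OF K] by auto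
  interpret ps: bounded_linear "pairing s" by (intro bounded_linear_pairing bm)
  interpret pK: bounded_linear "pairing (indicator (A K))" by (intro bounded_linear_pairing bm)
  have c: "s x = c L" if "L \<in> lev m" "x \<in> A L" for L x
    using adaptedD2[OF s(1), of L x "SOME y. y \<in> A L"] that someI[of "\<lambda>y. y \<in> A L" x]
    by (auto simp: c_def lev_def)
  have c_out: "c L = 0" if L: "L \<in> lev m - D" for L
  proof -
    obtain x where x: "x \<in> A L"
      using L nonempty[OF lev_ge_1[of L m]] by auto
    then have "x \<notin> A K"
      using lev_nested(2)[of L m n K] that assms by (auto simp: D_def)
    then show ?thesis
      using s(2)[of x] c[of L x] x that by simp
  qed
  have c_in: "c L * c L = 1" if L: "L \<in> D" for L
  proof -
    obtain x where x: "x \<in> A L"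
      using L nonempty[OF lev_ge_1[of L m]] by (auto simp: D_def)
    then have "x \<in> A K"
      using lev_nested(1)[of L m n K] that assms by (auto simp: D_def)
    then show ?thesis
      using s(2)[of x] c[of L x] x that by (auto simp: D_def abs_if split: if_splits)
  qed
  have eq: "s = (\<lambda>x. \<Sum>L\<in>lev m. c L * indicator (A L) x)"
    unfolding c_def lev_def by (intro ext adapted_eq_sum[OF s(1)]) simp
  have "to_L1 s = to_L1 (\<lambda>x. \<Sum>L\<in>lev m. c L * indicator (A L) x)"
    by (rule arg_cong[OF eq])
  also have "\<dots> = (\<Sum>L\<in>lev m. to_L1 (\<lambda>x. c L * indicator (A L) x))"
    by (intro to_L1_sum[symmetric] integrable_mult_right integrable_ind) (auto dest: lev_ge_1)
  also have "\<dots> = (\<Sum>L\<in>lev m. c L *\<^sub>R chi L)"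
    by (intro sum.cong refl to_L1_scaleR[symmetric] integrable_ind) (auto dest: lev_ge_1)
  also have "\<dots> = (\<Sum>L\<in>D. c L *\<^sub>R chi L)"
    using c_out by (intro sum.mono_neutral_right) (auto simp: D_def)
  finally have "pairing s (T (to_L1 s)) = (\<Sum>L\<in>D. pairing (\<lambda>x. c L * s x) (T (chi L)))"
    by (simp add: T.sum T.scaleR ps.sum ps.scaleR pairing_cmult_left)
  moreover have "pairing (indicator (A K)) (diag T m) = (\<Sum>L\<in>D. pairing (indicator (A L)) (T (chi L)))"
  proof -
    have "pairing (indicator (A K)) (diag T m) = (\<Sum>L\<in>lev m. pairing (\<lambda>x. indicator (A K) x * indicator (A L) x) (T (chi L)))"
      unfolding diag_def pK.sum
      by (intro sum.cong refl pairing_mult_L1 bounded_measurable_ind K) (auto dest: lev_ge_1)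
    also have "\<dots> = (\<Sum>L\<in>lev m. if L \<in> D then pairing (indicator (A L)) (T (chi L)) else 0)"
    proof (intro sum.cong refl)
      fix L assume L: "L \<in> lev m"
      have "(\<lambda>x. indicator (A K) x * indicator (A L) x) = (if L \<in> D then indicator (A L) else (\<lambda>_. 0::real))"
        using lev_nested[OF L assms(2,3)] L by (auto simp: D_def indicator_def fun_eq_iff)
      then show "pairing (\<lambda>x. indicator (A K) x * indicator (A L) x) (T (chi L))
          = (if L \<in> D then pairing (indicator (A L)) (T (chi L)) else 0)"
        by (simp add: pairing_def)
    qed
    also have "\<dots> = (\<Sum>L\<in>D. pairing (indicator (A L)) (T (chi L)))"
      by (subst sum.inter_restrict[symmetric]) (auto simp: D_def intro!: sum.cong)
    finally show ?thesis .
  qed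
  ultimately have "pairing s (T (to_L1 s)) - pairing (indicator (A K)) (diag T m)
      = (\<Sum>L\<in>D. pairing (\<lambda>x. c L * s x) (T (chi L)) - pairing (indicator (A L)) (T (chi L)))"
    by (simp add: sum_subtractf)
  also have "\<bar>\<dots>\<bar> \<le> (\<Sum>L\<in>D. norm (restr K (T (chi L))) - norm (restr L (T (chi L))))"
  proof (rule order_trans[OF sum_abs], rule sum_mono)
    fix L assume L: "L \<in> D"
    then have L1: "L \<ge> 1" and LK: "A L \<subseteq> A K" and Llev: "L \<in> lev m"
      using lev_ge_1[of L m] lev_nested(1)[of L m n K] assms by (auto simp: D_def)
    have bm': "bounded_measurable (\<lambda>x. c L * s x)" "bounded_measurable (indicator (A L))"
      by (intro bounded_measurable_mult bm bounded_measurable_const bounded_measurable_ind L1)+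
    have "pairing (\<lambda>x. c L * s x) (T (chi L)) - pairing (indicator (A L)) (T (chi L))
        = pairing (\<lambda>x. c L * s x - indicator (A L) x) (T (chi L))"
      by (intro pairing_diff_left[symmetric] bm')
    also have "\<bar>\<dots>\<bar> \<le> norm (mult_L1 (\<lambda>x. c L * s x - indicator (A L) x) (T (chi L)))"
      by (intro abs_pairing_le bounded_measurable_diff bm')
    also have "\<dots> \<le> norm (mult_L1 (\<lambda>x. indicator (A K) x - indicator (A L) x) (T (chi L)))"
    proof (intro norm_mult_mono bounded_measurable_diff bm' bm)
      fix x
      have "\<bar>c L\<bar> = 1"
        using c_in[OF L] by (metis abs_1 abs_mult_self_eq abs_square_eq_1 power2_eq_square)
      then show "\<bar>c L * s x - indicator (A L) x\<bar> \<le> \<bar>indicator (A K) x - indicator (A L) x\<bar>"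
        using c[OF Llev, of x] c_in[OF L] s(2)[of x] LK
        by (cases "x \<in> A L") (auto simp: abs_mult)
    qed
    also have "\<dots> = norm (restr K (T (chi L))) - norm (restr L (T (chi L)))"
      by (intro norm_restr_diff L1 K LK)
    finally show "\<bar>pairing (\<lambda>x. c L * s x) (T (chi L)) - pairing (indicator (A L)) (T (chi L))\<bar>
        \<le> norm (restr K (T (chi L))) - norm (restr L (T (chi L)))" .
  qed
  finally show ?thesis
    by (simp add: D_def)
qed

lemma sum_block_diag_close:
  assumes T: "bounded_linear T" and "n \<le> m" "B \<subseteq> lev n"
    and s: "\<And>K. K \<in> B \<Longrightarrow> adapted (2 ^ m) (s K)" "\<And>K x. K \<in> B \<Longrightarrow> \<bar>s K x\<bar> = indicator (A K) x"
  shows "(\<Sum>K\<in>B. \<bar>pairing (s K) (T (to_L1 (s K))) - pairing (indicator (A K)) (diag T m)\<bar>)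
    \<le> offdiag_mass T n m"
proof -
  define t where "t K L = norm (restr K (T (chi L))) - norm (restr L (T (chi L)))" for K L
  define D where "D K = {L \<in> lev m. L div 2 ^ (m - n) = K}" for K
  have "(\<Sum>K\<in>B. \<bar>pairing (s K) (T (to_L1 (s K))) - pairing (indicator (A K)) (diag T m)\<bar>)
      \<le> (\<Sum>K\<in>B. \<Sum>L\<in>D K. t K L)"
    unfolding t_def D_def using assms by (intro sum_mono block_diag_close) auto
  also have "\<dots> \<le> (\<Sum>K\<in>lev n. \<Sum>L\<in>D K. t K L)"
  proof (rule sum_mono2)
    fix K assume K: "K \<in> lev n - B"
    have "0 \<le> t K L" if "L \<in> D K" for L
    proof -
      have "norm (mult_L1 (\<lambda>x. indicator (A K) x - indicator (A L) x) (T (chi L))) = t K L"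
        unfolding t_def using that K lev_ge_1 lev_nested(1)[of L m n K] assms(2)
        by (intro norm_restr_diff) (auto simp: D_def)
      then show ?thesis
        by (metis norm_ge_zero)
    qed
    then show "0 \<le> (\<Sum>L\<in>D K. t K L)"
      by (rule sum_nonneg)
  qed (use assms in auto)
  also have "\<dots> = (\<Sum>K\<in>lev n. \<Sum>L\<in>D K. t (L div 2 ^ (m - n)) L)"
    by (simp add: D_def)
  also have "\<dots> = (\<Sum>L\<in>lev m. t (L div 2 ^ (m - n)) L)"
    unfolding D_def using assms(2) ancestor_lev by (intro sum.group) auto
  also have "\<dots> = offdiag_mass T n m"
    by (simp add: t_def offdiag_mass_def block_mass_def sum_subtractf)
  finally show ?thesis .
qed

text \<open>The functions \<open>s\<close> only have to be \<open>\<plusminus>1\<close> on subcells, so that both the Haar functions of an interval and the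
  tensor products \<open>h\<^sub>I \<otimes> h\<^sub>J\<close> on a square are admitted.\<close>

definition large_diagonal :: "('a L1 \<Rightarrow> 'a L1) \<Rightarrow> real \<Rightarrow> bool" where
  "large_diagonal T \<delta> \<longleftrightarrow> (\<forall>N. \<exists>n\<ge>N. \<exists>m\<ge>n. \<forall>K\<in>lev n. \<exists>s. adapted (2 ^ m) s \<and>
     (\<forall>x. \<bar>s x\<bar> = indicator (A K) x) \<and> \<delta> * mass K \<le> \<bar>pairing s (T (to_L1 s))\<bar>)"

lemma norm_restr_diag_limit_ge:
  assumes T: "bounded_linear T" and "large_diagonal T \<delta>" and g: "diag T \<longlonglongrightarrow> g" and "C \<ge> 1"
  shows "\<delta> * mass C \<le> norm (restr C g)"
proof (rule field_le_epsilon)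
  fix \<epsilon> :: real assume "\<epsilon> > 0"
  define k where "k = floor_log C"
  have C: "C \<in> lev k"
    using floor_log_exp2_le[of C] floor_log_exp2_gt[of C] \<open>C \<ge> 1\<close> by (simp add: k_def lev_def)
  have "(\<lambda>n. norm (restr C (diag T n))) \<longlonglongrightarrow> norm (restr C g)"
    by (intro tendsto_norm bounded_linear.tendsto[OF bounded_linear_restr] g \<open>C \<ge> 1\<close>)
  then have "\<forall>\<^sub>F n in sequentially. norm (restr C (diag T n)) < norm (restr C g) + \<epsilon> / 2"
    using \<open>\<epsilon> > 0\<close> by (intro order_tendstoD(2)) auto
  then obtain N1 where N1: "\<And>n. n \<ge> N1 \<Longrightarrow> norm (restr C (diag T n)) < norm (restr C g) + \<epsilon> / 2"
    by (auto simp: eventually_sequentially)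
  obtain N2 where N2: "\<And>n m. n \<ge> N2 \<Longrightarrow> m \<ge> n \<Longrightarrow> offdiag_mass T n m < \<epsilon> / 2"
    using offdiag_mass_tendsto_0[OF T, of "\<epsilon> / 2"] \<open>\<epsilon> > 0\<close> by auto
  obtain n m s where n: "n \<ge> k" "n \<ge> N1" "n \<ge> N2" "m \<ge> n"
    and s: "\<And>K. K \<in> lev n \<Longrightarrow> adapted (2 ^ m) (s K)"
      "\<And>K x. K \<in> lev n \<Longrightarrow> \<bar>s K x\<bar> = indicator (A K) x"
      "\<And>K. K \<in> lev n \<Longrightarrow> \<delta> * mass K \<le> \<bar>pairing (s K) (T (to_L1 (s K)))\<bar>"
    using assms(2)[unfolded large_diagonal_def, rule_format, of "max k (max N1 N2)"]
    by (auto simp: Ball_def) metis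
  define B where "B = {K \<in> lev n. K div 2 ^ (n - k) = C}"
  have "\<delta> * mass C = (\<Sum>K\<in>B. \<delta> * mass K)"
    unfolding B_def sum_distrib_left[symmetric]
    by (subst sum_descendants[OF mass_split n(1) C]) auto
  also have "\<dots> \<le> (\<Sum>K\<in>B. norm (restr K (diag T m)) +
      \<bar>pairing (s K) (T (to_L1 (s K))) - pairing (indicator (A K)) (diag T m)\<bar>)"
  proof (rule sum_mono)
    fix K assume "K \<in> B"
    then have "K \<in> lev n"
      by (simp add: B_def)
    then show "\<delta> * mass K \<le> norm (restr K (diag T m)) +
        \<bar>pairing (s K) (T (to_L1 (s K))) - pairing (indicator (A K)) (diag T m)\<bar>"
      using s(3)[of K] abs_pairing_le[OF bounded_measurable_ind[OF lev_ge_1], of K n "diag T m"]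
      by linarith
  qed
  also have "\<dots> \<le> (\<Sum>K\<in>B. norm (restr K (diag T m))) + offdiag_mass T n m"
    unfolding sum.distrib
    by (intro add_left_mono sum_block_diag_close T n) (use s in \<open>auto simp: B_def\<close>)
  also have "(\<Sum>K\<in>B. norm (restr K (diag T m))) = norm (restr C (diag T m))"
    unfolding B_def by (rule sum_descendants[OF norm_restr_split n(1) C])
  also have "norm (restr C (diag T m)) + offdiag_mass T n m \<le> norm (restr C g) + \<epsilon>"
    using N1[of m] N2[of n m] n by simp
  finally show "\<delta> * mass C \<le> norm (restr C g) + \<epsilon>" .
qed

text \<open>The limit \<open>g\<close> of the diagonals is bounded away from \<open>0\<close>, and composing \<open>T\<close> with multiplication by \<open>1 / g\<close>
  divides every diagonal by \<open>g\<close>.\<close>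

lemma diag_normalization:
  assumes T: "bounded_linear T" and large: "large_diagonal T \<delta>" and "\<delta> > 0"
  obtains \<phi> where "bounded_measurable \<phi>" "\<And>x. \<bar>\<phi> x\<bar> \<le> 1 / \<delta>"
    "diag (\<lambda>u. mult_L1 \<phi> (T u)) \<longlonglongrightarrow> chi 1"
proof -
  obtain g where g: "diag T \<longlonglongrightarrow> g"
    using diag_convergent[OF T] by (auto simp: convergent_def)
  have AE: "AE x in unit_cube. \<delta> \<le> \<bar>rep_L1 g x\<bar>"
    by (intro AE_lower_bound norm_restr_diag_limit_ge[OF T large g])
  \<comment> \<open>the default value \<open>0\<close> is taken only on a null set\<close>
  define \<phi> where "\<phi> x = (if \<delta> \<le> \<bar>rep_L1 g x\<bar> then indicator (A 1) x / rep_L1 g x else 0)" for x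
  have [measurable]: "rep_L1 g \<in> borel_measurable unit_cube"
    "(indicator (A 1) :: 'a \<Rightarrow> real) \<in> borel_measurable unit_cube"
    using borel_measurable_integrable[OF rep_L1_integrable] bounded_measurable_ind[of 1]
    by (auto dest: bounded_measurable_measurable)
  have bound: "\<bar>\<phi> x\<bar> \<le> 1 / \<delta>" for x
    using \<open>\<delta> > 0\<close> by (auto simp: \<phi>_def indicator_def intro!: divide_left_mono mult_pos_pos)
  have \<phi>: "bounded_measurable \<phi>"
    by (rule bounded_measurableI[OF _ bound]) (simp add: \<phi>_def)
  interpret M: bounded_linear "mult_L1 \<phi>"
    by (rule bounded_linear_mult_L1[OF \<phi>])
  have "diag (\<lambda>u. mult_L1 \<phi> (T u)) = (\<lambda>n. mult_L1 \<phi> (diag T n))"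
    unfolding diag_def M.sum
    by (intro ext sum.cong refl) (auto simp: mult_L1_mult_L1 \<phi> bounded_measurable_ind mult.commute dest!: lev_ge_1)
  moreover have "mult_L1 \<phi> g = chi 1"
    unfolding mult_L1_def
  proof (subst to_L1_eq_iff)
    show "AE x in unit_cube. \<phi> x * rep_L1 g x = indicator (A 1) x"
      using AE by eventually_elim (use \<open>\<delta> > 0\<close> in \<open>auto simp: \<phi>_def\<close>)
  qed (auto intro!: integrable_mult_rep_L1 \<phi> integrable_ind)
  ultimately have "diag (\<lambda>u. mult_L1 \<phi> (T u)) \<longlonglongrightarrow> chi 1"
    using M.tendsto[OF g] by simp
  then show ?thesis
    using \<phi> bound that by blast
qed

end

section \<open>Random signs\<close>

lemma sum_Pow_insert:
  fixes F :: "'b set \<Rightarrow> real"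
  assumes "finite B" "x \<notin> B"
  shows "(\<Sum>S\<in>Pow (insert x B). F S) = (\<Sum>S\<in>Pow B. F S + F (insert x S))"
proof -
  have "inj_on (insert x) (Pow B)"
    using assms by (intro inj_onI) (metis PowD insert_ident subsetD)
  moreover have "Pow B \<inter> insert x ` Pow B = {}"
    using assms by auto
  ultimately show ?thesis
    using assms by (simp add: Pow_insert sum.union_disjoint sum.reindex sum.distrib)
qed

text \<open>A choice of signs on a finite set \<open>B\<close> is encoded by the subset where the sign is \<open>1\<close>, so that averages over
  all signs are sums over \<open>Pow B\<close>.\<close>

definition sign_of :: "'b set \<Rightarrow> 'b \<Rightarrow> real" where
  "sign_of S i = (if i \<in> S then 1 else -1)"

lemma sign_of_sq [simp]: "sign_of S i * sign_of S i = 1"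
  by (simp add: sign_of_def)

lemma abs_sign_of [simp]: "\<bar>sign_of S i\<bar> = 1"
  by (simp add: sign_of_def)

lemma sum_signs_linear:
  assumes "finite B"
  shows "(\<Sum>S\<in>Pow B. (\<Sum>i\<in>B. sign_of S i * c i)\<^sup>2) = 2 ^ card B * (\<Sum>i\<in>B. (c i)\<^sup>2)"
  using assms
proof (induction B)
  case (insert x B)
  have "(\<Sum>i\<in>insert x B. sign_of S i * c i)\<^sup>2 + (\<Sum>i\<in>insert x B. sign_of (insert x S) i * c i)\<^sup>2
      = 2 * (\<Sum>i\<in>B. sign_of S i * c i)\<^sup>2 + 2 * (c x)\<^sup>2" if "S \<in> Pow B" for S
  proof -
    have "(\<Sum>i\<in>B. sign_of (insert x S) i * c i) = (\<Sum>i\<in>B. sign_of S i * c i)"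
      using insert by (intro sum.cong) (auto simp: sign_of_def)
    moreover have "sign_of S x = -1" "sign_of (insert x S) x = 1"
      using insert that by (auto simp: sign_of_def)
    ultimately show ?thesis
      using insert by (simp add: power2_eq_square algebra_simps)
  qed
  then have "(\<Sum>S\<in>Pow (insert x B). (\<Sum>i\<in>insert x B. sign_of S i * c i)\<^sup>2)
      = (\<Sum>S\<in>Pow B. 2 * (\<Sum>i\<in>B. sign_of S i * c i)\<^sup>2 + 2 * (c x)\<^sup>2)"
    unfolding sum_Pow_insert[OF insert.hyps] by (intro sum.cong refl) auto
  also have "\<dots> = 2 * (2 ^ card B * (\<Sum>i\<in>B. (c i)\<^sup>2)) + 2 ^ card B * (2 * (c x)\<^sup>2)"
    using insert by (simp add: sum.distrib card_Pow flip: sum_distrib_left)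
  finally show ?case
    using insert by (simp add: algebra_simps)
qed simp

definition sign_form :: "('b \<Rightarrow> 'b \<Rightarrow> real) \<Rightarrow> 'b set \<Rightarrow> 'b set \<Rightarrow> real" where
  "sign_form a B S = (\<Sum>i\<in>B. \<Sum>j\<in>B. if i = j then 0 else sign_of S i * sign_of S j * a i j)"

text \<open>Adding an element \<open>x\<close> adds \<open>\<plusminus>l S\<close> to the form, where \<open>l\<close> is linear in the old signs; averaging over the new
  sign removes the mixed term and leaves a second moment of a linear form.\<close>

lemma sum_signs_quadratic:
  assumes "finite B"
  shows "(\<Sum>S\<in>Pow B. (sign_form a B S)\<^sup>2) \<le> 2 ^ card B * (2 * (\<Sum>i\<in>B. \<Sum>j\<in>B. (a i j)\<^sup>2))"
  using assms
proof (induction B)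
  case (insert x B)
  define l where "l S = (\<Sum>i\<in>B. sign_of S i * (a i x + a x i))" for S
  have form: "sign_form a (insert x B) S = sign_form a B S + sign_of S x * l S" for S
  proof -
    have "(\<Sum>i\<in>B. if i = x then 0 else sign_of S i * sign_of S x * a i x) = (\<Sum>i\<in>B. sign_of S i * sign_of S x * a i x)"
      "(\<Sum>i\<in>B. if x = i then 0 else sign_of S x * sign_of S i * a x i) = (\<Sum>i\<in>B. sign_of S x * sign_of S i * a x i)"
      using insert by (auto intro!: sum.cong)
    then show ?thesis
      using insert unfolding sign_form_def l_def
      by (simp add: sum.distrib sum_distrib_left algebra_simps)
  qed
  have pair: "(sign_form a (insert x B) S)\<^sup>2 + (sign_form a (insert x B) (insert x S))\<^sup>2
      = 2 * (sign_form a B S)\<^sup>2 + 2 * (l S)\<^sup>2" if "S \<in> Pow B" for S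
  proof -
    have "sign_of (insert x S) i = sign_of S i" if "i \<in> B" for i
      using insert that by (auto simp: sign_of_def)
    then have "sign_form a B (insert x S) = sign_form a B S" "l (insert x S) = l S"
      unfolding sign_form_def l_def by (auto intro!: sum.cong)
    moreover have "sign_of S x = -1" "sign_of (insert x S) x = 1"
      using insert that by (auto simp: sign_of_def)
    ultimately show ?thesis
      unfolding form by (simp add: power2_eq_square algebra_simps)
  qed
  have "(\<Sum>S\<in>Pow (insert x B). (sign_form a (insert x B) S)\<^sup>2)
      = (\<Sum>S\<in>Pow B. 2 * (sign_form a B S)\<^sup>2 + 2 * (l S)\<^sup>2)"
    unfolding sum_Pow_insert[OF insert.hyps] by (intro sum.cong refl pair) auto
  also have "\<dots> = 2 * (\<Sum>S\<in>Pow B. (sign_form a B S)\<^sup>2) + 2 * (\<Sum>S\<in>Pow B. (l S)\<^sup>2)"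
    by (simp add: sum.distrib flip: sum_distrib_left)
  also have "(\<Sum>S\<in>Pow B. (l S)\<^sup>2) = 2 ^ card B * (\<Sum>i\<in>B. (a i x + a x i)\<^sup>2)"
    unfolding l_def by (rule sum_signs_linear[OF insert.hyps(1)])
  also have "(\<Sum>i\<in>B. (a i x + a x i)\<^sup>2) \<le> (\<Sum>i\<in>B. 2 * (a i x)\<^sup>2 + 2 * (a x i)\<^sup>2)"
  proof (rule sum_mono)
    fix i
    show "(a i x + a x i)\<^sup>2 \<le> 2 * (a i x)\<^sup>2 + 2 * (a x i)\<^sup>2"
      using zero_le_power2[of "a i x - a x i"] by (simp add: power2_eq_square algebra_simps)
  qed
  also have "\<dots> = 2 * ((\<Sum>i\<in>B. (a i x)\<^sup>2) + (\<Sum>i\<in>B. (a x i)\<^sup>2))"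
    by (simp add: sum.distrib flip: sum_distrib_left)
  also have "2 * (\<Sum>S\<in>Pow B. (sign_form a B S)\<^sup>2) + 2 * (2 ^ card B * (2 * ((\<Sum>i\<in>B. (a i x)\<^sup>2) + (\<Sum>i\<in>B. (a x i)\<^sup>2))))
      \<le> 2 * (2 ^ card B * (2 * (\<Sum>i\<in>B. \<Sum>j\<in>B. (a i j)\<^sup>2)))
        + 2 * (2 ^ card B * (2 * ((a x x)\<^sup>2 + (\<Sum>i\<in>B. (a i x)\<^sup>2) + (\<Sum>i\<in>B. (a x i)\<^sup>2))))"
    using insert.IH by (intro add_mono mult_left_mono) auto
  also have "\<dots> = 2 ^ card (insert x B) * (2 * (\<Sum>i\<in>insert x B. \<Sum>j\<in>insert x B. (a i j)\<^sup>2))"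
    using insert.hyps by (simp add: sum.distrib algebra_simps)
  finally show ?case
    by simp
qed (simp add: sign_form_def)

lemma exists_signs:
  assumes "finite B"
  shows "\<exists>S. (sign_form a B S)\<^sup>2 \<le> 2 * (\<Sum>i\<in>B. \<Sum>j\<in>B. (a i j)\<^sup>2)"
proof (rule ccontr)
  assume "\<not> ?thesis"
  then have "(\<Sum>S\<in>Pow B. 2 * (\<Sum>i\<in>B. \<Sum>j\<in>B. (a i j)\<^sup>2)) < (\<Sum>S\<in>Pow B. (sign_form a B S)\<^sup>2)"
    using assms by (intro sum_strict_mono) (auto simp: not_le)
  then show False
    using sum_signs_quadratic[OF assms, of a] assms by (simp add: card_Pow)
qed

section \<open>Blocks of Haar functions\<close>

context dyadic_tree
begin

text \<open>The energies \<open>E n\<close>, sums of \<open>(\<psi> (chi i))\<^sup>2 / mass i\<close> over a generation, increase and are bounded, and the increment is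
  the corresponding sum over Haar functions.  It tends to \<open>0\<close>, and the Cauchy-Schwarz inequality passes to absolute
  values.\<close>

lemma functional_haar_sum_tendsto_0:
  fixes \<psi> :: "'a L1 \<Rightarrow> real"
  assumes "bounded_linear \<psi>"
  shows "(\<lambda>n. \<Sum>i\<in>lev n. \<bar>\<psi> (e i)\<bar>) \<longlonglongrightarrow> 0"
proof -
  interpret bounded_linear \<psi> by fact
  obtain M where M: "\<And>u. \<bar>\<psi> u\<bar> \<le> norm u * M" and "M > 0"
    using pos_bounded by auto
  define E where "E n = (\<Sum>i\<in>lev n. (\<psi> (chi i))\<^sup>2 / mass i)" for n
  define d where "d n = (\<Sum>i\<in>lev n. (\<psi> (e i))\<^sup>2 / mass i)" for n
  have E_Suc: "E (Suc n) = E n + d n" for n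
  proof -
    have "(\<psi> (chi (2*i)))\<^sup>2 / mass (2*i) + (\<psi> (chi (Suc (2*i))))\<^sup>2 / mass (Suc (2*i))
        = (\<psi> (chi i))\<^sup>2 / mass i + (\<psi> (e i))\<^sup>2 / mass i" if "i \<in> lev n" for i
    proof -
      have i: "i \<ge> 1"
        using lev_ge_1[OF that] .
      have "x\<^sup>2 / (z / 2) + y\<^sup>2 / (z / 2) = (x + y)\<^sup>2 / z + (x - y)\<^sup>2 / z" if "z > 0" for x y z :: real
        using that by (simp add: field_simps power2_eq_square)
      then show ?thesis
        unfolding chi_split[OF i] e_split[OF i] add diff mass_twice[OF i] mass_twice_Suc[OF i]
        using mass_pos by blast
    qed
    then show ?thesis
      unfolding E_def d_def sum_lev_Suc sum.distrib[symmetric] by (intro sum.cong refl)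
  qed
  have "d n \<ge> 0" for n
    unfolding d_def by (intro sum_nonneg divide_nonneg_pos) auto
  then have "incseq E"
    by (intro incseq_SucI) (simp add: E_Suc)
  moreover have "E n \<le> M\<^sup>2" for n
  proof -
    have "E n \<le> (\<Sum>i\<in>lev n. M\<^sup>2 * mass i)"
      unfolding E_def
    proof (rule sum_mono)
      fix i assume "i \<in> lev n"
      then have "\<bar>\<psi> (chi i)\<bar> \<le> mass i * M"
        using M[of "chi i"] norm_chi[OF lev_ge_1] by simp
      then have "\<bar>\<psi> (chi i)\<bar>\<^sup>2 \<le> (mass i * M)\<^sup>2"
        by (intro power_mono) auto
      then show "(\<psi> (chi i))\<^sup>2 / mass i \<le> M\<^sup>2 * mass i"
        by (simp add: divide_le_eq power2_eq_square algebra_simps)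
    qed
    then show ?thesis
      using sum_mass_lev[of n] by (simp flip: sum_distrib_left)
  qed
  ultimately obtain L where L: "E \<longlonglongrightarrow> L"
    using incseq_convergent by blast
  have "(\<lambda>n. E (Suc n) - E n) \<longlonglongrightarrow> L - L"
    by (intro tendsto_diff L LIMSEQ_Suc)
  then have d: "(\<lambda>n. sqrt (d n)) \<longlonglongrightarrow> sqrt 0"
    by (intro tendsto_real_sqrt) (simp add: E_Suc)
  show ?thesis
  proof (rule Lim_null_comparison)
    have "norm (\<Sum>i\<in>lev n. \<bar>\<psi> (e i)\<bar>) \<le> sqrt (d n)" for n
    proof (rule real_le_rsqrt)
      have "(\<Sum>i\<in>lev n. \<bar>\<psi> (e i)\<bar>) = (\<Sum>i\<in>lev n. (\<bar>\<psi> (e i)\<bar> / sqrt (mass i)) * sqrt (mass i))"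
        by (intro sum.cong) auto
      also have "\<dots>\<^sup>2 \<le> (\<Sum>i\<in>lev n. (\<bar>\<psi> (e i)\<bar> / sqrt (mass i))\<^sup>2) * (\<Sum>i\<in>lev n. (sqrt (mass i))\<^sup>2)"
        by (rule Cauchy_Schwarz_ineq_sum)
      also have "\<dots> = d n"
        by (simp add: sum_mass_lev d_def power_divide)
      finally show "(norm (\<Sum>i\<in>lev n. \<bar>\<psi> (e i)\<bar>))\<^sup>2 \<le> d n"
        by simp
    qed
    then show "\<forall>\<^sub>F n in sequentially. norm (\<Sum>i\<in>lev n. \<bar>\<psi> (e i)\<bar>) \<le> sqrt (d n)"
      by simp
    show "(\<lambda>n. sqrt (d n)) \<longlonglongrightarrow> 0"
      using d by simp
  qed
qed

lemma sum_norm_restr_lev: "(\<Sum>i\<in>lev n. norm (restr i u)) \<le> norm u"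
  using unsigned.sum_norm_leaves_le[where n = "2^n" and u = u] by (simp add: lev_def)

lemma sum_abs_pairing_h_le: "(\<Sum>i\<in>lev n. \<bar>pairing (h i) u\<bar>) \<le> norm u"
proof -
  have "(\<Sum>i\<in>lev n. \<bar>pairing (h i) u\<bar>) \<le> (\<Sum>i\<in>lev n. norm (restr i u))"
  proof (rule sum_mono)
    fix i assume "i \<in> lev n"
    then have i: "i \<ge> 1"
      by (rule lev_ge_1)
    have "norm (mult_L1 (h i) u) \<le> norm (restr i u)"
      using i by (intro norm_mult_mono unsigned.bounded_measurable_signed_haar bounded_measurable_ind)
        (auto simp: abs_h)
    then show "\<bar>pairing (h i) u\<bar> \<le> norm (restr i u)"
      using abs_pairing_le[OF unsigned.bounded_measurable_signed_haar, of i u] by simp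
  qed
  then show ?thesis
    using sum_norm_restr_lev[of u n] by linarith
qed

text \<open>The sums are bounded by \<open>norm u\<close> uniformly in \<open>n\<close>, and for an indicator of a node they vanish eventually.\<close>

lemma pairing_haar_sum_tendsto_0: "(\<lambda>n. \<Sum>i\<in>lev n. \<bar>pairing (h i) u\<bar>) \<longlonglongrightarrow> 0"
proof -
  define V where "V = {u. (\<lambda>n. \<Sum>i\<in>lev n. \<bar>pairing (h i) u\<bar>) \<longlonglongrightarrow> 0}"
  interpret p: bounded_linear "pairing (h i)" for i
    by (intro bounded_linear_pairing unsigned.bounded_measurable_signed_haar)
  have "subspace V"
    unfolding subspace_def
  proof (intro conjI ballI allI)
    show "0 \<in> V"
      by (simp add: V_def p.zero)
    fix u v assume uv: "u \<in> V" "v \<in> V"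
    show "u + v \<in> V"
      unfolding V_def mem_Collect_eq
    proof (rule Lim_null_comparison)
      show "(\<lambda>n. (\<Sum>i\<in>lev n. \<bar>pairing (h i) u\<bar>) + (\<Sum>i\<in>lev n. \<bar>pairing (h i) v\<bar>)) \<longlonglongrightarrow> 0"
        using tendsto_add[of "\<lambda>n. \<Sum>i\<in>lev n. \<bar>pairing (h i) u\<bar>" 0] uv by (simp add: V_def)
      have "(\<Sum>i\<in>lev n. \<bar>pairing (h i) (u + v)\<bar>)
          \<le> (\<Sum>i\<in>lev n. \<bar>pairing (h i) u\<bar>) + (\<Sum>i\<in>lev n. \<bar>pairing (h i) v\<bar>)" for n
        unfolding p.add sum.distrib[symmetric] by (intro sum_mono abs_triangle_ineq)
      then show "\<forall>\<^sub>F n in sequentially. norm (\<Sum>i\<in>lev n. \<bar>pairing (h i) (u + v)\<bar>)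
          \<le> (\<Sum>i\<in>lev n. \<bar>pairing (h i) u\<bar>) + (\<Sum>i\<in>lev n. \<bar>pairing (h i) v\<bar>)"
        by simp
    qed
  next
    fix c u assume "u \<in> V"
    then show "c *\<^sub>R u \<in> V"
      using tendsto_mult[OF tendsto_const[of "\<bar>c\<bar>"], of "\<lambda>n. \<Sum>i\<in>lev n. \<bar>pairing (h i) u\<bar>" 0 sequentially]
      by (simp add: V_def p.scaleR abs_mult sum_distrib_left)
  qed
  moreover have "closed V"
    unfolding closed_sequential_limits
  proof safe
    fix f u assume f: "\<forall>k. f k \<in> V" and lim: "f \<longlonglongrightarrow> u"
    show "u \<in> V"
      unfolding V_def mem_Collect_eq
    proof (rule LIMSEQ_I)
      fix \<epsilon> :: real assume "\<epsilon> > 0"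
      then obtain k where k: "norm (f k - u) < \<epsilon> / 2"
        using LIMSEQ_D[OF lim, of "\<epsilon> / 2"] by auto
      have "(\<lambda>n. \<Sum>i\<in>lev n. \<bar>pairing (h i) (f k)\<bar>) \<longlonglongrightarrow> 0"
        using f by (simp add: V_def)
      then obtain N where N: "\<And>n. n \<ge> N \<Longrightarrow> norm ((\<Sum>i\<in>lev n. \<bar>pairing (h i) (f k)\<bar>) - 0) < \<epsilon> / 2"
        using LIMSEQ_D[of _ 0 "\<epsilon> / 2"] \<open>\<epsilon> > 0\<close> half_gt_zero by blast
      have "norm ((\<Sum>i\<in>lev n. \<bar>pairing (h i) u\<bar>) - 0) < \<epsilon>" if "n \<ge> N" for n
      proof -
        have "(\<Sum>i\<in>lev n. \<bar>pairing (h i) u\<bar>)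
            \<le> (\<Sum>i\<in>lev n. \<bar>pairing (h i) (f k)\<bar> + \<bar>pairing (h i) (u - f k)\<bar>)"
          by (intro sum_mono) (simp add: p.diff)
        also have "\<dots> \<le> (\<Sum>i\<in>lev n. \<bar>pairing (h i) (f k)\<bar>) + norm (u - f k)"
          using sum_abs_pairing_h_le[where n = n and u = "u - f k"] by (simp add: sum.distrib)
        also have "\<dots> < \<epsilon>"
          using N[OF that] k by (simp add: norm_minus_commute)
        finally show ?thesis
          by (simp add: sum_nonneg)
      qed
      then show "\<exists>N. \<forall>n\<ge>N. norm ((\<Sum>i\<in>lev n. \<bar>pairing (h i) u\<bar>) - 0) < \<epsilon>"
        by blast
    qed
  qed
  moreover have "chi j \<in> V" if "j \<ge> 1" for j
    unfolding V_def mem_Collect_eq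
  proof (rule tendsto_eventually)
    have "(\<Sum>i\<in>lev n. \<bar>pairing (h i) (chi j)\<bar>) = 0" if "n \<ge> j" for n
    proof (intro sum.neutral ballI)
      fix i assume "i \<in> lev n"
      then have "i \<ge> 2 ^ n"
        by (simp add: lev_def)
      then have "j \<le> i"
        using less_exp[of n] that by linarith
      then show "\<bar>pairing (h i) (chi j)\<bar> = 0"
        using pairing_h_chi[OF \<open>j \<ge> 1\<close>] by simp
    qed
    then show "\<forall>\<^sub>F n in sequentially. (\<Sum>i\<in>lev n. \<bar>pairing (h i) (chi j)\<bar>) = 0"
      unfolding eventually_sequentially by blast
  qed
  ultimately have "u \<in> V"
    using dense by blast
  then show ?thesis
    by (simp add: V_def)
qed

text \<open>Each entry of the matrix is at most \<open>M / 2 ^ n\<close>, and the column sums have the same bound because the Haar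
  functions of one generation have disjoint supports.\<close>

lemma sum_matrix_sq_le:
  assumes T: "bounded_linear T" and M: "\<And>u. norm (T u) \<le> norm u * M" and "M \<ge> 0" and B: "B \<subseteq> lev n"
  shows "(\<Sum>i\<in>B. \<Sum>j\<in>B. (pairing (h i) (T (e j)))\<^sup>2) \<le> M\<^sup>2 / 2 ^ n"
proof -
  have mass_lev: "mass j = 1 / 2 ^ n" if "j \<in> lev n" for j
    using that floor_log_eqI[of j n] lev_ge_1[OF that] by (simp add: mass_def lev_def)
  have "(\<Sum>i\<in>B. \<Sum>j\<in>B. (pairing (h i) (T (e j)))\<^sup>2) = (\<Sum>j\<in>B. \<Sum>i\<in>B. (pairing (h i) (T (e j)))\<^sup>2)"
    by (rule sum.swap)
  also have "\<dots> \<le> (\<Sum>j\<in>B. (M / 2 ^ n)\<^sup>2)"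
  proof (rule sum_mono)
    fix j assume j: "j \<in> B"
    have Tj: "norm (T (e j)) \<le> M / 2 ^ n"
      using M[of "e j"] j B mass_lev[of j] by (auto simp: norm_e)
    have sum: "(\<Sum>i\<in>B. \<bar>pairing (h i) (T (e j))\<bar>) \<le> norm (T (e j))"
      using sum_mono2[OF finite_lev B, of "\<lambda>i. \<bar>pairing (h i) (T (e j))\<bar>"]
        sum_abs_pairing_h_le[where n = n and u = "T (e j)"] by simp
    have fin: "finite B"
      using B finite_subset finite_lev by blast
    have "(\<Sum>i\<in>B. (pairing (h i) (T (e j)))\<^sup>2) \<le> (\<Sum>i\<in>B. \<bar>pairing (h i) (T (e j))\<bar> * norm (T (e j)))"
    proof (rule sum_mono)
      fix i assume i: "i \<in> B"
      have "\<bar>pairing (h i) (T (e j))\<bar> \<le> norm (T (e j))"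
        using member_le_sum[OF i _ fin, of "\<lambda>i. \<bar>pairing (h i) (T (e j))\<bar>"] sum by simp
      then show "(pairing (h i) (T (e j)))\<^sup>2 \<le> \<bar>pairing (h i) (T (e j))\<bar> * norm (T (e j))"
        by (metis abs_ge_zero mult_left_mono power2_abs power2_eq_square)
    qed
    also have "\<dots> \<le> norm (T (e j)) * norm (T (e j))"
      unfolding sum_distrib_right[symmetric] by (intro mult_right_mono sum) auto
    also have "\<dots> \<le> (M / 2 ^ n)\<^sup>2"
      unfolding power2_eq_square using Tj by (intro mult_mono) (auto simp: \<open>M \<ge> 0\<close>)
    finally show "(\<Sum>i\<in>B. (pairing (h i) (T (e j)))\<^sup>2) \<le> (M / 2 ^ n)\<^sup>2" .
  qed
  also have "\<dots> \<le> 2 ^ n * (M / 2 ^ n)\<^sup>2"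
    using card_mono[OF finite_lev B]
    by (auto simp: lev_def intro!: mult_right_mono)
  also have "\<dots> = M\<^sup>2 / 2 ^ n"
    by (simp add: power2_eq_square)
  finally show ?thesis .
qed

definition signed_block :: "nat set \<Rightarrow> nat set \<Rightarrow> 'a \<Rightarrow> real" where
  "signed_block S B x = (\<Sum>i\<in>B. sign_of S i * h i x)"

lemma adapted_signed_block:
  assumes "B \<subseteq> lev n"
  shows "adapted (2 * 2 ^ n) (signed_block S B)"
  unfolding signed_block_def
proof (intro adapted_sum adapted_comp[of _ _ "\<lambda>t. _ * t"])
  fix i assume "i \<in> B"
  then have "Suc i \<le> 2 * 2 ^ n"
    using assms by (auto simp: lev_def)
  then show "adapted (2 * 2 ^ n) (h i)"
    using adapted_h adapted_mono by blast
qed simp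

lemma signed_block_at:
  assumes "B \<subseteq> lev n" "i \<in> lev n" "x \<in> A i"
  shows "signed_block S B x = (if i \<in> B then sign_of S i * h i x else 0)"
proof -
  have "h j x = 0" if "j \<in> B" "j \<noteq> i" for j
    using lev_disjoint[of j n i] that assms h_eq_0[OF lev_ge_1, of j n x] by auto
  then have "signed_block S B x = (\<Sum>j\<in>B. if j = i then sign_of S i * h i x else 0)"
    unfolding signed_block_def by (intro sum.cong) auto
  then show ?thesis
    using finite_subset[OF assms(1)] by simp
qed

lemma abs_signed_block:
  assumes C: "adapted (2 ^ n) (indicator C)" and B: "B = {i \<in> lev n. A i \<subseteq> C}"
  shows "\<bar>signed_block S B x\<bar> = indicator C x"
proof (cases "x \<in> A 1")
  case True
  then obtain i where i: "i \<in> lev n" "x \<in> A i"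
    using leaf_exists[of "2^n" x] by (auto simp: lev_def)
  have "x \<in> C \<longleftrightarrow> A i \<subseteq> C"
  proof
    assume "x \<in> C"
    have "y \<in> C" if "y \<in> A i" for y
      using adaptedD2[OF C, of i x y] i that \<open>x \<in> C\<close>
      by (auto simp: lev_def indicator_def split: if_splits)
    then show "A i \<subseteq> C"
      by blast
  qed (use i in blast)
  then show ?thesis
    using signed_block_at[of B n i x S] i B abs_h[OF lev_ge_1[OF i(1)], of x]
    by (auto simp: abs_mult sign_of_def indicator_def)
next
  case False
  have "B \<subseteq> lev n"
    using B by auto
  then show ?thesis
    using False adaptedD1[OF adapted_signed_block[of B n S], of x] adaptedD1[OF C, of x] by simp
qed

lemma integral_signed_block_adapted:
  assumes B: "B \<subseteq> lev n" and s: "adapted (2 ^ n) s"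
  shows "(\<integral>x. signed_block S B x * s x \<partial>unit_cube) = 0"
proof -
  have int: "integrable unit_cube (\<lambda>x. h i x * s x)" for i
    by (intro integrable_bounded_measurable bounded_measurable_mult
        unsigned.bounded_measurable_signed_haar adapted_bounded_measurable[OF s])
  have "(\<integral>x. signed_block S B x * s x \<partial>unit_cube)
      = (\<integral>x. (\<Sum>i\<in>B. sign_of S i * (h i x * s x)) \<partial>unit_cube)"
    by (simp add: signed_block_def sum_distrib_right mult.assoc)
  also have "\<dots> = (\<Sum>i\<in>B. sign_of S i * (\<integral>x. h i x * s x \<partial>unit_cube))"
    by (simp add: int)
  also have "\<dots> = 0"
    using B by (intro sum.neutral) (auto intro!: integral_h_adapted[OF s] dest: lev_ge_1 simp: lev_def)
  finally show ?thesis .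
qed

lemma to_L1_signed_block:
  "to_L1 (signed_block S B) = (\<Sum>i\<in>B. sign_of S i *\<^sub>R e i)"
proof -
  have "to_L1 (signed_block S B) = (\<Sum>i\<in>B. to_L1 (\<lambda>x. sign_of S i * h i x))"
    unfolding signed_block_def by (intro to_L1_sum[symmetric] integrable_mult_right integrable_h)
  then show ?thesis
    by (simp add: to_L1_scaleR integrable_h)
qed

lemma pairing_signed_block:
  "pairing (signed_block S B) u = (\<Sum>i\<in>B. sign_of S i * pairing (h i) u)"
  unfolding signed_block_def
  by (subst pairing_sum_left)
     (auto simp: pairing_cmult_left intro!: bounded_measurable_mult unsigned.bounded_measurable_signed_haar)

text \<open>The diagonal terms of \<open>\<langle>\<beta>, T \<beta>\<rangle>\<close> add up to the integral of \<open>diag T (Suc n)\<close> over \<open>C\<close>, up to off-diagonal mass, and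
  hence to nearly \<open>\<bar>C\<bar>\<close>; the terms off the diagonal are small for suitable signs.  The remaining tests are small for
  all signs.\<close>

lemma exists_block:
  assumes T: "bounded_linear T" and diag: "diag T \<longlonglongrightarrow> chi 1"
    and C: "adapted N0 (indicator C)"
    and \<Psi>: "finite \<Psi>" "\<And>\<psi>. \<psi> \<in> \<Psi> \<Longrightarrow> bounded_linear \<psi>" and F: "finite F" and "\<epsilon> > 0"
  shows "\<exists>n\<ge>N. \<exists>\<beta>. adapted (2 * 2 ^ n) \<beta> \<and> (\<forall>x. \<bar>\<beta> x\<bar> = indicator C x)
    \<and> (\<forall>s. adapted (2 ^ n) s \<longrightarrow> (\<integral>x. \<beta> x * s x \<partial>unit_cube) = 0)
    \<and> \<bar>pairing \<beta> (T (to_L1 \<beta>)) - (\<integral>x. indicator C x \<partial>unit_cube)\<bar> \<le> \<epsilon>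
    \<and> (\<forall>\<psi>\<in>\<Psi>. \<bar>\<psi> (to_L1 \<beta>) :: real\<bar> \<le> \<epsilon>) \<and> (\<forall>f\<in>F. \<bar>pairing \<beta> f\<bar> \<le> \<epsilon>)"
proof -
  interpret T: bounded_linear T by fact
  obtain M where M: "\<And>u. norm (T u) \<le> norm u * M" "M > 0"
    using T.pos_bounded by auto
  have bmC: "bounded_measurable (indicator C)"
    by (rule adapted_bounded_measurable[OF C])
  have "\<forall>\<^sub>F n in sequentially. \<forall>\<psi>\<in>\<Psi>. (\<Sum>i\<in>lev n. \<bar>\<psi> (e i)\<bar>) < \<epsilon>"
    using \<Psi> \<open>\<epsilon> > 0\<close> by (intro eventually_ball_finite ballI order_tendstoD(2)[OF functional_haar_sum_tendsto_0]) auto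
  moreover have "\<forall>\<^sub>F n in sequentially. \<forall>f\<in>F. (\<Sum>i\<in>lev n. \<bar>pairing (h i) f\<bar>) < \<epsilon>"
    using F \<open>\<epsilon> > 0\<close> by (intro eventually_ball_finite ballI order_tendstoD(2)[OF pairing_haar_sum_tendsto_0]) auto
  moreover have "\<forall>\<^sub>F n in sequentially. sqrt (2 * (M\<^sup>2 * (1 / 2) ^ n)) < \<epsilon> / 3"
  proof (rule order_tendstoD(2))
    have "(\<lambda>n. sqrt (2 * (M\<^sup>2 * (1 / 2) ^ n))) \<longlonglongrightarrow> sqrt (2 * (M\<^sup>2 * 0))"
      by (intro tendsto_intros LIMSEQ_realpow_zero) auto
    then show "(\<lambda>n. sqrt (2 * (M\<^sup>2 * (1 / 2) ^ n))) \<longlonglongrightarrow> 0"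
      by simp
  qed (use \<open>\<epsilon> > 0\<close> in simp)
  moreover have "\<forall>\<^sub>F n in sequentially. norm (diag T (Suc n) - chi 1) < \<epsilon> / 3"
    using tendstoD[OF LIMSEQ_Suc[OF diag], of "\<epsilon> / 3"] \<open>\<epsilon> > 0\<close> by (simp add: dist_norm)
  moreover have "\<forall>\<^sub>F n in sequentially. offdiag_mass T n (Suc n) < \<epsilon> / 3"
    using offdiag_mass_tendsto_0[OF T, of "\<epsilon> / 3"] \<open>\<epsilon> > 0\<close>
    unfolding eventually_sequentially by (meson divide_pos_pos le_SucI order_refl zero_less_numeral)
  moreover have "\<forall>\<^sub>F n in sequentially. n \<ge> max N N0"
    by (rule eventually_ge_at_top)
  ultimately have ev: "\<forall>\<^sub>F n in sequentially. (\<forall>\<psi>\<in>\<Psi>. (\<Sum>i\<in>lev n. \<bar>\<psi> (e i)\<bar>) < \<epsilon>)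
      \<and> (\<forall>f\<in>F. (\<Sum>i\<in>lev n. \<bar>pairing (h i) f\<bar>) < \<epsilon>)
      \<and> sqrt (2 * (M\<^sup>2 * (1 / 2) ^ n)) < \<epsilon> / 3 \<and> norm (diag T (Suc n) - chi 1) < \<epsilon> / 3
      \<and> offdiag_mass T n (Suc n) < \<epsilon> / 3 \<and> n \<ge> max N N0"
    by (intro eventually_conj)
  obtain n where n: "\<And>\<psi>. \<psi> \<in> \<Psi> \<Longrightarrow> (\<Sum>i\<in>lev n. \<bar>\<psi> (e i)\<bar>) < \<epsilon>"
      "\<And>f. f \<in> F \<Longrightarrow> (\<Sum>i\<in>lev n. \<bar>pairing (h i) f\<bar>) < \<epsilon>"
      "sqrt (2 * (M\<^sup>2 * (1 / 2) ^ n)) < \<epsilon> / 3" "norm (diag T (Suc n) - chi 1) < \<epsilon> / 3"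
      "offdiag_mass T n (Suc n) < \<epsilon> / 3" "n \<ge> N" "n \<ge> N0"
    using eventually_happens'[OF sequentially_bot ev] unfolding max.bounded_iff by blast
  define B where "B = {i \<in> lev n. A i \<subseteq> C}"
  define t where "t i j = pairing (h i) (T (e j))" for i j
  have B: "B \<subseteq> lev n" and fin: "finite B"
    by (auto simp: B_def)
  obtain S where S: "(sign_form t B S)\<^sup>2 \<le> 2 * (\<Sum>i\<in>B. \<Sum>j\<in>B. (t i j)\<^sup>2)"
    using exists_signs[OF fin] by blast
  define \<beta> where "\<beta> = signed_block S B"
  have Cn: "adapted (2 ^ n) (indicator C)"
    using n(7) less_exp[of n] by (intro adapted_mono[OF C]) linarith
  have form: "\<bar>sign_form t B S\<bar> \<le> \<epsilon> / 3"
  proof -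
    have "(sign_form t B S)\<^sup>2 \<le> 2 * (M\<^sup>2 * (1 / 2) ^ n)"
      using S sum_matrix_sq_le[OF T M(1) _ B] M(2) unfolding t_def
      by (simp add: power_one_over)
    then have "\<bar>sign_form t B S\<bar> \<le> sqrt (2 * (M\<^sup>2 * (1 / 2) ^ n))"
      by (metis real_sqrt_abs real_sqrt_le_iff)
    then show ?thesis
      using n(3) by linarith
  qed
  have diag_part: "\<bar>(\<Sum>i\<in>B. t i i) - (\<Sum>i\<in>B. pairing (indicator (A i)) (diag T (Suc n)))\<bar> \<le> \<epsilon> / 3"
  proof -
    have "\<bar>(\<Sum>i\<in>B. t i i) - (\<Sum>i\<in>B. pairing (indicator (A i)) (diag T (Suc n)))\<bar>
        \<le> (\<Sum>i\<in>B. \<bar>t i i - pairing (indicator (A i)) (diag T (Suc n))\<bar>)"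
      unfolding sum_subtractf[symmetric] by (rule sum_abs)
    also have "\<dots> \<le> offdiag_mass T n (Suc n)"
      unfolding t_def
    proof (rule sum_block_diag_close[OF T _ B])
      fix K assume K: "K \<in> B"
      then show "adapted (2 ^ Suc n) (h K)"
        using B by (intro adapted_mono[OF adapted_h]) (auto simp: lev_def)
      show "\<bar>h K x\<bar> = indicator (A K) x" for x
        using K B by (intro abs_h lev_ge_1) auto
    qed simp
    finally show ?thesis
      using n(5) by linarith
  qed
  have ind_C: "(\<lambda>x. \<Sum>i\<in>B. indicator (A i) x) = (indicator C :: 'a \<Rightarrow> real)"
  proof
    fix x
    have "(\<Sum>i\<in>B. indicator (A i) x) = (\<Sum>i\<in>lev n. indicator C x * indicator (A i) x :: real)"
    proof (rule sum.mono_neutral_cong_left)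
      show "\<forall>i\<in>lev n - B. indicator C x * indicator (A i) x = (0::real)"
      proof (safe, rule ccontr)
        fix i assume i: "i \<in> lev n" "i \<notin> B" and "indicator C x * indicator (A i) x \<noteq> (0::real)"
        then have "x \<in> C" "x \<in> A i"
          by (auto simp: indicator_def split: if_splits)
        then have "A i \<subseteq> C"
          using adaptedD2[OF Cn, of i x] i by (fastforce simp: lev_def indicator_def split: if_splits)
        then show False
          using i by (auto simp: B_def)
      qed
      show "indicator (A i) x = (indicator C x * indicator (A i) x :: real)" if "i \<in> B" for i
        using that by (auto simp: B_def indicator_def)
    qed (use B in auto)
    also have "\<dots> = indicator C x * indicator (A 1) x"
      using sum_indicator_leaves[of "2^n" x] by (simp add: lev_def flip: sum_distrib_left)
    also have "\<dots> = indicator C x"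
      using adaptedD1[OF Cn, of x] by (auto simp: indicator_def split: if_splits)
    finally show "(\<Sum>i\<in>B. indicator (A i) x) = (indicator C x :: real)" .
  qed
  have sum_pairing: "(\<Sum>i\<in>B. pairing (indicator (A i)) u) = pairing (indicator C) u" for u
    unfolding ind_C[symmetric]
    by (intro pairing_sum_left[symmetric] bounded_measurable_ind) (use B lev_ge_1 in blast)
  interpret pC: bounded_linear "pairing (indicator C)"
    by (rule bounded_linear_pairing[OF bmC])
  have limit_part: "\<bar>pairing (indicator C) (diag T (Suc n)) - (\<integral>x. indicator C x \<partial>unit_cube)\<bar> \<le> \<epsilon> / 3"
  proof -
    have "pairing (indicator C) (chi 1) = (\<integral>x. indicator C x * indicator (A 1) x \<partial>unit_cube)"
      by (intro pairing_to_L1 bmC integrable_ind) simp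
    also have "(\<lambda>x. indicator C x * indicator (A 1) x) = (indicator C :: 'a \<Rightarrow> real)"
      using adaptedD1[OF Cn] by (auto simp: indicator_def fun_eq_iff split: if_splits)
    finally have "pairing (indicator C) (diag T (Suc n)) - (\<integral>x. indicator C x \<partial>unit_cube)
        = pairing (indicator C) (diag T (Suc n) - chi 1)"
      by (simp add: pC.diff)
    also have "\<bar>\<dots>\<bar> \<le> norm (mult_L1 (indicator C) (diag T (Suc n) - chi 1))"
      by (rule abs_pairing_le[OF bmC])
    also have "\<dots> \<le> 1 * norm (diag T (Suc n) - chi 1)"
      by (rule norm_mult_L1_le[OF bmC]) (auto simp: indicator_def)
    finally show ?thesis
      using n(4) by linarith
  qed
  have "pairing \<beta> (T (to_L1 \<beta>)) = (\<Sum>i\<in>B. \<Sum>j\<in>B. sign_of S i * sign_of S j * t i j)"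
  proof -
    interpret p: bounded_linear "pairing (h i)" for i
      by (intro bounded_linear_pairing unsigned.bounded_measurable_signed_haar)
    show ?thesis
      unfolding \<beta>_def to_L1_signed_block pairing_signed_block t_def T.sum T.scaleR p.sum p.scaleR
      by (simp add: sum_distrib_left mult.assoc)
  qed
  also have "\<dots> = (\<Sum>i\<in>B. \<Sum>j\<in>B. (if i = j then t i i else 0)
      + (if i = j then 0 else sign_of S i * sign_of S j * t i j))"
    by (intro sum.cong) auto
  also have "\<dots> = (\<Sum>i\<in>B. t i i) + sign_form t B S"
    using fin unfolding sign_form_def sum.distrib by simp
  finally have "\<bar>pairing \<beta> (T (to_L1 \<beta>)) - (\<integral>x. indicator C x \<partial>unit_cube)\<bar> \<le> \<epsilon>"
    using form diag_part limit_part unfolding sum_pairing by linarith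
  moreover have "\<bar>\<psi> (to_L1 \<beta>)\<bar> \<le> \<epsilon>" if "\<psi> \<in> \<Psi>" for \<psi>
  proof -
    interpret \<psi>: bounded_linear \<psi> using \<Psi> that by auto
    have "\<bar>\<psi> (to_L1 \<beta>)\<bar> \<le> (\<Sum>i\<in>B. \<bar>sign_of S i * \<psi> (e i)\<bar>)"
      unfolding \<beta>_def to_L1_signed_block \<psi>.sum \<psi>.scaleR real_scaleR_def by (rule sum_abs)
    also have "\<dots> = (\<Sum>i\<in>B. \<bar>\<psi> (e i)\<bar>)"
      by (simp add: abs_mult)
    also have "\<dots> \<le> (\<Sum>i\<in>lev n. \<bar>\<psi> (e i)\<bar>)"
      using B by (intro sum_mono2) auto
    finally show ?thesis
      using n(1)[OF that] by linarith
  qed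
  moreover have "\<bar>pairing \<beta> f\<bar> \<le> \<epsilon>" if "f \<in> F" for f
  proof -
    have "\<bar>pairing \<beta> f\<bar> \<le> (\<Sum>i\<in>B. \<bar>sign_of S i * pairing (h i) f\<bar>)"
      unfolding \<beta>_def pairing_signed_block by (rule sum_abs)
    also have "\<dots> = (\<Sum>i\<in>B. \<bar>pairing (h i) f\<bar>)"
      by (simp add: abs_mult)
    also have "\<dots> \<le> (\<Sum>i\<in>lev n. \<bar>pairing (h i) f\<bar>)"
      using B by (intro sum_mono2) auto
    finally show ?thesis
      using n(2)[OF that] by linarith
  qed
  moreover have "adapted (2 * 2 ^ n) \<beta>" "\<forall>x. \<bar>\<beta> x\<bar> = indicator C x"
      "\<forall>s. adapted (2 ^ n) s \<longrightarrow> (\<integral>x. \<beta> x * s x \<partial>unit_cube) = 0"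
    unfolding \<beta>_def using adapted_signed_block[OF B] abs_signed_block[OF Cn B_def]
      integral_signed_block_adapted[OF B] by auto
  ultimately show ?thesis
    using n(6) by blast
qed

end

section \<open>Copies of the Haar system on which a matrix of operators is almost diagonal\<close>

lemma prod_encode_ge: "d + j \<le> prod_encode (d, j)"
proof -
  have "n \<le> triangle n" for n
    by (induction n) auto
  then show ?thesis
    unfolding prod_encode_def by (simp add: trans_le_add1)
qed

lemma prod_encode_strict_mono: "i < j \<Longrightarrow> prod_encode (c, i) < prod_encode (c, j)"
proof -
  have "triangle m < triangle n" if "m < n" for m n
    using that
  proof (induction n)
    case (Suc n)
    then show ?case
      by (cases "m = n") auto
  qed simp
  then show "i < j \<Longrightarrow> prod_encode (c, i) < prod_encode (c, j)"
    unfolding prod_encode_def by simp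
qed

lemma sum_half_power_le: "(\<Sum>i<n. (1/2::real) ^ i) \<le> 2"
proof -
  have "(\<Sum>i<n. (1/2::real) ^ i) = 2 - 2 * (1/2) ^ n"
    by (induction n) auto
  then show ?thesis
    by simp
qed

lemma mass_ge: "(1/2) ^ i \<le> mass i"
proof -
  have "floor_log i \<le> i"
  proof (cases "i = 0")
    case False
    then show ?thesis
      using floor_log_exp2_le[of i] less_exp[of "floor_log i"] by linarith
  qed simp
  then show ?thesis
    unfolding mass_def by (simp add: power_one_over divide_simps)
qed

context dyadic_tree
begin

lemma adapted_borel:
  assumes "adapted n f"
  shows "f \<in> borel_measurable borel"
proof -
  have "adapted (Suc n) f"
    using assms by (rule adapted_mono) simp
  then have eq: "f = (\<lambda>x. \<Sum>i=Suc n..<2*Suc n. f (SOME y. y \<in> A i) * indicator (A i) x)"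
    by (intro ext adapted_eq_sum) simp_all
  show ?thesis
    by (subst eq) (intro borel_measurable_sum borel_measurable_times borel_measurable_const
        borel_measurable_indicator borel, auto)
qed

text \<open>If the functions of the source system are eventually orthogonal to every node, the truncated transfers are eventually
  constant on step functions, hence converge everywhere.\<close>

lemma transfer_limit:
  assumes "signed_dyadic C \<rho>" "signed_dyadic C' \<rho>'"
    and zero: "\<And>i j. 1 \<le> j \<Longrightarrow> j \<le> i \<Longrightarrow> pairing (signed_haar C \<rho> i) (chi j) = 0"
  obtains V :: "'a L1 \<Rightarrow> 'a L1" where "bounded_linear V" "\<And>u. norm (V u) \<le> norm u"
    "\<And>u. (\<lambda>n. haar_transfer C \<rho> C' \<rho>' n u) \<longlonglongrightarrow> V u"
proof (rule limit_operator[of "haar_transfer C \<rho> C' \<rho>'"])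
  show "bounded_linear (haar_transfer C \<rho> C' \<rho>' n)" for n
    by (intro bounded_linear_haar_transfer assms)
  show "norm (haar_transfer C \<rho> C' \<rho>' n u) \<le> norm u" for n u
    by (intro norm_haar_transfer_le assms)
  show "convergent (\<lambda>n. haar_transfer C \<rho> C' \<rho>' n (chi j))" if "j \<ge> 1" for j
  proof -
    have "haar_transfer C \<rho> C' \<rho>' n (chi j) = haar_transfer C \<rho> C' \<rho>' j (chi j)" if "n \<ge> j" for n
      unfolding haar_transfer_def using zero[OF \<open>j \<ge> 1\<close>] that
      by (intro sum.mono_neutral_right) auto
    then have "\<forall>\<^sub>F n in sequentially. haar_transfer C \<rho> C' \<rho>' n (chi j) = haar_transfer C \<rho> C' \<rho>' j (chi j)"
      unfolding eventually_sequentially by blast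
    then have "(\<lambda>n. haar_transfer C \<rho> C' \<rho>' n (chi j)) \<longlonglongrightarrow> haar_transfer C \<rho> C' \<rho>' j (chi j)"
      by (rule tendsto_eventually)
    then show ?thesis
      by (rule convergentI)
  qed
qed (use that in blast)

text \<open>The supports of the blocks of coordinate \<open>c\<close>.  Block \<open>i\<close> of coordinate \<open>c\<close> has index \<open>prod_encode (c, i)\<close>; block \<open>0\<close>
  is the image \<open>\<rho>\<close> of the constant function, and the halves of the support of block \<open>i\<close> are the sets where \<open>\<rho>\<close> times
  this block is \<open>1\<close> and \<open>-1\<close>.  Only blocks with smaller index than \<open>prod_encode (c, i)\<close> occur.\<close>

definition support_of :: "(nat \<Rightarrow> 'a \<Rightarrow> real) \<Rightarrow> nat \<Rightarrow> nat \<Rightarrow> 'a set" where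
  "support_of \<beta> c i = (if i \<le> 1 then A 1
     else {x. \<beta> (prod_encode (c, 0)) x * \<beta> (prod_encode (c, i div 2)) x = (if even i then 1 else -1)})"

lemma adapted_support_of:
  assumes "\<And>l. l < prod_encode (c, i) \<Longrightarrow> adapted N (\<beta> l)" "N \<ge> 1"
  shows "adapted N (indicator (support_of \<beta> c i))"
proof (cases "i \<le> 1")
  case True
  then show ?thesis
    using adapted_mono[OF adapted_indicator[of 1] assms(2)] by (simp add: support_of_def)
next
  case False
  define t where "t = (if even i then 1 else -1 :: real)"
  have eq: "indicator (support_of \<beta> c i) = (\<lambda>x. if \<beta> (prod_encode (c, 0)) x * \<beta> (prod_encode (c, i div 2)) x = t then 1 else 0 :: real)"
    using False by (auto simp: support_of_def t_def indicator_def fun_eq_iff)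
  show ?thesis
    unfolding eq using False
    by (intro adapted_comp2[of N _ _ "\<lambda>a b. if a * b = t then 1 else 0"] assms(1) prod_encode_strict_mono)
       (auto simp: t_def)
qed

text \<open>What is required of the block \<open>r\<close> with index \<open>k\<close> given the earlier blocks \<open>\<beta> l\<close>.  The tolerance is quadratic in
  \<open>(1/4) ^ k\<close> so that it is below \<open>\<epsilon> * (1/4) ^ k * (1/4) ^ l\<close> for all \<open>l \<le> k\<close>.\<close>

definition good_block ::
  "(nat \<Rightarrow> nat \<Rightarrow> 'a L1 \<Rightarrow> 'a L1) \<Rightarrow> real \<Rightarrow> (nat \<Rightarrow> 'a \<Rightarrow> real) \<Rightarrow> nat \<Rightarrow> ('a \<Rightarrow> real) \<Rightarrow> bool" where
  "good_block T \<epsilon> \<beta> k r \<longleftrightarrow> (let c = fst (prod_decode k); i = snd (prod_decode k) in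
    \<exists>n\<ge>k. (\<forall>l<k. adapted (2 ^ n) (\<beta> l)) \<and> adapted (2 * 2 ^ n) r
      \<and> (\<forall>x. \<bar>r x\<bar> = indicator (support_of \<beta> c i) x)
      \<and> (\<forall>s. adapted (2 ^ n) s \<longrightarrow> (\<integral>x. r x * s x \<partial>unit_cube) = 0)
      \<and> \<bar>pairing r (T c c (to_L1 r)) - (\<integral>x. indicator (support_of \<beta> c i) x \<partial>unit_cube)\<bar> \<le> \<epsilon> * (1/4) ^ k * (1/4) ^ k
      \<and> (\<forall>l<k. \<bar>pairing (\<beta> l) (T (fst (prod_decode l)) c (to_L1 r))\<bar> \<le> \<epsilon> * (1/4) ^ k * (1/4) ^ k
            \<and> \<bar>pairing r (T c (fst (prod_decode l)) (to_L1 (\<beta> l)))\<bar> \<le> \<epsilon> * (1/4) ^ k * (1/4) ^ k))"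

lemma exists_good_blocks:
  assumes T: "\<And>c d. bounded_linear (T c d)" and diag: "\<And>c. diag (T c c) \<longlonglongrightarrow> chi 1" and "\<epsilon> > 0"
  shows "\<exists>\<beta>. \<forall>k. good_block T \<epsilon> \<beta> k (\<beta> k)"
proof (rule dependent_wellorder_choice)
  fix r and f g :: "nat \<Rightarrow> 'a \<Rightarrow> real" and k
  assume eq: "\<And>y. y < k \<Longrightarrow> f y = g y"
  define c i where "c = fst (prod_decode k)" and "i = snd (prod_decode k)"
  have k: "k = prod_encode (c, i)"
    by (simp add: c_def i_def)
  have "support_of f c i = support_of g c i"
  proof (cases "i \<le> 1")
    case False
    then have "prod_encode (c, 0) < k" "prod_encode (c, i div 2) < k"
      unfolding k by (auto intro!: prod_encode_strict_mono)
    then show ?thesis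
      by (simp add: support_of_def eq)
  qed (simp add: support_of_def)
  then show "good_block T \<epsilon> f k r = good_block T \<epsilon> g k r"
    unfolding good_block_def Let_def c_def[symmetric] i_def[symmetric] by (simp add: eq cong: conj_cong)
next
  fix k and \<beta> :: "nat \<Rightarrow> 'a \<Rightarrow> real"
  assume good: "\<And>l. l < k \<Longrightarrow> good_block T \<epsilon> \<beta> l (\<beta> l)"
  define c i where "c = fst (prod_decode k)" and "i = snd (prod_decode k)"
  have k: "prod_encode (c, i) = k"
    by (simp add: c_def i_def)
  have "\<exists>M. adapted M (\<beta> l)" if "l < k" for l
    using good[OF that] by (auto simp: good_block_def Let_def)
  then obtain M where M: "\<And>l. l < k \<Longrightarrow> adapted (M l) (\<beta> l)"
    by metis
  \<comment> \<open>fine enough for all earlier blocks\<close>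
  define N where "N = k + sum M {..<k} + 1"
  have N: "adapted N' (\<beta> l)" if "l < k" "N \<le> N'" for l N'
    using member_le_sum[of l "{..<k}" M] that
    by (intro adapted_mono[OF M[OF that(1)]]) (simp add: N_def)
  have C: "adapted N (indicator (support_of \<beta> c i))"
    using N by (intro adapted_support_of) (auto simp: k N_def)
  define \<Psi> where "\<Psi> = (\<lambda>l u. pairing (\<beta> l) (T (fst (prod_decode l)) c u)) ` {..<k}"
  define F where "F = (\<lambda>l. T c (fst (prod_decode l)) (to_L1 (\<beta> l))) ` {..<k}"
  have \<Psi>: "bounded_linear \<psi>" if "\<psi> \<in> \<Psi>" for \<psi>
    using that unfolding \<Psi>_def
    by (auto intro!: bounded_linear_compose[OF bounded_linear_pairing T] adapted_bounded_measurable[OF M])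
  have fin: "finite \<Psi>" "finite F"
    by (auto simp: \<Psi>_def F_def)
  have "\<epsilon> * (1/4) ^ k * (1/4) ^ k > 0"
    using \<open>\<epsilon> > 0\<close> by simp
  from exists_block[OF T diag C fin(1) \<Psi> fin(2) this, where N = N]
  obtain n r where n: "n \<ge> N" and r: "adapted (2 * 2 ^ n) r" "\<forall>x. \<bar>r x\<bar> = indicator (support_of \<beta> c i) x"
      "\<forall>s. adapted (2 ^ n) s \<longrightarrow> (\<integral>x. r x * s x \<partial>unit_cube) = 0"
      "\<bar>pairing r (T c c (to_L1 r)) - (\<integral>x. indicator (support_of \<beta> c i) x \<partial>unit_cube)\<bar> \<le> \<epsilon> * (1/4) ^ k * (1/4) ^ k"
      "\<forall>\<psi>\<in>\<Psi>. \<bar>\<psi> (to_L1 r)\<bar> \<le> \<epsilon> * (1/4) ^ k * (1/4) ^ k" "\<forall>f\<in>F. \<bar>pairing r f\<bar> \<le> \<epsilon> * (1/4) ^ k * (1/4) ^ k"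
    by blast
  have "\<forall>l<k. adapted (2 ^ n) (\<beta> l)"
    using N n less_exp[of n] by (meson less_imp_le order_trans)
  moreover have "n \<ge> k"
    using n by (simp add: N_def)
  ultimately have "good_block T \<epsilon> \<beta> k r"
    unfolding good_block_def Let_def c_def[symmetric] i_def[symmetric]
    using r by (auto simp: \<Psi>_def F_def)
  then show "\<exists>r. good_block T \<epsilon> \<beta> k r"
    by (rule exI[of "good_block T \<epsilon> \<beta> k"])
qed

text \<open>Since \<open>\<rho>\<close> is adapted to a coarser partition than the later blocks, \<open>\<rho>\<close> times a block has integral \<open>0\<close>, so
  each support is cut into halves of equal measure.\<close>

lemma good_blocks_dyadic:
  assumes good: "\<And>k. good_block T \<epsilon> \<beta> k (\<beta> k)"
  shows "signed_dyadic (support_of \<beta> c) (\<beta> (prod_encode (c, 0)))"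
    and "signed_haar (support_of \<beta> c) (\<beta> (prod_encode (c, 0))) i = \<beta> (prod_encode (c, i))"
    and "1 \<le> j \<Longrightarrow> j \<le> i \<Longrightarrow> pairing (\<beta> (prod_encode (c, i))) (chi j) = 0"
proof -
  define b where "b i = \<beta> (prod_encode (c, i))" for i
  define C where "C = support_of \<beta> c"
  have good': "\<exists>n\<ge>prod_encode (c, i). (\<forall>l<prod_encode (c, i). adapted (2 ^ n) (\<beta> l)) \<and> adapted (2 * 2 ^ n) (b i)
      \<and> (\<forall>x. \<bar>b i x\<bar> = indicator (C i) x)
      \<and> (\<forall>s. adapted (2 ^ n) s \<longrightarrow> (\<integral>x. b i x * s x \<partial>unit_cube) = 0)" for i
    using good[of "prod_encode (c, i)"] unfolding good_block_def Let_def b_def C_def by auto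
  have abs_b: "\<bar>b i x\<bar> = indicator (C i) x" for i x
    using good'[of i] by blast
  have ad: "\<exists>N. adapted N (b i)" for i
    using good'[of i] by blast
  have C01: "C 0 = A 1" "C 1 = A 1"
    by (simp_all add: C_def support_of_def)
  have C_even: "C (2 * i) = {x. b 0 x * b i x = 1}" and C_odd: "C (Suc (2 * i)) = {x. b 0 x * b i x = -1}"
    if "i \<ge> 1" for i
    using that by (auto simp: C_def support_of_def b_def)
  have C_sub: "C i \<subseteq> A 1" for i
  proof
    fix x assume "x \<in> C i"
    then have "b i x \<noteq> 0"
      using abs_b[of i x] by auto
    then show "x \<in> A 1"
      using ad[of i] adaptedD1 by blast
  qed
  have b_sq: "b i x * b i x = indicator (C i) x" for i x
    using abs_b[of i x] by (metis abs_mult_self_eq indicator_inter_arith Int_absorb)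
  have bb_abs: "\<bar>b 0 x * b i x\<bar> = indicator (C i) x" for i x
    unfolding abs_mult abs_b C01 using C_sub[of i] by (auto simp: indicator_def)
  have bb: "b 0 x * b i x = indicator (C (2 * i)) x - indicator (C (Suc (2 * i))) x" if "i \<ge> 1" for i x
  proof -
    define t where "t = b 0 x * b i x"
    have "x \<in> C (2 * i) \<longleftrightarrow> t = 1" "x \<in> C (Suc (2 * i)) \<longleftrightarrow> t = -1" "\<bar>t\<bar> = indicator (C i) x"
      using bb_abs[of x i] by (auto simp: t_def C_even[OF that] C_odd[OF that])
    then have "t = indicator (C (2 * i)) x - indicator (C (Suc (2 * i))) x"
      by (cases "x \<in> C i") (auto simp: indicator_def abs_if split: if_splits)
    then show ?thesis
      by (simp add: t_def)
  qed
  have C_split: "C i = C (2 * i) \<union> C (Suc (2 * i))" if "i \<ge> 1" for i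
  proof -
    have "x \<in> C i \<longleftrightarrow> b 0 x * b i x = 1 \<or> b 0 x * b i x = -1" for x
      using bb_abs[of x i] by (auto simp: indicator_def abs_if split: if_splits)
    then show ?thesis
      unfolding C_even[OF that] C_odd[OF that] by auto
  qed
  have C_disjoint: "C (2 * i) \<inter> C (Suc (2 * i)) = {}" if "i \<ge> 1" for i
    unfolding C_even[OF that] C_odd[OF that] by auto
  have C_borel: "C i \<in> sets borel" for i
  proof -
    obtain N where "adapted N (b i)"
      using ad by blast
    then have [measurable]: "b i \<in> borel_measurable borel"
      by (rule adapted_borel)
    have "C i = {x \<in> space borel. \<bar>b i x\<bar> = 1}"
      using abs_b by (auto simp: indicator_def)
    also have "\<dots> \<in> sets borel"
      by measurable
    finally show ?thesis .
  qed
  have integral_bb: "(\<integral>x. b 0 x * b i x \<partial>unit_cube) = 0" if i: "i \<ge> 1" for i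
  proof -
    obtain n where n: "\<forall>l<prod_encode (c, i). adapted (2 ^ n) (\<beta> l)"
      "\<forall>s. adapted (2 ^ n) s \<longrightarrow> (\<integral>x. b i x * s x \<partial>unit_cube) = 0"
      using good'[of i] by blast
    have "adapted (2 ^ n) (b 0)"
      unfolding b_def using i by (intro n(1)[rule_format] prod_encode_strict_mono) simp
    then show ?thesis
      using n(2) by (simp add: mult.commute)
  qed
  have C_measure: "(\<integral>x. indicator (C i) x \<partial>unit_cube) = mass i" if "i \<ge> 1" for i
    using that
  proof (induction i rule: less_induct)
    case (less i)
    show ?case
    proof (cases "i = 1")
      case True
      then show ?thesis
        using C01 measure[of 1] by simp
    next
      case False
      define p where "p = i div 2"
      have p: "p \<ge> 1" "p < i" "i = 2 * p \<or> i = Suc (2 * p)"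
        using False less.prems by (auto simp: p_def)
      have int: "integrable unit_cube (indicator (C j) :: 'a \<Rightarrow> real)" for j
        by (intro integrable_bounded_measurable bounded_measurable_indicator C_borel)
      have "(\<integral>x. indicator (C (2 * p)) x \<partial>unit_cube) - (\<integral>x. indicator (C (Suc (2 * p))) x \<partial>unit_cube) = (0::real)"
        using integral_bb[OF p(1)] int by (simp add: bb[OF p(1)])
      moreover have "(\<integral>x. indicator (C (2 * p)) x \<partial>unit_cube) + (\<integral>x. indicator (C (Suc (2 * p))) x \<partial>unit_cube)
          = (\<integral>x. indicator (C p) x \<partial>unit_cube :: real)"
      proof -
        have "(\<integral>x. indicator (C p) x \<partial>unit_cube)
            = (\<integral>x. indicator (C (2 * p)) x + indicator (C (Suc (2 * p))) x \<partial>unit_cube :: real)"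
          using C_split[OF p(1)] C_disjoint[OF p(1)]
          by (intro Bochner_Integration.integral_cong) (auto simp: indicator_def)
        also have "\<dots> = (\<integral>x. indicator (C (2 * p)) x \<partial>unit_cube) + (\<integral>x. indicator (C (Suc (2 * p))) x \<partial>unit_cube)"
          by (intro Bochner_Integration.integral_add int)
        finally show ?thesis
          by simp
      qed
      ultimately have "(\<integral>x. indicator (C i) x \<partial>unit_cube) = (\<integral>x. indicator (C p) x \<partial>unit_cube :: real) / 2"
        using p(3) by (elim disjE) auto
      also have "\<dots> = mass p / 2"
        using less.IH[OF p(2,1)] by simp
      also have "\<dots> = mass i"
        using p by auto
      finally show ?thesis .
    qed
  qed
  obtain N where "adapted N (b 0)"
    using ad by blast
  then have "bounded_measurable (b 0)"
    by (rule adapted_bounded_measurable)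
  moreover have "\<bar>b 0 x\<bar> \<le> 1" for x
    by (simp add: abs_b indicator_def)
  ultimately have "signed_dyadic C (b 0)"
    by (intro signed_dyadic.intro dyadic_sets.intro signed_dyadic_axioms.intro
        C_borel C_split C_disjoint C_measure)
  then show "signed_dyadic (support_of \<beta> c) (\<beta> (prod_encode (c, 0)))"
    by (simp add: C_def b_def)
  have "signed_haar C (b 0) i x = b i x" for x
  proof (cases "i = 0")
    case True
    then show ?thesis
      using abs_b[of 0 x] C01 by (auto simp: signed_haar_def indicator_def)
  next
    case False
    then have "signed_haar C (b 0) i x = (b 0 x * b 0 x) * b i x"
      using bb[of i x] by (simp add: signed_haar_def mult.assoc)
    also have "\<dots> = b i x"
      unfolding b_sq C01 using abs_b[of i x] C_sub[of i]
      by (cases "x \<in> C i") (auto simp: indicator_def split: if_splits)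
    finally show ?thesis .
  qed
  then show "signed_haar (support_of \<beta> c) (\<beta> (prod_encode (c, 0))) i = \<beta> (prod_encode (c, i))"
    unfolding C_def b_def by (rule ext)
  show "pairing (\<beta> (prod_encode (c, i))) (chi j) = 0" if "1 \<le> j" "j \<le> i"
  proof -
    obtain n where n: "n \<ge> prod_encode (c, i)"
      "\<forall>s. adapted (2 ^ n) s \<longrightarrow> (\<integral>x. b i x * s x \<partial>unit_cube) = 0"
      using good'[of i] by blast
    have "j \<le> 2 ^ n"
      using n(1) that(2) prod_encode_ge[of c i] less_exp[of n] by linarith
    then have "(\<integral>x. b i x * indicator (A j) x \<partial>unit_cube) = 0"
      using n(2) adapted_mono[OF adapted_indicator[OF that(1)]] by blast
    moreover obtain N where "adapted N (b i)"
      using ad by blast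
    ultimately show ?thesis
      using pairing_to_L1[OF adapted_bounded_measurable integrable_ind[OF that(1)]] by (simp add: b_def)
  qed
qed

lemma good_blocks_pairing:
  assumes good: "\<And>k. good_block T \<epsilon> \<beta> k (\<beta> k)" and "\<epsilon> > 0"
  shows "\<bar>pairing (\<beta> (prod_encode (c, i))) (T c d (to_L1 (\<beta> (prod_encode (d, j)))))
      - (if c = d \<and> i = j then mass j else 0)\<bar>
    \<le> \<epsilon> * (1/4) ^ prod_encode (c, i) * (1/4) ^ prod_encode (d, j)"
proof -
  define k l where "k = prod_encode (c, i)" and "l = prod_encode (d, j)"
  have kl: "prod_decode k = (c, i)" "prod_decode l = (d, j)"
    by (simp_all add: k_def l_def)
  have tests: "\<bar>pairing (\<beta> k) (T c c (to_L1 (\<beta> k))) - (\<integral>x. indicator (support_of \<beta> c i) x \<partial>unit_cube)\<bar>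
        \<le> \<epsilon> * (1/4) ^ k * (1/4) ^ k"
      "\<And>l'. l' < k \<Longrightarrow> \<bar>pairing (\<beta> k) (T c (fst (prod_decode l')) (to_L1 (\<beta> l')))\<bar> \<le> \<epsilon> * (1/4) ^ k * (1/4) ^ k"
    using good[of k] by (auto simp: good_block_def Let_def kl)
  have testl: "\<And>k'. k' < l \<Longrightarrow> \<bar>pairing (\<beta> k') (T (fst (prod_decode k')) d (to_L1 (\<beta> l)))\<bar> \<le> \<epsilon> * (1/4) ^ l * (1/4) ^ l"
    using good[of l] by (auto simp: good_block_def Let_def kl)
  have mono: "\<epsilon> * (1/4) ^ b * (1/4) ^ b \<le> \<epsilon> * (1/4) ^ a * (1/4) ^ b" if "a \<le> b" for a b :: nat
    using \<open>\<epsilon> > 0\<close> that by (intro mult_right_mono mult_left_mono power_decreasing) auto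
  have "\<bar>pairing (\<beta> k) (T c d (to_L1 (\<beta> l))) - (if c = d \<and> i = j then mass j else 0)\<bar>
      \<le> \<epsilon> * (1/4) ^ k * (1/4) ^ l"
  proof (cases k l rule: linorder_cases)
    case less
    then have "\<not> (c = d \<and> i = j)"
      by (auto simp: k_def l_def)
    then have "\<bar>pairing (\<beta> k) (T c d (to_L1 (\<beta> l))) - (if c = d \<and> i = j then mass j else 0)\<bar>
        = \<bar>pairing (\<beta> k) (T (fst (prod_decode k)) d (to_L1 (\<beta> l)))\<bar>"
      by (auto simp: kl)
    also have "\<dots> \<le> \<epsilon> * (1/4) ^ l * (1/4) ^ l"
      using testl[OF less] .
    also have "\<dots> \<le> \<epsilon> * (1/4) ^ k * (1/4) ^ l"
      using mono[of k l] less by simp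
    finally show ?thesis .
  next
    case greater
    then have "\<not> (c = d \<and> i = j)"
      by (auto simp: k_def l_def)
    then have "\<bar>pairing (\<beta> k) (T c d (to_L1 (\<beta> l))) - (if c = d \<and> i = j then mass j else 0)\<bar>
        = \<bar>pairing (\<beta> k) (T c (fst (prod_decode l)) (to_L1 (\<beta> l)))\<bar>"
      by (auto simp: kl)
    also have "\<dots> \<le> \<epsilon> * (1/4) ^ k * (1/4) ^ k"
      using tests(2)[OF greater] .
    also have "\<dots> \<le> \<epsilon> * (1/4) ^ k * (1/4) ^ l"
      using mono[of l k] greater by (simp add: mult_ac)
    finally show ?thesis .
  next
    case equal
    then have eq: "c = d" "i = j"
      using kl by auto
    have "(\<integral>x. indicator (support_of \<beta> c i) x \<partial>unit_cube) = mass i"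
    proof (cases "i = 0")
      case True
      then show ?thesis
        using measure[of 1] by (simp add: support_of_def)
    next
      case False
      interpret signed_dyadic "support_of \<beta> c" "\<beta> (prod_encode (c, 0))"
        by (rule good_blocks_dyadic[OF good])
      show ?thesis
        using False by (intro measure) simp
    qed
    then show ?thesis
      using tests(1) eq equal by simp
  qed
  then show ?thesis
    by (simp add: k_def l_def)
qed

text \<open>The entries of \<open>S c \<circ> T c d \<circ> R d\<close> in the Haar basis are the pairings of the blocks, which are those of the
  identity up to \<open>\<epsilon> * (1/4) ^ prod_encode (c, i) * (1/4) ^ prod_encode (d, j)\<close>.  As \<open>c + i \<le> prod_encode (c, i)\<close>, the weights
  outweigh the normalization \<open>1 / mass j \<le> 2 ^ j\<close> and are summable.\<close>

theorem simultaneous_factorization: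
  assumes T: "\<And>c d. bounded_linear (T c d)" and large: "\<And>c. large_diagonal (T c c) \<delta>"
    and "\<delta> > 0" "\<eta> > 0"
  shows "\<exists>(R :: nat \<Rightarrow> 'a L1 \<Rightarrow> 'a L1) (S :: nat \<Rightarrow> 'a L1 \<Rightarrow> 'a L1). (\<forall>c. bounded_linear (R c)) \<and> (\<forall>c. bounded_linear (S c))
    \<and> (\<forall>c u. norm (R c u) \<le> norm u) \<and> (\<forall>c u. norm (S c u) \<le> norm u / \<delta>)
    \<and> (\<forall>c d u. norm (S c (T c d (R d u)) - (if c = d then u else 0)) \<le> \<eta> * (1/2) ^ c * (1/2) ^ d * norm u)"
proof -
  have "\<exists>\<phi>. bounded_measurable \<phi> \<and> (\<forall>x. \<bar>\<phi> x\<bar> \<le> 1 / \<delta>) \<and> diag (\<lambda>u. mult_L1 \<phi> (T c c u)) \<longlonglongrightarrow> chi 1" for c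
    using diag_normalization[OF T large \<open>\<delta> > 0\<close>] by metis
  then obtain \<phi> where \<phi>: "\<And>c. bounded_measurable (\<phi> c)" "\<And>c x. \<bar>\<phi> c x\<bar> \<le> 1 / \<delta>"
    "\<And>c. diag (\<lambda>u. mult_L1 (\<phi> c) (T c c u)) \<longlonglongrightarrow> chi 1"
    by metis
  define T' where "T' c d u = mult_L1 (\<phi> c) (T c d u)" for c d u
  have T': "bounded_linear (T' c d)" for c d
    unfolding T'_def by (intro bounded_linear_compose[OF bounded_linear_mult_L1 T] \<phi>)
  define \<epsilon> where "\<epsilon> = \<eta> / 4"
  have "\<epsilon> > 0"
    using \<open>\<eta> > 0\<close> by (simp add: \<epsilon>_def)
  have "diag (T' c c) \<longlonglongrightarrow> chi 1" for c
    unfolding T'_def by (rule \<phi>)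
  from exists_good_blocks[of T', OF T' this \<open>\<epsilon> > 0\<close>]
  obtain \<beta> where good: "\<And>k. good_block T' \<epsilon> \<beta> k (\<beta> k)"
    by blast
  define b where "b c i = \<beta> (prod_encode (c, i))" for c i
  define C where "C c = support_of \<beta> c" for c
  have sd: "signed_dyadic (C c) (b c 0)" and sh: "signed_haar (C c) (b c 0) i = b c i"
    and zero: "1 \<le> j \<Longrightarrow> j \<le> i \<Longrightarrow> pairing (b c i) (chi j) = 0" for c i j
    unfolding C_def b_def using good_blocks_dyadic[OF good] by auto
  have "\<exists>R. bounded_linear R \<and> (\<forall>u. norm (R u) \<le> norm u)
      \<and> (\<forall>u. (\<lambda>n. haar_transfer A (\<lambda>_. 1) (C c) (b c 0) n u) \<longlonglongrightarrow> R u)" for c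
    using transfer_limit[OF unsigned.signed_dyadic_axioms sd pairing_h_chi] by metis
  then obtain R where R: "\<And>c. bounded_linear (R c)" "\<And>c u. norm (R c u) \<le> norm u"
    "\<And>c u. (\<lambda>n. haar_transfer A (\<lambda>_. 1) (C c) (b c 0) n u) \<longlonglongrightarrow> R c u"
    by metis
  have "\<exists>S. bounded_linear S \<and> (\<forall>u. norm (S u) \<le> norm u)
      \<and> (\<forall>u. (\<lambda>n. haar_transfer (C c) (b c 0) A (\<lambda>_. 1) n u) \<longlonglongrightarrow> S u)" for c
  proof -
    have "pairing (signed_haar (C c) (b c 0) i) (chi j) = 0" if "1 \<le> j" "j \<le> i" for i j
      unfolding sh by (rule zero[OF that])
    from transfer_limit[OF sd unsigned.signed_dyadic_axioms this] show ?thesis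
      by metis
  qed
  then obtain S where S: "\<And>c. bounded_linear (S c)" "\<And>c u. norm (S c u) \<le> norm u"
    "\<And>c u. (\<lambda>n. haar_transfer (C c) (b c 0) A (\<lambda>_. 1) n u) \<longlonglongrightarrow> S c u"
    by metis
  have R_e: "R d (e j) = to_L1 (b d j)" for d j
  proof -
    have "haar_transfer A (\<lambda>_. 1) (C d) (b d 0) n (e j) = to_L1 (b d j)" if "n > j" for n
    proof -
      have "haar_transfer A (\<lambda>_. 1) (C d) (b d 0) n (e j) = (\<Sum>i<n. if i = j then to_L1 (b d j) else 0)"
        unfolding haar_transfer_def sh by (intro sum.cong) (auto simp: pairing_h_e)
      then show ?thesis
        using that by simp
    qed
    then have "\<forall>\<^sub>F n in sequentially. haar_transfer A (\<lambda>_. 1) (C d) (b d 0) n (e j) = to_L1 (b d j)"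
      unfolding eventually_sequentially by (intro exI[of _ "Suc j"]) auto
    then show ?thesis
      using LIMSEQ_unique[OF R(3)[of d "e j"] tendsto_eventually] by blast
  qed
  define w where "w c i = (1/4::real) ^ prod_encode (c, i)" for c i
  have w_nonneg: "w c i \<ge> 0" for c i
    by (simp add: w_def)
  \<comment> \<open>half of the exponent pays for the division by \<open>mass i\<close>, the other half remains\<close>
  have w_mass: "w c i / mass i \<le> (1/2) ^ c * (1/2) ^ i" for c i
  proof -
    have "w c i \<le> (1/4) ^ (c + i)"
      unfolding w_def by (intro power_decreasing prod_encode_ge) auto
    also have "\<dots> = (1/2) ^ (c + i) * ((1/2) ^ (c + i))"
      by (simp flip: power_mult_distrib)
    also have "\<dots> \<le> (1/2) ^ (c + i) * mass i"
    proof (intro mult_left_mono)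
      have "(1/2::real) ^ (c + i) \<le> (1/2) ^ i"
        by (intro power_decreasing) auto
      then show "(1/2) ^ (c + i) \<le> mass i"
        using mass_ge[of i] by linarith
    qed simp
    finally show ?thesis
      by (simp add: divide_le_eq power_add)
  qed
  have w_le: "w c i \<le> (1/2) ^ c * (1/2) ^ i" for c i
  proof -
    have "w c i \<le> w c i / mass i"
    proof -
      have "mass i \<le> 1"
        by (simp add: mass_def)
      then show ?thesis
        using mult_left_mono[of "mass i" 1 "w c i"] w_nonneg by (simp add: le_divide_eq)
    qed
    then show ?thesis
      using w_mass[of c i] by linarith
  qed
  define G where "G c d u = S c (T' c d (R d u)) - (if c = d then u else 0)" for c d u
  have G: "bounded_linear (G c d)" for c d
  proof -
    have "bounded_linear (\<lambda>u. if c = d then u else 0 :: 'a L1)"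
      by (cases "c = d") (auto simp: bounded_linear_ident)
    then show ?thesis
      unfolding G_def
      by (intro bounded_linear_sub bounded_linear_compose[OF S(1) bounded_linear_compose[OF T' R(1)]])
  qed
  have G_e: "norm (G c d (e j)) \<le> 2 * \<epsilon> * (1/2) ^ c * w d j" for c d j
  proof -
    let ?v = "T' c d (to_L1 (b d j))"
    have "norm (haar_transfer (C c) (b c 0) A (\<lambda>_. 1) n ?v - (if c = d then e j else 0))
        \<le> 2 * \<epsilon> * (1/2) ^ c * w d j" if "n > j" for n
    proof -
      define \<kappa> where "\<kappa> i = (if c = d \<and> i = j then mass j else 0)" for i
      have "(if c = d then e j else 0) = (\<Sum>i<n. (\<kappa> i / mass i) *\<^sub>R e i)"
      proof -
        have "(\<Sum>i<n. (\<kappa> i / mass i) *\<^sub>R e i) = (\<Sum>i<n. if i = j then (if c = d then e j else 0) else 0)"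
          by (intro sum.cong) (auto simp: \<kappa>_def)
        then show ?thesis
          using that by simp
      qed
      then have "haar_transfer (C c) (b c 0) A (\<lambda>_. 1) n ?v - (if c = d then e j else 0)
          = (\<Sum>i<n. ((pairing (b c i) ?v - \<kappa> i) / mass i) *\<^sub>R e i)"
        unfolding haar_transfer_def sh by (simp add: sum_subtractf diff_divide_distrib scaleR_left_diff_distrib)
      also have "norm \<dots> \<le> (\<Sum>i<n. \<epsilon> * w d j * (1/2) ^ c * (1/2) ^ i)"
      proof (rule sum_norm_le)
        fix i
        have "norm (((pairing (b c i) ?v - \<kappa> i) / mass i) *\<^sub>R e i) = \<bar>pairing (b c i) ?v - \<kappa> i\<bar>"
          by (simp add: norm_e)
        also have "\<dots> \<le> \<epsilon> * w c i * w d j"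
          unfolding b_def \<kappa>_def w_def by (rule good_blocks_pairing[OF good \<open>\<epsilon> > 0\<close>])
        also have "\<dots> \<le> \<epsilon> * ((1/2) ^ c * (1/2) ^ i) * w d j"
          using \<open>\<epsilon> > 0\<close> w_nonneg by (intro mult_right_mono mult_left_mono w_le) auto
        finally show "norm (((pairing (b c i) ?v - \<kappa> i) / mass i) *\<^sub>R e i) \<le> \<epsilon> * w d j * (1/2) ^ c * (1/2) ^ i"
          by (simp add: mult_ac)
      qed
      also have "\<dots> = \<epsilon> * w d j * (1/2) ^ c * (\<Sum>i<n. (1/2) ^ i)"
        by (rule sum_distrib_left[symmetric])
      also have "\<dots> \<le> \<epsilon> * w d j * (1/2) ^ c * 2"
        using \<open>\<epsilon> > 0\<close> w_nonneg by (intro mult_left_mono sum_half_power_le) auto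
      finally show ?thesis
        by (simp add: mult_ac)
    qed
    then have ev: "\<forall>\<^sub>F n in sequentially. norm (haar_transfer (C c) (b c 0) A (\<lambda>_. 1) n ?v - (if c = d then e j else 0))
        \<le> 2 * \<epsilon> * (1/2) ^ c * w d j"
      unfolding eventually_sequentially by (intro exI[of _ "Suc j"]) auto
    have "(\<lambda>n. norm (haar_transfer (C c) (b c 0) A (\<lambda>_. 1) n ?v - (if c = d then e j else 0)))
        \<longlonglongrightarrow> norm (S c ?v - (if c = d then e j else 0))"
      by (intro tendsto_intros S)
    from tendsto_upperbound[OF this ev] show ?thesis
      by (simp add: G_def R_e)
  qed
  have G_le: "norm (G c d u) \<le> \<eta> * (1/2) ^ c * (1/2) ^ d * norm u" for c d u
  proof -
    interpret G: bounded_linear "G c d" by (rule G)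
    have "norm (G c d (expansion n u)) \<le> \<eta> * (1/2) ^ c * (1/2) ^ d * norm u" for n
    proof -
      have "G c d (expansion n u) = (\<Sum>j<n. (pairing (h j) u / mass j) *\<^sub>R G c d (e j))"
        unfolding haar_transfer_def G.sum G.scaleR ..
      also have "norm \<dots> \<le> (\<Sum>j<n. norm u * (2 * \<epsilon> * (1/2) ^ c * (1/2) ^ d) * (1/2) ^ j)"
      proof (rule sum_norm_le)
        fix j
        have "\<bar>pairing (h j) u\<bar> \<le> norm u"
          using abs_pairing_le[OF unsigned.bounded_measurable_signed_haar, of j u]
            norm_mult_L1_le[OF unsigned.bounded_measurable_signed_haar unsigned.abs_signed_haar_le, of j u]
          by simp
        then have "norm ((pairing (h j) u / mass j) *\<^sub>R G c d (e j))
            \<le> (norm u / mass j) * (2 * \<epsilon> * (1/2) ^ c * w d j)"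
          unfolding norm_scaleR by (intro mult_mono G_e) (auto simp: divide_right_mono)
        also have "\<dots> = norm u * (2 * \<epsilon> * (1/2) ^ c) * (w d j / mass j)"
          by simp
        also have "\<dots> \<le> norm u * (2 * \<epsilon> * (1/2) ^ c) * ((1/2) ^ d * (1/2) ^ j)"
          using \<open>\<epsilon> > 0\<close> by (intro mult_left_mono w_mass) auto
        finally show "norm ((pairing (h j) u / mass j) *\<^sub>R G c d (e j))
            \<le> norm u * (2 * \<epsilon> * (1/2) ^ c * (1/2) ^ d) * (1/2) ^ j"
          by (simp add: mult_ac)
      qed
      also have "\<dots> = norm u * (2 * \<epsilon> * (1/2) ^ c * (1/2) ^ d) * (\<Sum>j<n. (1/2) ^ j)"
        by (rule sum_distrib_left[symmetric])
      also have "\<dots> \<le> norm u * (2 * \<epsilon> * (1/2) ^ c * (1/2) ^ d) * 2"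
        using \<open>\<epsilon> > 0\<close> by (intro mult_left_mono sum_half_power_le) auto
      finally show ?thesis
        by (simp add: \<epsilon>_def mult_ac)
    qed
    moreover have "(\<lambda>n. norm (G c d (expansion n u))) \<longlonglongrightarrow> norm (G c d u)"
      by (intro tendsto_norm G.tendsto expansion_tendsto)
    ultimately show ?thesis
      by (intro LIMSEQ_le_const2) auto
  qed
  define S' where "S' c u = S c (mult_L1 (\<phi> c) u)" for c u
  have "bounded_linear (S' c)" for c
    unfolding S'_def by (intro bounded_linear_compose[OF S(1) bounded_linear_mult_L1] \<phi>)
  moreover have "norm (S' c u) \<le> norm u / \<delta>" for c u
    unfolding S'_def using S(2)[of c "mult_L1 (\<phi> c) u"] norm_mult_L1_le[OF \<phi>(1,2), of c u] by simp
  moreover have "norm (S' c (T c d (R d u)) - (if c = d then u else 0)) \<le> \<eta> * (1/2) ^ c * (1/2) ^ d * norm u" for c d u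
    using G_le[of c d u] by (simp add: G_def S'_def T'_def)
  moreover note R(1,2)
  ultimately show ?thesis
    by - (rule exI[of _ R], rule exI[of _ S'], intro conjI allI)
qed

end

section \<open>Perturbation of the identity and Schauder bases\<close>

text \<open>Completeness is stated for series whose terms decay like a geometric sequence, the form in which a Neumann
  series uses it.\<close>

locale banach_on =
  fixes X :: "'v::real_vector set" and N :: "'v \<Rightarrow> real"
  assumes zero_mem: "0 \<in> X" and add_mem: "\<And>x y. x \<in> X \<Longrightarrow> y \<in> X \<Longrightarrow> x + y \<in> X"
    and scaleR_mem: "\<And>c x. x \<in> X \<Longrightarrow> c *\<^sub>R x \<in> X"
    and N_nonneg: "\<And>x. x \<in> X \<Longrightarrow> 0 \<le> N x"
    and N_eq_0: "\<And>x. x \<in> X \<Longrightarrow> N x = 0 \<Longrightarrow> x = 0"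
    and N_add: "\<And>x y. x \<in> X \<Longrightarrow> y \<in> X \<Longrightarrow> N (x + y) \<le> N x + N y"
    and N_scaleR: "\<And>c x. x \<in> X \<Longrightarrow> N (c *\<^sub>R x) = \<bar>c\<bar> * N x"
    and complete: "\<And>x C. (\<And>k. x k \<in> X) \<Longrightarrow> (\<And>k. N (x k) \<le> C * (1/2) ^ k) \<Longrightarrow>
      \<exists>y\<in>X. (\<lambda>m::nat. N (y - (\<Sum>k<m. x k))) \<longlonglongrightarrow> 0"
begin

lemma diff_mem: "x \<in> X \<Longrightarrow> y \<in> X \<Longrightarrow> x - y \<in> X"
  using add_mem[of x "(-1) *\<^sub>R y"] scaleR_mem[of y "-1"] by simp

lemma sum_mem: "(\<And>i. i \<in> I \<Longrightarrow> f i \<in> X) \<Longrightarrow> sum f I \<in> X"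
  by (induction I rule: infinite_finite_induct) (auto simp: zero_mem add_mem)

lemma N_zero: "N 0 = 0"
  using N_scaleR[OF zero_mem, of 0] by simp

lemma N_minus_commute: "x \<in> X \<Longrightarrow> y \<in> X \<Longrightarrow> N (x - y) = N (y - x)"
  using N_scaleR[of "y - x" "-1"] diff_mem[of y x] by simp

lemma N_triangle3: "x \<in> X \<Longrightarrow> y \<in> X \<Longrightarrow> z \<in> X \<Longrightarrow> N (x - z) \<le> N (x - y) + N (y - z)"
  using N_add[of "x - y" "y - z"] diff_mem by simp

lemma N_sum: "(\<And>i. i \<in> I \<Longrightarrow> f i \<in> X) \<Longrightarrow> N (sum f I) \<le> (\<Sum>i\<in>I. N (f i))"
proof (induction I rule: infinite_finite_induct)
  case (insert i I)
  then show ?case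
    using N_add[of "f i" "sum f I"] sum_mem[of I f] by force
qed (auto simp: N_zero)

lemma limit_unique:
  assumes "x \<in> X" "y \<in> X" "\<And>n. s n \<in> X"
    and "(\<lambda>n::nat. N (x - s n)) \<longlonglongrightarrow> 0" "(\<lambda>n. N (y - s n)) \<longlonglongrightarrow> 0"
  shows "x = y"
proof -
  have "(\<lambda>n. N (x - s n) + N (y - s n)) \<longlonglongrightarrow> 0 + 0"
    by (intro tendsto_add assms)
  moreover have "N (x - y) \<le> N (x - s n) + N (y - s n)" for n
    using N_triangle3[of x "s n" y] N_minus_commute[of "s n" y] assms by simp
  ultimately have "N (x - y) \<le> 0 + 0"
    by (intro LIMSEQ_le_const) auto
  then show ?thesis
    using N_eq_0[of "x - y"] N_nonneg[of "x - y"] diff_mem assms by fastforce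
qed

text \<open>The inverse is the Neumann series of \<open>D x = x - V x\<close>.\<close>

lemma left_inverse_near_identity:
  assumes V: "bounded_operator X N V" and near: "\<And>x. x \<in> X \<Longrightarrow> N (V x - x) \<le> N x / 2"
  shows "\<exists>W. bounded_operator X N W \<and> (\<forall>x\<in>X. W (V x) = x)"
proof -
  define D where "D x = x - V x" for x
  have V_mem: "V x \<in> X" and V_add: "V (x + y) = V x + V y" and V_scaleR: "V (c *\<^sub>R x) = c *\<^sub>R V x"
    if "x \<in> X" "y \<in> X" for x y c
    using V that by (auto simp: bounded_operator_def)
  have D_mem: "D x \<in> X" if "x \<in> X" for x
    using that by (simp add: D_def V_mem[OF that that] diff_mem)
  have D_add: "D (x + y) = D x + D y" if "x \<in> X" "y \<in> X" for x y
    using that by (simp add: D_def V_add)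
  have D_scaleR: "D (c *\<^sub>R x) = c *\<^sub>R D x" if "x \<in> X" for x c
    using that by (simp add: D_def V_scaleR[OF that that] scaleR_diff_right)
  have D_N: "N (D x) \<le> N x / 2" if "x \<in> X" for x
    unfolding D_def using near[OF that] N_minus_commute[of "V x" x] V_mem[OF that that] that by simp
  have pow_mem: "(D ^^ k) x \<in> X" if "x \<in> X" for k x
    using that by (induction k) (auto simp: D_mem)
  have pow_add: "(D ^^ k) (x + y) = (D ^^ k) x + (D ^^ k) y" if "x \<in> X" "y \<in> X" for k x y
    using that by (induction k) (auto simp: D_add pow_mem)
  have pow_scaleR: "(D ^^ k) (c *\<^sub>R x) = c *\<^sub>R (D ^^ k) x" if "x \<in> X" for k x c
    using that by (induction k) (auto simp: D_scaleR pow_mem)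
  have pow_N: "N ((D ^^ k) x) \<le> N x * (1/2) ^ k" if "x \<in> X" for k x
  proof (induction k)
    case (Suc k)
    then show ?case
      using D_N[OF pow_mem[OF that], of k] by simp
  qed simp
  define s where "s m x = (\<Sum>k<m. (D ^^ k) x)" for m x
  have s_mem: "s m x \<in> X" if "x \<in> X" for m x
    unfolding s_def using that by (intro sum_mem pow_mem)
  have "\<exists>y\<in>X. (\<lambda>m. N (y - s m x)) \<longlonglongrightarrow> 0" if "x \<in> X" for x
    unfolding s_def by (intro complete[of _ "N x"] pow_mem pow_N that)
  then obtain W where W_mem: "\<And>x. x \<in> X \<Longrightarrow> W x \<in> X"
    and W: "\<And>x. x \<in> X \<Longrightarrow> (\<lambda>m. N (W x - s m x)) \<longlonglongrightarrow> 0"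
    by metis
  have W_unique: "W x = y" if "x \<in> X" "y \<in> X" "(\<lambda>m. N (y - s m x)) \<longlonglongrightarrow> 0" for x y
    using limit_unique[of "W x" y "\<lambda>m. s m x"] that W W_mem s_mem by blast
  have "W (V x) = x" if x: "x \<in> X" for x
  proof (rule W_unique)
    have "x - s m (V x) = (D ^^ m) x" for m
    proof (induction m)
      case (Suc m)
      have "(D ^^ m) (V x + D x) = (D ^^ m) (V x) + (D ^^ m) (D x)"
        using x by (intro pow_add V_mem D_mem)
      moreover have "V x + D x = x"
        by (simp add: D_def)
      moreover have "(D ^^ m) (D x) = (D ^^ Suc m) x"
        by (simp add: funpow_swap1)
      ultimately have "(D ^^ m) x = (D ^^ m) (V x) + (D ^^ Suc m) x"
        by metis
      then show ?case
        using Suc by (simp add: s_def algebra_simps del: funpow.simps)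
    qed (simp add: s_def)
    moreover have "(\<lambda>m. N ((D ^^ m) x)) \<longlonglongrightarrow> 0"
    proof (rule Lim_null_comparison)
      show "\<forall>\<^sub>F m in sequentially. norm (N ((D ^^ m) x)) \<le> N x * (1/2) ^ m"
        using pow_N[OF x] N_nonneg[OF pow_mem[OF x]] by simp
      show "(\<lambda>m. N x * (1/2) ^ m) \<longlonglongrightarrow> 0"
        by (intro tendsto_mult_right_zero LIMSEQ_realpow_zero) auto
    qed
    ultimately show "(\<lambda>m. N (x - s m (V x))) \<longlonglongrightarrow> 0"
      by simp
  qed (use x V_mem in auto)
  moreover have "bounded_operator X N W"
    unfolding bounded_operator_def
  proof (intro conjI ballI allI exI[of _ 2])
    fix x assume x: "x \<in> X"
    show "W x \<in> X"
      by (rule W_mem[OF x])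
    fix y assume y: "y \<in> X"
    show "W (x + y) = W x + W y"
    proof (rule W_unique)
      have "s m (x + y) = s m x + s m y" for m
        using x y by (simp add: s_def pow_add sum.distrib)
      then have eq: "W x + W y - s m (x + y) = (W x - s m x) + (W y - s m y)" for m
        by simp
      have mem: "W x - s m x \<in> X" "W y - s m y \<in> X" for m
        by (intro diff_mem W_mem s_mem x y)+
      show "(\<lambda>m. N (W x + W y - s m (x + y))) \<longlonglongrightarrow> 0"
        unfolding eq
      proof (rule Lim_null_comparison)
        show "\<forall>\<^sub>F m in sequentially. norm (N ((W x - s m x) + (W y - s m y))) \<le> N (W x - s m x) + N (W y - s m y)"
          using N_add[OF mem] N_nonneg[OF add_mem[OF mem]] by (intro always_eventually) simp
        show "(\<lambda>m. N (W x - s m x) + N (W y - s m y)) \<longlonglongrightarrow> 0"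
          using tendsto_add[OF W[OF x] W[OF y]] by simp
      qed
    qed (use x y W_mem add_mem in auto)
  next
    fix c x assume x: "x \<in> X"
    show "W (c *\<^sub>R x) = c *\<^sub>R W x"
    proof (rule W_unique)
      have "c *\<^sub>R W x - s m (c *\<^sub>R x) = c *\<^sub>R (W x - s m x)" for m
        using x by (simp add: s_def pow_scaleR scaleR_right.sum scaleR_diff_right)
      then have "N (c *\<^sub>R W x - s m (c *\<^sub>R x)) = \<bar>c\<bar> * N (W x - s m x)" for m
        using x W_mem s_mem diff_mem by (simp add: N_scaleR)
      then show "(\<lambda>m. N (c *\<^sub>R W x - s m (c *\<^sub>R x))) \<longlonglongrightarrow> 0"
        using tendsto_mult_right_zero[OF W[OF x], of "\<bar>c\<bar>"] by simp
    qed (use x W_mem scaleR_mem in auto)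
  next
    fix x assume x: "x \<in> X"
    have "N (W x) \<le> N (W x - s m x) + 2 * N x" for m
    proof -
      have "N (s m x) \<le> (\<Sum>k<m. N x * (1/2) ^ k)"
        unfolding s_def using N_sum[of "{..<m}" "\<lambda>k. (D ^^ k) x"] sum_mono[of "{..<m}" "\<lambda>k. N ((D ^^ k) x)"]
          pow_mem[OF x] pow_N[OF x] by (meson order_trans)
      also have "\<dots> \<le> N x * 2"
        unfolding sum_distrib_left[symmetric] by (intro mult_left_mono sum_half_power_le N_nonneg x)
      finally show ?thesis
        using N_add[of "W x - s m x" "s m x"] W_mem[OF x] s_mem[OF x] diff_mem by fastforce
    qed
    moreover have "(\<lambda>m. N (W x - s m x) + 2 * N x) \<longlonglongrightarrow> 0 + 2 * N x"
      by (intro tendsto_intros W x)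
    ultimately show "N (W x) \<le> 2 * N x"
      using LIMSEQ_le_const[of _ "0 + 2 * N x" "N (W x)"] by auto
  qed
  ultimately show ?thesis
    by blast
qed

lemma bounded_operator_compose:
  assumes "bounded_operator X N F" "bounded_operator X N G"
  shows "bounded_operator X N (\<lambda>x. F (G x))"
proof -
  obtain C where C: "\<And>x. x \<in> X \<Longrightarrow> N (F x) \<le> C * N x"
    using assms(1) unfolding bounded_operator_def by blast
  obtain D where D: "\<And>x. x \<in> X \<Longrightarrow> N (G x) \<le> D * N x"
    using assms(2) unfolding bounded_operator_def by blast
  have "N (F (G x)) \<le> (max 0 C * D) * N x" if "x \<in> X" for x
  proof -
    have "G x \<in> X"
      using assms(2) that by (auto simp: bounded_operator_def)
    then have "N (F (G x)) \<le> max 0 C * N (G x)"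
      using C[of "G x"] N_nonneg[of "G x"] mult_right_mono[of C "max 0 C" "N (G x)"] by simp
    also have "\<dots> \<le> max 0 C * (D * N x)"
      using D[OF that] by (intro mult_left_mono) auto
    finally show ?thesis
      by (simp add: mult.assoc)
  qed
  then show ?thesis
    using assms unfolding bounded_operator_def by auto
qed

lemma identity_factors:
  assumes "bounded_operator X N T" "bounded_operator X N R" "bounded_operator X N S"
    and "\<And>x. x \<in> X \<Longrightarrow> N (S (T (R x)) - x) \<le> N x / 2"
  shows "\<exists>R S. bounded_operator X N R \<and> bounded_operator X N S \<and> (\<forall>x\<in>X. x = S (T (R x)))"
proof -
  have "bounded_operator X N (\<lambda>x. S (T (R x)))"
    by (intro bounded_operator_compose[of S "\<lambda>x. T (R x)"] bounded_operator_compose[of T R] assms)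
  then obtain W where W: "bounded_operator X N W" "\<And>x. x \<in> X \<Longrightarrow> W (S (T (R x))) = x"
    using left_inverse_near_identity[of "\<lambda>x. S (T (R x))"] assms(4) by blast
  have "bounded_operator X N (\<lambda>x. W (S x))"
    by (rule bounded_operator_compose[OF W(1) assms(3)])
  then show ?thesis
    using assms(2) W(2) by (intro exI[of _ R] exI[of _ "\<lambda>x. W (S x)"]) auto
qed

text \<open>The coefficients of an expansion are unique because the biorthogonal functionals are continuous.\<close>

lemma normalized_schauder_basisI:
  assumes b: "\<And>k. b k \<in> X" "\<And>k. N (b k) = 1"
    and \<phi>: "\<And>k. bounded_functional X N (\<phi> k)" "\<And>k l. \<phi> k (b l) = (if k = l then 1 else 0)"
    and conv: "\<And>x. x \<in> X \<Longrightarrow> (\<lambda>n. N (x - (\<Sum>k<n. \<phi> k x *\<^sub>R b k))) \<longlonglongrightarrow> 0"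
  shows "normalized_schauder_basis X N b"
  unfolding normalized_schauder_basis_def
proof (intro conjI allI ballI b)
  fix x assume x: "x \<in> X"
  show "\<exists>!a. (\<lambda>n. N (x - (\<Sum>k<n. a k *\<^sub>R b k))) \<longlonglongrightarrow> 0"
  proof (rule ex1I)
    show "(\<lambda>n. N (x - (\<Sum>k<n. \<phi> k x *\<^sub>R b k))) \<longlonglongrightarrow> 0"
      by (rule conv[OF x])
    fix a assume a: "(\<lambda>n. N (x - (\<Sum>k<n. a k *\<^sub>R b k))) \<longlonglongrightarrow> 0"
    show "a = (\<lambda>k. \<phi> k x)"
    proof
      fix j
      have add: "\<phi> j (u + v) = \<phi> j u + \<phi> j v" and scale: "\<phi> j (c *\<^sub>R u) = c * \<phi> j u"
        if "u \<in> X" "v \<in> X" for u v c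
        using \<phi>(1)[of j] that by (auto simp: bounded_functional_def)
      obtain C where C: "\<And>u. u \<in> X \<Longrightarrow> \<bar>\<phi> j u\<bar> \<le> C * N u"
        using \<phi>(1)[of j] unfolding bounded_functional_def by blast
      have mem: "(\<Sum>k<n. a k *\<^sub>R b k) \<in> X" for n
        by (intro sum_mem scaleR_mem b)
      have part: "\<phi> j (\<Sum>k<n. a k *\<^sub>R b k) = (\<Sum>k<n. if j = k then a k else 0)" for n
      proof (induction n)
        case 0
        show ?case
          using scale[OF zero_mem zero_mem, of 0] by simp
      next
        case (Suc n)
        then show ?case
          using add[OF mem[of n] scaleR_mem[OF b(1)[of n], of "a n"]] scale[OF b(1)[of n] b(1)[of n], of "a n"] \<phi>(2)[of j n]
          by simp
      qed
      have "\<bar>\<phi> j x - a j\<bar> \<le> C * N (x - (\<Sum>k<n. a k *\<^sub>R b k))" if "n > j" for n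
      proof -
        have "\<phi> j (x - (\<Sum>k<n. a k *\<^sub>R b k)) = \<phi> j x - \<phi> j (\<Sum>k<n. a k *\<^sub>R b k)"
          using add[OF diff_mem[OF x mem[of n]] mem[of n]] by simp
        then show ?thesis
          using C[OF diff_mem[OF x mem[of n]]] that by (simp add: part)
      qed
      moreover have "(\<lambda>n. C * N (x - (\<Sum>k<n. a k *\<^sub>R b k))) \<longlonglongrightarrow> C * 0"
        by (intro tendsto_intros a)
      ultimately have "\<bar>\<phi> j x - a j\<bar> \<le> C * 0"
        by (intro LIMSEQ_le_const[of "\<lambda>n. C * N (x - (\<Sum>k<n. a k *\<^sub>R b k))"]) (auto intro!: exI[of _ "Suc j"])
      then show "a j = \<phi> j x"
        by simp
    qed
  qed
qed

end

lemma banach_on_UNIV: "banach_on (UNIV :: 'b::banach set) norm"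
proof
  fix x :: "nat \<Rightarrow> 'b" and C
  assume bound: "\<And>k. norm (x k) \<le> C * (1/2) ^ k"
  have "summable x"
    by (rule summable_comparison_test'[of "\<lambda>k. C * (1/2) ^ k"])
       (auto intro!: summable_mult summable_geometric bound)
  then have "(\<lambda>m. suminf x - (\<Sum>k<m. x k)) \<longlonglongrightarrow> suminf x - suminf x"
    by (intro tendsto_diff tendsto_const summable_LIMSEQ)
  then have "(\<lambda>m. norm (suminf x - (\<Sum>k<m. x k))) \<longlonglongrightarrow> 0"
    by (intro tendsto_norm_zero) simp
  then show "\<exists>y\<in>UNIV. (\<lambda>m. norm (y - (\<Sum>k<m. x k))) \<longlonglongrightarrow> 0"
    by blast
qed (auto intro: norm_triangle_ineq)

lemma sum_fun_eval: "(\<Sum>i\<in>I. f i) x = (\<Sum>i\<in>I. f i x :: 'b::comm_monoid_add)"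
  by (induction I rule: infinite_finite_induct) (auto simp: zero_fun_def plus_fun_def)

section \<open>The spaces \<open>\<ell>\<^sup>p(X)\<close>\<close>

lemma convex_powr_nonneg:
  assumes "p \<ge> 1" "x \<ge> 0" "y \<ge> 0" "s \<ge> 0" "t \<ge> 0" "s + t = (1::real)"
  shows "(s * x + t * y) powr p \<le> s * x powr p + t * y powr p"
proof -
  have contract: "(r * z) powr p \<le> r * z powr p" if "0 \<le> r" "r \<le> 1" "z \<ge> 0" for r z :: real
  proof -
    have "r powr p \<le> r powr 1"
      using that assms(1) by (intro powr_mono') auto
    then show ?thesis
      using that by (simp add: powr_mult mult_right_mono)
  qed
  show ?thesis
  proof (cases "x > 0 \<and> y > 0")
    case True
    moreover have s: "s = 1 - t"
      using assms by simp
    ultimately show ?thesis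
      using convex_onD[OF powr_convex[OF assms(1)], of t x y] assms(4,5) unfolding s by simp
  next
    case False
    then have "x = 0 \<or> y = 0"
      using assms by auto
    then show ?thesis
      using contract[of s x] contract[of t y] assms by auto
  qed
qed

context
  fixes p :: real
  assumes p: "1 \<le> p"
begin

lemma lp_norm_nonneg: "0 \<le> lp_norm p f"
  by (simp add: lp_norm_def)

lemma lp_norm_powr:
  assumes "f \<in> lp_space p"
  shows "lp_norm p f powr p = (\<Sum>n. norm (f n) powr p)"
proof -
  have "(\<Sum>n. norm (f n) powr p) \<ge> 0"
    using assms by (intro suminf_nonneg) (auto simp: lp_space_def)
  then show ?thesis
    using p by (simp add: lp_norm_def powr_powr)
qed

lemma sum_powr_le_lp_norm:
  assumes "f \<in> lp_space p"
  shows "(\<Sum>n<m. norm (f n) powr p) \<le> lp_norm p f powr p"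
  unfolding lp_norm_powr[OF assms] using assms
  by (intro sum_le_suminf) (auto simp: lp_space_def)

lemma norm_le_lp_norm:
  assumes "f \<in> lp_space p"
  shows "norm (f n) \<le> lp_norm p f"
proof -
  have "norm (f n) powr p \<le> (\<Sum>n<Suc n. norm (f n) powr p)"
    by (rule member_le_sum) auto
  also have "\<dots> \<le> lp_norm p f powr p"
    by (rule sum_powr_le_lp_norm[OF assms])
  finally show ?thesis
    using p lp_norm_nonneg powr_less_mono2[of p "lp_norm p f" "norm (f n)"] by (meson less_le_trans not_le zero_less_one)
qed

lemma lp_boundI:
  assumes "\<And>m. (\<Sum>n<m. norm (f n) powr p) \<le> B powr p" "B \<ge> 0"
  shows "f \<in> lp_space p" "lp_norm p f \<le> B"
proof -
  show f: "f \<in> lp_space p"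
    unfolding lp_space_def mem_Collect_eq by (rule summableI_nonneg_bounded[OF _ assms(1)]) auto
  then have "(\<Sum>n. norm (f n) powr p) \<le> B powr p"
    by (intro suminf_le_const assms) (auto simp: lp_space_def)
  then have "lp_norm p f \<le> (B powr p) powr (1 / p)"
    unfolding lp_norm_def using p f
    by (intro powr_mono2) (auto intro!: suminf_nonneg simp: lp_space_def)
  then show "lp_norm p f \<le> B"
    using p assms(2) by (simp add: powr_powr)
qed

lemma lp_mono:
  assumes "g \<in> lp_space p" "\<And>n. norm (f n) \<le> K * norm (g n)" "K \<ge> 0"
  shows "f \<in> lp_space p" "lp_norm p f \<le> K * lp_norm p g"
proof -
  have "(\<Sum>n<m. norm (f n) powr p) \<le> (K * lp_norm p g) powr p" for m
  proof -
    have "(\<Sum>n<m. norm (f n) powr p) \<le> (\<Sum>n<m. K powr p * norm (g n) powr p)"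
      using assms p by (intro sum_mono) (auto simp flip: powr_mult intro!: powr_mono2)
    also have "\<dots> \<le> K powr p * lp_norm p g powr p"
      unfolding sum_distrib_left[symmetric] by (intro mult_left_mono sum_powr_le_lp_norm assms) auto
    finally show ?thesis
      using assms(3) lp_norm_nonneg by (simp add: powr_mult)
  qed
  moreover have "0 \<le> K * lp_norm p g"
    by (rule mult_nonneg_nonneg[OF assms(3) lp_norm_nonneg])
  ultimately show "f \<in> lp_space p" "lp_norm p f \<le> K * lp_norm p g"
    by (rule lp_boundI)+
qed

text \<open>For \<open>a\<close>, \<open>b\<close> above the two norms, \<open>(f + g) / (a + b)\<close> is a convex combination of \<open>f / a\<close> and \<open>g / b\<close>, so the convexity
  of \<open>x powr p\<close> bounds its \<open>p\<close>-th powers by \<open>1\<close> in the sum.\<close>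

lemma lp_triangle:
  assumes f: "f \<in> lp_space p" and g: "g \<in> lp_space p"
  shows "(\<lambda>n. f n + g n) \<in> lp_space p" "lp_norm p (\<lambda>n. f n + g n) \<le> lp_norm p f + lp_norm p g"
proof -
  \<comment> \<open>strict upper bounds for the norms avoid the case of norm \<open>0\<close>\<close>
  have bound: "(\<Sum>n<m. norm (f n + g n) powr p) \<le> (a + b) powr p"
    if ab: "a > lp_norm p f" "b > lp_norm p g" for a b m
  proof -
    have pos: "a > 0" "b > 0"
      using ab lp_norm_nonneg[of f] lp_norm_nonneg[of g] by auto
    have scaled: "(\<Sum>n<m. (norm (u n) / c) powr p) \<le> 1" if "u \<in> lp_space p" "c > lp_norm p u" for c and u :: "nat \<Rightarrow> 'd::real_normed_vector"
    proof -
      have c: "c > 0"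
        using that lp_norm_nonneg[of u] by linarith
      have "(\<Sum>n<m. norm (u n) powr p) \<le> c powr p"
        using sum_powr_le_lp_norm[OF that(1), of m] powr_mono2[of p "lp_norm p u" c] that p lp_norm_nonneg[of u] by simp
      then show ?thesis
        using c by (simp add: powr_divide sum_divide_distrib[symmetric])
    qed
    have "norm (f n + g n) powr p \<le> (a + b) powr p * (a / (a + b) * (norm (f n) / a) powr p + b / (a + b) * (norm (g n) / b) powr p)" for n
    proof -
      have "norm (f n + g n) powr p \<le> (norm (f n) + norm (g n)) powr p"
        using p by (intro powr_mono2 norm_triangle_ineq) auto
      also have "\<dots> = ((a + b) * (a / (a + b) * (norm (f n) / a) + b / (a + b) * (norm (g n) / b))) powr p"
        using pos by (simp add: distrib_left add_pos_pos less_imp_neq[symmetric])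
      also have "\<dots> = (a + b) powr p * (a / (a + b) * (norm (f n) / a) + b / (a + b) * (norm (g n) / b)) powr p"
        using pos by (intro powr_mult)
      also have "\<dots> \<le> (a + b) powr p * (a / (a + b) * (norm (f n) / a) powr p + b / (a + b) * (norm (g n) / b) powr p)"
        using pos p by (intro mult_left_mono convex_powr_nonneg) (auto simp: add_divide_distrib[symmetric])
      finally show ?thesis .
    qed
    then have "(\<Sum>n<m. norm (f n + g n) powr p) \<le> (\<Sum>n<m. (a + b) powr p *
        (a / (a + b) * (norm (f n) / a) powr p + b / (a + b) * (norm (g n) / b) powr p))"
      by (rule sum_mono)
    also have "\<dots> = (a + b) powr p * (a / (a + b) * (\<Sum>n<m. (norm (f n) / a) powr p)
        + b / (a + b) * (\<Sum>n<m. (norm (g n) / b) powr p))"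
      by (simp only: sum.distrib sum_distrib_left distrib_left)
    also have "\<dots> \<le> (a + b) powr p * (a / (a + b) * 1 + b / (a + b) * 1)"
      using pos ab by (intro mult_left_mono add_mono scaled f g) auto
    also have "\<dots> = (a + b) powr p"
      using pos by (simp add: add_divide_distrib[symmetric])
    finally show ?thesis .
  qed
  have pos: "a + b \<ge> 0" if "a > lp_norm p f" "b > lp_norm p g" for a b
    using that lp_norm_nonneg[of f] lp_norm_nonneg[of g] by linarith
  show "(\<lambda>n. f n + g n) \<in> lp_space p"
    using lp_boundI(1)[OF bound pos, of "lp_norm p f + 1" "lp_norm p g + 1"] by simp
  have "lp_norm p (\<lambda>n. f n + g n) \<le> lp_norm p f + lp_norm p g + \<epsilon>" if "\<epsilon> > 0" for \<epsilon>
    using lp_boundI(2)[OF bound pos, of "lp_norm p f + \<epsilon> / 2" "lp_norm p g + \<epsilon> / 2"] that by simp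
  then show "lp_norm p (\<lambda>n. f n + g n) \<le> lp_norm p f + lp_norm p g"
    by (rule field_le_epsilon)
qed

lemma lp_scaleR:
  assumes f: "f \<in> lp_space p"
  shows "(\<lambda>n. c *\<^sub>R f n) \<in> lp_space p" "lp_norm p (\<lambda>n. c *\<^sub>R f n) = \<bar>c\<bar> * lp_norm p f"
proof -
  show mem: "(\<lambda>n. c *\<^sub>R f n) \<in> lp_space p"
    by (rule lp_mono(1)[OF f, of _ "\<bar>c\<bar>"]) auto
  have le: "lp_norm p (\<lambda>n. c *\<^sub>R f n) \<le> \<bar>c\<bar> * lp_norm p f"
    by (rule lp_mono(2)[OF f]) auto
  show "lp_norm p (\<lambda>n. c *\<^sub>R f n) = \<bar>c\<bar> * lp_norm p f"
  proof (cases "c = 0")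
    case True
    then show ?thesis
      using le lp_norm_nonneg[of "\<lambda>n. c *\<^sub>R f n"] by simp
  next
    case False
    have "lp_norm p f \<le> \<bar>inverse c\<bar> * lp_norm p (\<lambda>n. c *\<^sub>R f n)"
      by (rule lp_mono(2)[OF mem]) (simp_all add: False flip: mult.assoc)
    then have "\<bar>c\<bar> * lp_norm p f \<le> \<bar>c\<bar> * (\<bar>inverse c\<bar> * lp_norm p (\<lambda>n. c *\<^sub>R f n))"
      by (intro mult_left_mono) auto
    then show ?thesis
      using le False by (simp add: mult.assoc[symmetric] flip: abs_mult)
  qed
qed

lemma lp_norm_le_summable:
  assumes "summable (\<lambda>n. norm (f n))"
  shows "f \<in> lp_space p" "lp_norm p f \<le> (\<Sum>n. norm (f n))"
proof -
  define s where "s = (\<Sum>n. norm (f n))"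
  have fs: "norm (f n) \<le> s" for n
    unfolding s_def using sum_le_suminf[OF assms, of "{n}"] by simp
  have s: "s \<ge> 0"
    unfolding s_def using assms by (intro suminf_nonneg) auto
  have "(\<Sum>n<m. norm (f n) powr p) \<le> s powr p" for m
  proof -
    have "norm (f n) powr p \<le> s powr (p - 1) * norm (f n)" for n
    proof (cases "f n = 0")
      case False
      then have "norm (f n) powr p = norm (f n) powr (p - 1) * norm (f n) powr 1"
        by (subst powr_add[symmetric]) simp
      also have "\<dots> \<le> s powr (p - 1) * norm (f n) powr 1"
        using fs p by (intro mult_right_mono powr_mono2) auto
      finally show ?thesis
        using False by simp
    qed simp
    then have "(\<Sum>n<m. norm (f n) powr p) \<le> s powr (p - 1) * (\<Sum>n<m. norm (f n))"
      unfolding sum_distrib_left by (rule sum_mono)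
    also have "\<dots> \<le> s powr (p - 1) * s"
      unfolding s_def by (intro mult_left_mono sum_le_suminf assms) auto
    also have "\<dots> = s powr p"
      using s by (cases "s = 0") (auto simp: powr_diff)
    finally show ?thesis .
  qed
  then show "f \<in> lp_space p" "lp_norm p f \<le> (\<Sum>n. norm (f n))"
    unfolding s_def[symmetric] using lp_boundI[of f s] s by auto
qed

lemma lp_dominated:
  assumes x: "x \<in> lp_space p" and bound: "\<And>n c. norm (f n c) \<le> K * norm (x c)"
    and lim: "\<And>c. (\<lambda>n. f n c) \<longlonglongrightarrow> 0"
  shows "(\<lambda>n. lp_norm p (f n)) \<longlonglongrightarrow> 0"
proof -
  have "(\<lambda>n. \<Sum>c. norm (f n c) powr p) \<longlonglongrightarrow> (\<Sum>c. 0)"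
  proof (rule tannerys_theorem[THEN conjunct2, THEN conjunct2])
    show "((\<lambda>n. norm (f n c) powr p) \<longlongrightarrow> 0) sequentially" for c
      using p tendsto_norm_zero[OF lim[of c]]
      by (intro tendsto_zero_powrI[of _ _ _ p]) (auto intro: always_eventually)
    have "norm (norm (f n c) powr p) \<le> \<bar>K\<bar> powr p * norm (x c) powr p" for n c
    proof -
      have "norm (f n c) \<le> \<bar>K\<bar> * norm (x c)"
        using bound[of n c] mult_right_mono[OF abs_ge_self[of K] norm_ge_zero[of "x c"]] by linarith
      then show ?thesis
        using p by (auto simp flip: powr_mult intro!: powr_mono2)
    qed
    then show "\<forall>\<^sub>F (c, n) in sequentially \<times>\<^sub>F sequentially. norm (norm (f n c) powr p) \<le> \<bar>K\<bar> powr p * norm (x c) powr p"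
      by (intro always_eventually) auto
    show "summable (\<lambda>c. \<bar>K\<bar> powr p * norm (x c) powr p)"
      using x by (intro summable_mult) (simp add: lp_space_def)
  qed simp
  then have "(\<lambda>n. (\<Sum>c. norm (f n c) powr p) powr (1 / p)) \<longlonglongrightarrow> 0"
  proof (intro tendsto_zero_powrI[of _ _ _ "1 / p"])
    show "\<forall>\<^sub>F n in sequentially. 0 \<le> (\<Sum>c. norm (f n c) powr p)"
    proof (intro always_eventually allI suminf_nonneg)
      fix n
      have "norm (f n c) \<le> \<bar>K\<bar> * norm (x c)" for c
        using bound[of n c] mult_right_mono[OF abs_ge_self[of K] norm_ge_zero[of "x c"]] by linarith
      then show "summable (\<lambda>c. norm (f n c) powr p)"
        using lp_mono(1)[OF x, of "f n" "\<bar>K\<bar>"] by (simp add: lp_space_def)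
    qed simp
  qed (use p in auto)
  then show ?thesis
    by (simp add: lp_norm_def)
qed

lemma unit_tensor_lp: "unit_tensor c u \<in> lp_space p" "lp_norm p (unit_tensor c u) = norm u"
proof -
  have *: "(\<Sum>n<m. norm (unit_tensor c u n) powr p) \<le> norm u powr p" for m
  proof -
    have "(\<Sum>n<m. norm (unit_tensor c u n) powr p) = (\<Sum>n<m. if n = c then norm u powr p else 0)"
      by (intro sum.cong) (auto simp: unit_tensor_def)
    then show ?thesis
      by simp
  qed
  show mem: "unit_tensor c u \<in> lp_space p"
    by (rule lp_boundI(1)[OF *]) simp
  have "lp_norm p (unit_tensor c u) \<le> norm u"
    by (rule lp_boundI(2)[OF *]) simp
  moreover have "norm u \<le> lp_norm p (unit_tensor c u)"
    using norm_le_lp_norm[OF mem, of c] by (simp add: unit_tensor_def)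
  ultimately show "lp_norm p (unit_tensor c u) = norm u"
    by simp
qed

lemma banach_on_lp: "banach_on (lp_space p :: (nat \<Rightarrow> 'b::banach) set) (lp_norm p)"
proof
  show "0 \<in> (lp_space p :: (nat \<Rightarrow> 'b) set)"
    using p by (simp add: lp_space_def zero_fun_def)
  fix x y :: "nat \<Rightarrow> 'b" and c
  assume x: "x \<in> lp_space p"
  show "c *\<^sub>R x \<in> lp_space p" "lp_norm p (c *\<^sub>R x) = \<bar>c\<bar> * lp_norm p x"
    using lp_scaleR[OF x, of c] by (simp_all add: scaleR_fun_def)
  show "0 \<le> lp_norm p x"
    by (rule lp_norm_nonneg)
  show "x = 0" if "lp_norm p x = 0"
    using norm_le_lp_norm[OF x] that by (simp add: fun_eq_iff zero_fun_def)
  assume y: "y \<in> lp_space p"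
  show "x + y \<in> lp_space p" "lp_norm p (x + y) \<le> lp_norm p x + lp_norm p y"
    using lp_triangle[OF x y] by (simp_all add: plus_fun_def)
next
  fix x :: "nat \<Rightarrow> nat \<Rightarrow> 'b" and C
  assume x: "\<And>k. x k \<in> lp_space p" and C: "\<And>k. lp_norm p (x k) \<le> C * (1/2) ^ k"
  have norm_x: "norm (x k n) \<le> C * (1/2) ^ k" for k n
    using norm_le_lp_norm[OF x, of k n] C[of k] by linarith
  have summable: "summable (\<lambda>k. x k n)" for n
    by (rule summable_comparison_test'[of "\<lambda>k. C * (1/2) ^ k"])
       (auto intro!: summable_mult summable_geometric norm_x)
  define y where "y n = (\<Sum>k. x k n)" for n
  have C_nonneg: "C \<ge> 0"
    using C[of 0] lp_norm_nonneg[of "x 0"] by simp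
  have tail: "(\<lambda>n. y n - (\<Sum>k<m. x k n)) \<in> lp_space p \<and> lp_norm p (\<lambda>n. y n - (\<Sum>k<m. x k n)) \<le> 2 * C * (1/2) ^ m" for m
  proof -
    have part: "(\<lambda>n. \<Sum>k=m..<m+l. x k n) \<in> lp_space p \<and> lp_norm p (\<lambda>n. \<Sum>k=m..<m+l. x k n) \<le> (\<Sum>k=m..<m+l. C * (1/2) ^ k)" for l
    proof (induction l)
      case 0
      then show ?case
        using p unit_tensor_lp[of 0 "0::'b"] by (simp add: unit_tensor_def cong: if_cong)
    next
      case (Suc l)
      then show ?case
        using lp_triangle[of "\<lambda>n. \<Sum>k=m..<m+l. x k n" "x (m + l)"] x C[of "m + l"] by (auto intro: order_trans)
    qed
    have le: "(\<Sum>k=m..<m+l. C * (1/2) ^ k) \<le> 2 * C * (1/2) ^ m" for l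
    proof -
      have "(\<Sum>k=m..<m+l. C * (1/2) ^ k) = (\<Sum>k<l. C * (1/2) ^ m * (1/2) ^ k)"
        by (rule sum.reindex_bij_witness[of _ "\<lambda>k. k + m" "\<lambda>k. k - m"]) (auto simp flip: power_add)
      also have "\<dots> = C * (1/2) ^ m * (\<Sum>k<l. (1/2) ^ k)"
        by (rule sum_distrib_left[symmetric])
      also have "\<dots> \<le> C * (1/2) ^ m * 2"
        using C_nonneg by (intro mult_left_mono sum_half_power_le) auto
      finally show ?thesis
        by simp
    qed
    have "(\<Sum>n<N. norm (y n - (\<Sum>k<m. x k n)) powr p) \<le> (2 * C * (1/2) ^ m) powr p" for N
    proof (rule LIMSEQ_le_const2)
      have "(\<lambda>l. \<Sum>k=m..<m+l. x k n) \<longlonglongrightarrow> y n - (\<Sum>k<m. x k n)" for n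
      proof -
        have "(\<lambda>l. (\<Sum>k<l + m. x k n) - (\<Sum>k<m. x k n)) \<longlonglongrightarrow> y n - (\<Sum>k<m. x k n)"
          unfolding y_def by (intro tendsto_intros LIMSEQ_ignore_initial_segment summable_LIMSEQ summable)
        moreover have "(\<Sum>k<l + m. x k n) - (\<Sum>k<m. x k n) = (\<Sum>k=m..<m+l. x k n)" for l
          using sum_diff_nat_ivl[of 0 m "m + l" "\<lambda>k. x k n"] by (simp add: lessThan_atLeast0 add.commute)
        ultimately show ?thesis
          by simp
      qed
      then show "(\<lambda>l. \<Sum>n<N. norm (\<Sum>k=m..<m+l. x k n) powr p) \<longlonglongrightarrow> (\<Sum>n<N. norm (y n - (\<Sum>k<m. x k n)) powr p)"
        using p by (intro tendsto_sum tendsto_powr' tendsto_norm tendsto_const) auto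
      have "(\<Sum>n<N. norm (\<Sum>k=m..<m+l. x k n) powr p) \<le> (2 * C * (1/2) ^ m) powr p" for l
      proof -
        have "(\<Sum>n<N. norm (\<Sum>k=m..<m+l. x k n) powr p) \<le> lp_norm p (\<lambda>n. \<Sum>k=m..<m+l. x k n) powr p"
          using part[of l] by (intro sum_powr_le_lp_norm) auto
        also have "\<dots> \<le> (2 * C * (1/2) ^ m) powr p"
          using part[of l] le[of l] p lp_norm_nonneg by (intro powr_mono2) auto
        finally show ?thesis .
      qed
      then show "\<exists>L. \<forall>l\<ge>L. (\<Sum>n<N. norm (\<Sum>k=m..<m+l. x k n) powr p) \<le> (2 * C * (1/2) ^ m) powr p"
        by blast
    qed
    then show ?thesis
      using lp_boundI[of "\<lambda>n. y n - (\<Sum>k<m. x k n)" "2 * C * (1/2) ^ m"] C_nonneg by auto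
  qed
  have "y \<in> lp_space p"
    using tail[of 0] by simp
  moreover have "(\<lambda>m. lp_norm p (y - (\<Sum>k<m. x k))) \<longlonglongrightarrow> 0"
  proof (rule Lim_null_comparison)
    have eq: "y - (\<Sum>k<m. x k) = (\<lambda>n. y n - (\<Sum>k<m. x k n))" for m
      by (simp add: fun_eq_iff sum_fun_eval)
    show "\<forall>\<^sub>F m in sequentially. norm (lp_norm p (y - (\<Sum>k<m. x k))) \<le> 2 * C * (1/2) ^ m"
    proof (intro always_eventually allI)
      fix m
      show "norm (lp_norm p (y - (\<Sum>k<m. x k))) \<le> 2 * C * (1/2) ^ m"
        using tail[of m] lp_norm_nonneg[of "\<lambda>n. y n - (\<Sum>k<m. x k n)"] by (simp add: eq)
    qed
    show "(\<lambda>m. 2 * C * (1/2) ^ m) \<longlonglongrightarrow> 0"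
      by (intro tendsto_mult_right_zero LIMSEQ_realpow_zero) auto
  qed
  ultimately show "\<exists>y\<in>lp_space p. (\<lambda>m. lp_norm p (y - (\<Sum>k<m. x k))) \<longlonglongrightarrow> 0"
    by blast
qed

end

section \<open>Factorization of the identity\<close>

context dyadic_tree
begin

lemma L1_identity_factors:
  assumes T: "bounded_linear T" and large: "large_diagonal T \<delta>" and "\<delta> > 0"
  shows "\<exists>R S. bounded_operator (UNIV :: 'a L1 set) norm R \<and> bounded_operator UNIV norm S
    \<and> (\<forall>u\<in>UNIV. u = S (T (R u)))"
proof -
  interpret banach_on "UNIV :: 'a L1 set" norm
    by (rule banach_on_UNIV)
  obtain R S :: "nat \<Rightarrow> 'a L1 \<Rightarrow> 'a L1" where RS: "\<And>c. bounded_linear (R c)" "\<And>c. bounded_linear (S c)"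
    "\<And>c d u. norm (S c (T (R d u)) - (if c = d then u else 0)) \<le> 1/2 * (1/2) ^ c * (1/2) ^ d * norm u"
    using simultaneous_factorization[of "\<lambda>c d. T" \<delta> "1/2", OF T large \<open>\<delta> > 0\<close>] by auto
  show ?thesis
  proof (rule identity_factors)
    show "bounded_operator UNIV norm T" "bounded_operator UNIV norm (R 0)" "bounded_operator UNIV norm (S 0)"
      using T RS by (simp_all add: bounded_operator_UNIV)
    show "norm (S 0 (T (R 0 u)) - u) \<le> norm u / 2" for u
      using RS(3)[of 0 0 u] by simp
  qed
qed

text \<open>Since \<open>p < \<infinity>\<close>, every \<open>y\<close> is the limit of its finite parts, so \<open>T y\<close> is determined by the matrix \<open>T'\<close> between the
  coordinates.  The \<open>p\<close>-norm of the error is estimated by the sum of the norms of its coordinates.\<close>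

lemma lp_identity_factors:
  fixes T :: "(nat \<Rightarrow> 'a L1) \<Rightarrow> (nat \<Rightarrow> 'a L1)"
  assumes p: "1 \<le> p" and T: "bounded_operator (lp_space p) (lp_norm p) T"
    and large: "\<And>c. large_diagonal (\<lambda>u. T (unit_tensor c u) c) \<delta>" and "\<delta> > 0"
  shows "\<exists>R S. bounded_operator (lp_space p) (lp_norm p) R \<and> bounded_operator (lp_space p) (lp_norm p) S
    \<and> (\<forall>x\<in>lp_space p. x = S (T (R x)))"
proof -
  interpret lp: banach_on "lp_space p :: (nat \<Rightarrow> 'a L1) set" "lp_norm p"
    by (rule banach_on_lp[OF p])
  have T_mem: "T x \<in> lp_space p" and T_add: "T (x + y) = T x + T y" and T_scaleR: "T (c *\<^sub>R x) = c *\<^sub>R T x"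
    if "x \<in> lp_space p" "y \<in> lp_space p" for x y c
    using T that by (auto simp: bounded_operator_def)
  obtain C where C: "\<And>x. x \<in> lp_space p \<Longrightarrow> lp_norm p (T x) \<le> C * lp_norm p x"
    using T unfolding bounded_operator_def by blast
  define T' where "T' c d u = T (unit_tensor d u) c" for c d u
  have T': "bounded_linear (T' c d)" for c d
  proof (rule bounded_linear_intro[where K = C])
    fix u v :: "'a L1" and r :: real
    have "unit_tensor d (u + v) = unit_tensor d u + unit_tensor d v"
      "unit_tensor d (r *\<^sub>R u) = r *\<^sub>R unit_tensor d u"
      by (auto simp: unit_tensor_def fun_eq_iff plus_fun_def scaleR_fun_def)
    then show "T' c d (u + v) = T' c d u + T' c d v" "T' c d (r *\<^sub>R u) = r *\<^sub>R T' c d u"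
      using T_add[OF unit_tensor_lp(1)[OF p, of d u] unit_tensor_lp(1)[OF p, of d v]]
        T_scaleR[OF unit_tensor_lp(1)[OF p, of d u] unit_tensor_lp(1)[OF p, of d u], of r] by (simp_all add: T'_def plus_fun_def scaleR_fun_def)
    have "norm (T' c d u) \<le> lp_norm p (T (unit_tensor d u))"
      unfolding T'_def using unit_tensor_lp(1)[OF p] by (intro norm_le_lp_norm[OF p] T_mem)
    also have "\<dots> \<le> C * norm u"
      using C[OF unit_tensor_lp(1)[OF p], of d u] unit_tensor_lp(2)[OF p, of d u] by simp
    finally show "norm (T' c d u) \<le> norm u * C"
      by (simp add: mult.commute)
  qed
  have "large_diagonal (T' c c) \<delta>" for c
    unfolding T'_def by (rule large)
  from simultaneous_factorization[of T' \<delta> "1/8", OF T' this \<open>\<delta> > 0\<close>]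
  obtain R S :: "nat \<Rightarrow> 'a L1 \<Rightarrow> 'a L1" where RS: "\<And>c. bounded_linear (R c)" "\<And>c. bounded_linear (S c)"
    "\<And>c u. norm (R c u) \<le> norm u" "\<And>c u. norm (S c u) \<le> norm u / \<delta>"
    "\<And>c d u. norm (S c (T' c d (R d u)) - (if c = d then u else 0)) \<le> 1/8 * (1/2) ^ c * (1/2) ^ d * norm u"
    by auto
  have diagonal: "bounded_operator (lp_space p) (lp_norm p) (\<lambda>x c. F c (x c))"
    if F: "\<And>c. bounded_linear (F c)" "\<And>c u. norm (F c u) \<le> K * norm u" "K \<ge> 0" for F :: "nat \<Rightarrow> 'a L1 \<Rightarrow> 'a L1" and K
  proof -
    interpret bounded_linear "F c" for c by (rule F)
    show ?thesis
      unfolding bounded_operator_def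
    proof (intro conjI ballI allI exI[of _ K])
      fix x y :: "nat \<Rightarrow> 'a L1" and r :: real
      assume x: "x \<in> lp_space p"
      show "(\<lambda>c. F c (x c)) \<in> lp_space p" "lp_norm p (\<lambda>c. F c (x c)) \<le> K * lp_norm p x"
        using lp_mono[OF p x, of "\<lambda>c. F c (x c)" K] F by auto
      show "(\<lambda>c. F c ((x + y) c)) = (\<lambda>c. F c (x c)) + (\<lambda>c. F c (y c))"
        by (simp add: add plus_fun_def)
      show "(\<lambda>c. F c ((r *\<^sub>R x) c)) = r *\<^sub>R (\<lambda>c. F c (x c))"
        by (simp add: scaleR scaleR_fun_def)
    qed
  qed
  have R: "bounded_operator (lp_space p) (lp_norm p) (\<lambda>x c. R c (x c))"
    by (rule diagonal[of R 1]) (auto simp: RS)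
  have S: "bounded_operator (lp_space p) (lp_norm p) (\<lambda>x c. S c (x c))"
    by (rule diagonal[of S "1 / \<delta>"]) (use \<open>\<delta> > 0\<close> in \<open>auto simp: RS\<close>)
  show ?thesis
  proof (rule lp.identity_factors[OF T R S])
    fix x :: "nat \<Rightarrow> 'a L1" assume x: "x \<in> lp_space p"
    define y where "y c = R c (x c)" for c
    have y: "y \<in> lp_space p"
      using R x unfolding bounded_operator_def y_def by blast
    define f where "f n = (\<Sum>d<n. unit_tensor d (y d))" for n
    have f_mem: "f n \<in> lp_space p" for n
      unfolding f_def by (intro lp.sum_mem unit_tensor_lp p)
    have f_eval: "f n c = (if c < n then y c else 0)" for n c
    proof -
      have "f n c = (\<Sum>d<n. if c = d then y c else 0)"
        unfolding f_def sum_fun_eval by (intro sum.cong) (auto simp: unit_tensor_def)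
      then show ?thesis
        by simp
    qed
    have f_lim: "(\<lambda>n. lp_norm p (y - f n)) \<longlonglongrightarrow> 0"
    proof (rule lp_dominated[OF p y])
      show "norm ((y - f n) c) \<le> 1 * norm (y c)" for n c
        by (simp add: f_eval)
      show "(\<lambda>n. (y - f n) c) \<longlonglongrightarrow> 0" for c
        by (rule tendsto_eventually) (auto simp: f_eval eventually_sequentially intro!: exI[of _ "Suc c"])
    qed
    have Tf: "T (f n) c = (\<Sum>d<n. T' c d (y d))" for n c
    proof (induction n)
      case 0
      have "T (0 *\<^sub>R y) = 0 *\<^sub>R T y"
        using T_scaleR[OF y y] .
      then show ?case
        by (simp add: f_def zero_fun_def)
    next
      case (Suc n)
      have "T (f n + unit_tensor n (y n)) = T (f n) + T (unit_tensor n (y n))"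
        by (intro T_add f_mem unit_tensor_lp p)
      then show ?case
        using Suc by (simp add: f_def plus_fun_def T'_def)
    qed
    have T_lim: "(\<lambda>n. T (f n) c) \<longlonglongrightarrow> T y c" for c
    proof -
      have le: "norm (T (f n) c - T y c) \<le> C * lp_norm p (y - f n)" for n
      proof -
        have mem: "y - f n \<in> lp_space p"
          by (intro lp.diff_mem y f_mem)
        have "T y = T (y - f n) + T (f n)"
          using T_add[OF mem f_mem, of n] by simp
        then have "norm (T (f n) c - T y c) = norm (T (y - f n) c)"
          by (simp add: plus_fun_def)
        also have "\<dots> \<le> lp_norm p (T (y - f n))"
          by (intro norm_le_lp_norm p T_mem[OF mem mem])
        finally show ?thesis
          using C[OF mem] by linarith
      qed
      have "(\<lambda>n. T (f n) c - T y c) \<longlonglongrightarrow> 0"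
      proof (rule Lim_null_comparison)
        show "\<forall>\<^sub>F n in sequentially. norm (T (f n) c - T y c) \<le> C * lp_norm p (y - f n)"
          by (rule always_eventually) (simp only: le simp_thms)
        show "(\<lambda>n. C * lp_norm p (y - f n)) \<longlonglongrightarrow> 0"
          by (intro tendsto_mult_right_zero f_lim)
      qed
      then show ?thesis
        by (rule LIM_zero_cancel)
    qed
    define z where "z c = S c (T y c) - x c" for c
    have z: "norm (z c) \<le> 1/4 * lp_norm p x * (1/2) ^ c" for c
    proof -
      interpret S: bounded_linear "S c" by (rule RS)
      have lim: "(\<lambda>n. norm (S c (T (f n) c) - x c)) \<longlonglongrightarrow> norm (z c)"
        unfolding z_def by (intro tendsto_intros S.tendsto T_lim)
      have "norm (S c (T (f n) c) - x c) \<le> 1/4 * lp_norm p x * (1/2) ^ c" if "n > c" for n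
      proof -
        have "x c = (\<Sum>d<n. if c = d then x d else 0)"
          using that by simp
        then have "S c (T (f n) c) - x c = (\<Sum>d<n. S c (T' c d (R d (x d))) - (if c = d then x d else 0))"
          by (simp only: Tf S.sum sum_subtractf y_def)
        also have "norm \<dots> \<le> (\<Sum>d<n. 1/8 * lp_norm p x * (1/2) ^ c * (1/2) ^ d)"
        proof (rule sum_norm_le)
          fix d
          have "norm (S c (T' c d (R d (x d))) - (if c = d then x d else 0)) \<le> 1/8 * (1/2) ^ c * (1/2) ^ d * norm (x d)"
            by (rule RS(5))
          also have "\<dots> \<le> 1/8 * (1/2) ^ c * (1/2) ^ d * lp_norm p x"
            by (intro mult_left_mono norm_le_lp_norm p x) auto
          finally show "norm (S c (T' c d (R d (x d))) - (if c = d then x d else 0)) \<le> 1/8 * lp_norm p x * (1/2) ^ c * (1/2) ^ d"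
            by (simp add: mult_ac)
        qed
        also have "\<dots> = 1/8 * lp_norm p x * (1/2) ^ c * (\<Sum>d<n. (1/2) ^ d)"
          by (rule sum_distrib_left[symmetric])
        also have "\<dots> \<le> 1/8 * lp_norm p x * (1/2) ^ c * 2"
          using lp_norm_nonneg[OF p, of x] by (intro mult_left_mono sum_half_power_le) auto
        finally show ?thesis
          by simp
      qed
      then have "\<forall>\<^sub>F n in sequentially. norm (S c (T (f n) c) - x c) \<le> 1/4 * lp_norm p x * (1/2) ^ c"
        unfolding eventually_sequentially by (intro exI[of _ "Suc c"]) auto
      from tendsto_upperbound[OF lim this] show ?thesis
        by simp
    qed
    have geo: "summable (\<lambda>c. 1/4 * lp_norm p x * (1/2) ^ c)"
      by (intro summable_mult summable_geometric) simp
    have sz: "summable (\<lambda>c. norm (z c))"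
      by (rule summable_comparison_test'[OF geo, of 0]) (use z in simp)
    have "lp_norm p z \<le> (\<Sum>c. norm (z c))"
      by (rule lp_norm_le_summable[OF p sz])
    also have "\<dots> \<le> (\<Sum>c. 1/4 * lp_norm p x * (1/2) ^ c)"
      by (intro suminf_le z sz geo)
    also have "\<dots> = lp_norm p x / 2"
      by (subst suminf_mult) (auto simp: suminf_geometric summable_geometric)
    finally have "lp_norm p z \<le> lp_norm p x / 2" .
    moreover have "(\<lambda>c. S c (T (\<lambda>c. R c (x c)) c)) - x = z"
      by (simp add: z_def y_def[abs_def] fun_eq_iff)
    ultimately show "lp_norm p ((\<lambda>c. S c (T (\<lambda>c. R c (x c)) c)) - x) \<le> lp_norm p x / 2"
      by simp
  qed
qed

end

section \<open>Density of step functions\<close>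

lemma to_L1_dominated:
  fixes f :: "'a::euclidean_space \<Rightarrow> real"
  assumes f: "integrable unit_cube f" "\<And>n. integrable unit_cube (s n)" and w: "integrable unit_cube w"
    and lim: "AE x in unit_cube. (\<lambda>n. s n x) \<longlonglongrightarrow> f x"
    and bound: "\<And>n. AE x in unit_cube. \<bar>s n x\<bar> \<le> w x"
  shows "(\<lambda>n. to_L1 (s n)) \<longlonglongrightarrow> to_L1 f"
proof -
  have "(\<lambda>n. \<integral>x. \<bar>s n x - f x\<bar> \<partial>unit_cube) \<longlonglongrightarrow> (\<integral>x. 0 \<partial>(unit_cube :: 'a measure))"
  proof (rule integral_dominated_convergence[where w = "\<lambda>x. w x + \<bar>f x\<bar>"])
    show "AE x in unit_cube. (\<lambda>n. \<bar>s n x - f x\<bar>) \<longlonglongrightarrow> 0"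
      using lim by eventually_elim (use LIM_zero tendsto_rabs_zero in blast)
    show "AE x in unit_cube. norm \<bar>s n x - f x\<bar> \<le> w x + \<bar>f x\<bar>" for n
      using bound[of n] by eventually_elim auto
    show "integrable unit_cube (\<lambda>x. w x + \<bar>f x\<bar>)"
      by (intro Bochner_Integration.integrable_add integrable_abs w f)
    show "(\<lambda>x. \<bar>s n x - f x\<bar>) \<in> borel_measurable unit_cube" for n
      by (intro borel_measurable_integrable integrable_abs Bochner_Integration.integrable_diff f)
  qed simp
  then have "(\<lambda>n. norm (to_L1 (s n) - to_L1 f)) \<longlonglongrightarrow> 0"
    using f by (simp add: norm_to_L1_diff)
  then show ?thesis
    by (rule LIM_zero_cancel[OF tendsto_norm_zero_cancel])
qed

text \<open>The sets whose indicators lie in \<open>V\<close> form a Dynkin system, and the boxes \<open>{..a}\<close> are stable under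
  intersection and generate the Borel sets.\<close>

lemma L1_dense:
  fixes V :: "'a::ordered_euclidean_space L1 set"
  assumes V: "closed V" "subspace V"
    and one: "to_L1 (\<lambda>_. 1) \<in> V" and box: "\<And>a. to_L1 (indicator {..a}) \<in> V"
  shows "u \<in> V"
proof -
  have int: "integrable unit_cube (indicator E :: 'a \<Rightarrow> real)" if "E \<in> sets borel" for E
    by (intro integrable_bounded_measurable bounded_measurable_indicator that)
  have const: "integrable unit_cube (\<lambda>x :: 'a. c :: real)" for c
    by (rule finite_measure.integrable_const[OF finite_measure_unit_cube])
  have ind: "to_L1 (indicator E) \<in> V" if "E \<in> sets (borel :: 'a measure)" for E
  proof -
    have gen: "sets (borel :: 'a measure) = sigma_sets UNIV (range (\<lambda>a. {..a}))"
      by (simp add: borel_eq_atMost)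
    have "{..a} \<inter> {..b} = {..inf a b}" for a b :: 'a
      by auto
    then have "Int_stable (range (\<lambda>a :: 'a. {..a}))"
      by (auto simp: Int_stable_def)
    moreover have "range (\<lambda>a :: 'a. {..a}) \<subseteq> Pow UNIV"
      by simp
    moreover have "E \<in> sigma_sets UNIV (range (\<lambda>a. {..a}))"
      using that gen by simp
    ultimately show ?thesis
    proof (induction rule: sigma_sets_induct_disjoint)
      case (basic E)
      then show ?case
        using box by auto
    next
      case empty
      have "indicator {} = (\<lambda>_ :: 'a. 0 :: real)"
        by auto
      then show ?case
        using to_L1_zero subspace_0[OF V(2)] by metis
    next
      case (compl E)
      then have E: "E \<in> sets borel"
        using gen by simp
      have "to_L1 (\<lambda>_. 1) - to_L1 (indicator E) = to_L1 (\<lambda>x. 1 - indicator E x)"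
        by (intro to_L1_diff const int E)
      also have "(\<lambda>x. 1 - indicator E x :: real) = indicator (UNIV - E)"
        by (auto simp: indicator_def)
      finally show ?case
        using subspace_diff[OF V(2) one compl.IH] by simp
    next
      case (union E)
      then have E: "E i \<in> sets borel" for i
        using gen by auto
      have fin: "(\<Sum>i<n. to_L1 (indicator (E i))) = to_L1 (\<lambda>x. indicator (\<Union>i<n. E i) x)" for n
      proof -
        have "(\<lambda>x. \<Sum>i<n. indicator (E i) x) = (\<lambda>x. indicator (\<Union>i<n. E i) x :: real)"
          using union.hyps(1) by (intro ext indicator_UN_disjoint[symmetric])
            (auto simp: disjoint_family_on_def)
        then show ?thesis
          by (subst to_L1_sum) (auto intro: int E)
      qed
      have mem: "to_L1 (\<lambda>x. indicator (\<Union>i<n. E i) x) \<in> V" for n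
        unfolding fin[symmetric] by (intro subspace_sum V union.IH)
      have "(\<lambda>n. to_L1 (\<lambda>x. indicator (\<Union>i<n. E i) x)) \<longlonglongrightarrow> to_L1 (indicator (\<Union>i. E i))"
      proof (rule to_L1_dominated[where w = "\<lambda>_. 1"])
        show "AE x in unit_cube. (\<lambda>n. indicator (\<Union>i<n. E i) x :: real) \<longlonglongrightarrow> indicator (\<Union>i. E i) x"
          by (intro AE_I2 LIMSEQ_indicator_UN)
        show "AE x in unit_cube. \<bar>indicator (\<Union>i<n. E i) x :: real\<bar> \<le> 1" for n
          by (simp add: indicator_def)
        show "integrable unit_cube (\<lambda>x. indicator (\<Union>i<n. E i) x :: real)" for n
          using E by (intro int sets.finite_UN) auto
        show "integrable unit_cube (indicator (\<Union>i. E i) :: 'a \<Rightarrow> real)"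
          using E by (intro int sets.countable_UN) auto
      qed (rule const)
      then show ?case
        by (rule closed_sequentially[OF V(1) mem])
    qed
  qed
  have "to_L1 f \<in> V" if "integrable unit_cube f" for f :: "'a \<Rightarrow> real"
    using that
  proof (induction rule: integrable_induct)
    case (base E c)
    have E: "E \<in> sets borel"
    proof -
      have "cbox 0 One \<inter> space (lborel :: 'a measure) \<in> sets lborel"
        by simp
      then show ?thesis
        using base(1) by (simp add: unit_cube_def sets_restrict_space_iff)
    qed
    have "to_L1 (\<lambda>x. indicator E x *\<^sub>R c) = c *\<^sub>R to_L1 (indicator E)"
      by (subst to_L1_scaleR) (auto intro: int E simp: mult.commute)
    then show ?case
      using subspace_scale[OF V(2) ind[OF E]] by simp
  next
    case (add f g)
    have "to_L1 f + to_L1 g \<in> V"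
      using add by (intro subspace_add[OF V(2)])
    then show ?case
      using add to_L1_add[of f g] by simp
  next
    case (lim f s)
    have mem: "to_L1 (s i) \<in> V" for i
      using lim by blast
    have "(\<lambda>i. to_L1 (s i)) \<longlonglongrightarrow> to_L1 f"
      using lim by (intro to_L1_dominated[where w = "\<lambda>x. 2 * \<bar>f x\<bar>"]) auto
    then show ?case
      by (rule closed_sequentially[OF V(1) mem])
  qed
  from this[OF rep_L1_integrable, of u] show ?thesis
    by (simp add: to_L1_rep_L1)
qed

lemma integral_one_unit_cube: "(\<integral>x. 1 \<partial>(unit_cube :: 'a::euclidean_space measure)) = (1::real)"
proof -
  have "(\<integral>x. 1 \<partial>(unit_cube :: 'a measure)) = measure (unit_cube :: 'a measure) (space unit_cube)"
    by simp
  also have "\<dots> = 1"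
    using content_unit[where 'a = 'a]
    by (simp add: unit_cube_def space_restrict_space measure_restrict_space)
  finally show ?thesis .
qed

lemma (in dyadic_sets) AE_root: "AE x in unit_cube. x \<in> C 1"
proof -
  have int: "integrable unit_cube (\<lambda>x. 1 - indicator (C 1) x :: real)"
    by (intro Bochner_Integration.integrable_diff integrable_bounded_measurable bounded_measurable_ind
        bounded_measurable_const) auto
  have "(\<integral>x. 1 - indicator (C 1) x \<partial>unit_cube) = (\<integral>x. 1 \<partial>(unit_cube :: 'a measure)) - (\<integral>x. indicator (C 1) x \<partial>unit_cube :: real)"
    by (intro Bochner_Integration.integral_diff integrable_bounded_measurable bounded_measurable_ind
        bounded_measurable_const) auto
  also have "\<dots> = 0"
    using measure[of 1] by (simp only: integral_one_unit_cube mass_1)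
  finally have "AE x in unit_cube. 1 - indicator (C 1) x = (0::real)"
    using integral_nonneg_eq_0_iff_AE[OF int] by (simp add: indicator_def)
  then show ?thesis
    by eventually_elim (simp add: indicator_def split: if_splits)
qed

lemma to_L1_cong_AE:
  assumes "integrable unit_cube f" "integrable unit_cube g" "AE x in unit_cube. f x = g x"
  shows "to_L1 f = to_L1 g"
  using to_L1_eq_iff assms by blast

section \<open>Dyadic intervals\<close>

definition left_end :: "nat \<Rightarrow> real" where
  "left_end i = real i * mass i - 1"

text \<open>For \<open>i = 2 ^ n + j\<close> with \<open>j < 2 ^ n\<close> this is the interval from \<open>j / 2 ^ n\<close> to \<open>(j + 1) / 2 ^ n\<close>.\<close>

definition node :: "nat \<Rightarrow> real set" where
  "node i = {left_end i ..< left_end i + mass i}"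

lemma left_end_twice: "i \<ge> 1 \<Longrightarrow> left_end (2 * i) = left_end i"
  and left_end_twice_Suc: "i \<ge> 1 \<Longrightarrow> left_end (Suc (2 * i)) = left_end i + mass i / 2"
  by (simp_all add: left_end_def) (simp add: field_simps)

lemma node_subset: "i \<ge> 1 \<Longrightarrow> node i \<subseteq> {0..<1}"
proof -
  assume "i \<ge> 1"
  have "2 ^ floor_log i \<le> i" "i + 1 \<le> 2 * 2 ^ floor_log i"
    using floor_log_exp2_le[of i] floor_log_exp2_gt[of i] \<open>i \<ge> 1\<close> by auto
  then have "real (2 ^ floor_log i) \<le> real i" "real (i + 1) \<le> real (2 * 2 ^ floor_log i)"
    unfolding of_nat_le_iff by auto
  then have "(2::real) ^ floor_log i \<le> real i" "real i + 1 \<le> 2 * 2 ^ floor_log i"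
    by simp_all
  then have "0 \<le> left_end i" "left_end i + mass i \<le> 1"
    by (simp_all add: left_end_def mass_def field_simps)
  then show ?thesis
    by (auto simp: node_def)
qed

lemma integral_unit_interval:
  "(\<integral>x. f x \<partial>(unit_cube :: real measure)) = (\<integral>x. indicator {0..1} x * f x \<partial>lborel :: real)"
  unfolding unit_cube_def by (subst integral_restrict_space) (simp_all add: cbox_interval)

interpretation interval: dyadic_sets node
proof
  fix i :: nat assume i: "i \<ge> 1"
  show "node i \<in> sets borel"
    by (simp add: node_def)
  show "node i = node (2 * i) \<union> node (Suc (2 * i))" "node (2 * i) \<inter> node (Suc (2 * i)) = {}"
    using i mass_pos[of i] unfolding node_def left_end_twice[OF i] left_end_twice_Suc[OF i] mass_twice[OF i] mass_twice_Suc[OF i]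
    by auto
  have eq: "indicator {0..1} x * indicator (node i) x = (indicator (node i) x :: real)" for x
    using node_subset[OF i] by (auto simp: indicator_def)
  have "(\<integral>x. indicator (node i) x \<partial>unit_cube) = (\<integral>x. indicator (node i) x \<partial>lborel :: real)"
    unfolding integral_unit_interval eq ..
  also have "\<dots> = mass i"
    by (simp add: node_def)
  finally show "(\<integral>x. indicator (node i) x \<partial>unit_cube) = mass i" .
qed

lemma node_1: "node 1 = {0..<1}"
  by (simp add: node_def left_end_def)

text \<open>The indicator of the union of the intervals of generation \<open>n\<close> that begin at or before \<open>a\<close>.\<close>

definition lower_approx :: "real \<Rightarrow> nat \<Rightarrow> real \<Rightarrow> real" where
  "lower_approx a n x = (\<Sum>i | i \<in> lev n \<and> left_end i \<le> a. indicator (node i) x)"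

lemma lower_approx_bounds: "0 \<le> lower_approx a n x" "lower_approx a n x \<le> 1"
proof -
  show "0 \<le> lower_approx a n x"
    unfolding lower_approx_def by (intro sum_nonneg) auto
  have "lower_approx a n x \<le> (\<Sum>i\<in>lev n. indicator (node i) x)"
    unfolding lower_approx_def by (intro sum_mono2) auto
  also have "\<dots> = indicator (node 1) x"
    unfolding lev_def by (rule interval.sum_indicator_leaves) simp
  also have "\<dots> \<le> 1"
    by (simp add: indicator_def)
  finally show "lower_approx a n x \<le> 1" .
qed

lemma lower_approx_tendsto:
  assumes "x \<in> node 1"
  shows "(\<lambda>n. lower_approx a n x) \<longlonglongrightarrow> indicator {..a} x"
proof (cases "x \<le> a")
  case True
  have "lower_approx a n x = 1" for n
  proof -
    have "lower_approx a n x = (\<Sum>i\<in>lev n. indicator (node i) x)"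
      unfolding lower_approx_def using True
      by (intro sum.mono_neutral_left) (auto simp: node_def indicator_def)
    also have "\<dots> = indicator (node 1) x"
      unfolding lev_def by (rule interval.sum_indicator_leaves) simp
    finally show ?thesis
      using assms by simp
  qed
  then show ?thesis
    using True by simp
next
  case False
  then have "x - a > 0"
    by simp
  then obtain N where N: "(1/2) ^ N < x - a"
    using real_arch_pow_inv[of "x - a" "1/2"] by auto
  have "lower_approx a n x = 0" if "n \<ge> N" for n
    unfolding lower_approx_def
  proof (intro sum.neutral ballI)
    fix i assume i: "i \<in> {i. i \<in> lev n \<and> left_end i \<le> a}"
    then have "floor_log i = n"
      using floor_log_eqI[of i n] lev_ge_1[of i n] by (auto simp: lev_def)
    then have "mass i = (1/2) ^ n"
      by (simp add: mass_def power_one_over)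
    also have "\<dots> \<le> (1/2) ^ N"
      using that by (intro power_decreasing) auto
    finally show "indicator (node i) x = (0::real)"
      using i N by (auto simp: node_def indicator_def)
  qed
  then have "(\<lambda>n. lower_approx a n x) \<longlonglongrightarrow> 0"
    by (intro tendsto_eventually) (auto simp: eventually_sequentially)
  then show ?thesis
    using False by simp
qed

lemma lower_approx_bounded_measurable: "bounded_measurable (lower_approx a n)"
  unfolding lower_approx_def
  by (intro bounded_measurable_sum interval.bounded_measurable_ind) (auto dest: lev_ge_1)

interpretation interval: dyadic_tree node
proof
  fix V :: "real L1 set" and u
  assume V: "closed V" "subspace V" and chi: "\<And>i. i \<ge> 1 \<Longrightarrow> to_L1 (indicator (node i)) \<in> V"
  have int: "integrable unit_cube (lower_approx a n)" for a n
    by (rule integrable_bounded_measurable[OF lower_approx_bounded_measurable])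
  show "u \<in> V"
  proof (rule L1_dense[OF V])
    have "to_L1 (\<lambda>_. 1) = to_L1 (indicator (node 1) :: real \<Rightarrow> real)"
    proof (rule to_L1_cong_AE)
      show "AE x in unit_cube. 1 = (indicator (node 1) x :: real)"
        using interval.AE_root by eventually_elim simp
    qed (auto intro!: integrable_bounded_measurable interval.bounded_measurable_ind)
    then show "to_L1 (\<lambda>_. 1) \<in> V"
      using chi[of 1] by simp
    fix a :: real
    have mem: "to_L1 (lower_approx a n) \<in> V" for n
    proof -
      have "to_L1 (lower_approx a n) = (\<Sum>i | i \<in> lev n \<and> left_end i \<le> a. to_L1 (indicator (node i)))"
        unfolding lower_approx_def
        by (intro to_L1_sum[symmetric] integrable_bounded_measurable interval.bounded_measurable_ind)
           (auto dest: lev_ge_1)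
      then show ?thesis
        by (simp only:) (intro subspace_sum[OF V(2)] chi, auto dest: lev_ge_1)
    qed
    have "(\<lambda>n. to_L1 (lower_approx a n)) \<longlonglongrightarrow> to_L1 (indicator {..a})"
    proof (rule to_L1_dominated[where w = "\<lambda>_. 1"])
      show "AE x in unit_cube. (\<lambda>n. lower_approx a n x) \<longlonglongrightarrow> indicator {..a} x"
        using interval.AE_root by eventually_elim (rule lower_approx_tendsto)
      show "AE x in unit_cube. \<bar>lower_approx a n x\<bar> \<le> 1" for n
        using lower_approx_bounds[of a n] by (intro AE_I2) simp
    qed (auto intro!: int integrable_bounded_measurable bounded_measurable_indicator)
    then show "to_L1 (indicator {..a}) \<in> V"
      by (rule closed_sequentially[OF V(1) mem])
  qed
qed

section \<open>Dyadic squares\<close>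

definition tensor :: "(real \<Rightarrow> real) \<Rightarrow> (real \<Rightarrow> real) \<Rightarrow> real \<times> real \<Rightarrow> real" where
  "tensor f g = (\<lambda>(s, t). f s * g t)"

lemma unit_square: "cbox 0 (One :: real \<times> real) = {0..1} \<times> {0..1}"
proof -
  have "(One :: real \<times> real) = (1, 1)"
    by (simp add: Basis_prod_def)
  then have "cbox 0 (One :: real \<times> real) = cbox (0, 0) (1, 1)"
    by (simp only: zero_prod_def)
  also have "\<dots> = cbox 0 1 \<times> cbox 0 1"
    by (rule cbox_Pair_eq)
  finally show ?thesis
    by (simp only: box_real)
qed

lemma bounded_measurable_tensor:
  assumes "f \<in> borel_measurable borel" "g \<in> borel_measurable borel" "\<And>s. \<bar>f s\<bar> \<le> 1" "\<And>t. \<bar>g t\<bar> \<le> 1"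
  shows "bounded_measurable (tensor f g)"
proof (rule bounded_measurableI[where B = 1])
  have "tensor f g \<in> borel_measurable borel"
    unfolding tensor_def borel_prod[symmetric] using assms(1,2) by measurable
  then show "tensor f g \<in> borel_measurable unit_cube"
    unfolding unit_cube_def by (intro measurable_restrict_space1) simp
  show "\<bar>tensor f g x\<bar> \<le> 1" for x
    using assms(3)[of "fst x"] assms(4)[of "snd x"] mult_mono[of "\<bar>f (fst x)\<bar>" 1 "\<bar>g (snd x)\<bar>" 1]
    by (simp add: tensor_def split_beta abs_mult)
qed

lemma integral_tensor:
  assumes f: "f \<in> borel_measurable borel" "\<And>s. \<bar>f s\<bar> \<le> 1" and g: "g \<in> borel_measurable borel" "\<And>t. \<bar>g t\<bar> \<le> 1"
  shows "(\<integral>x. tensor f g x \<partial>unit_cube) = (\<integral>s. f s \<partial>unit_cube) * (\<integral>t. g t \<partial>unit_cube)"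
proof -
  define F where "F s = indicator {0..1} s * f s" for s :: real
  define G where "G t = indicator {0..1} t * g t" for t :: real
  have eq: "indicator (cbox 0 One) x *\<^sub>R tensor f g x = (case x of (s, t) \<Rightarrow> F s * G t)" for x
    by (auto simp: unit_square tensor_def F_def G_def indicator_def split: prod.splits)
  have sets: "cbox 0 One \<inter> space lborel \<in> sets (lborel :: (real \<times> real) measure)"
    by simp
  have "integrable unit_cube (tensor f g)"
    by (intro integrable_bounded_measurable bounded_measurable_tensor assms)
  then have int: "integrable (lborel \<Otimes>\<^sub>M lborel) (\<lambda>x. case x of (s, t) \<Rightarrow> F s * G t)"
    unfolding unit_cube_def lborel_prod integrable_restrict_space[OF sets] eq .
  have "(\<integral>x. tensor f g x \<partial>unit_cube) = (\<integral>x. (case x of (s, t) \<Rightarrow> F s * G t) \<partial>(lborel \<Otimes>\<^sub>M lborel))"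
    unfolding unit_cube_def lborel_prod integral_restrict_space[OF sets] eq ..
  also have "\<dots> = (\<integral>s. (\<integral>t. F s * G t \<partial>lborel) \<partial>lborel)"
    using lborel_pair.integral_fst'[OF int] by simp
  also have "\<dots> = (\<integral>s. F s \<partial>lborel) * (\<integral>t. G t \<partial>lborel)"
    by simp
  finally show ?thesis
    by (simp add: integral_unit_interval F_def G_def)
qed

text \<open>The sides of the rectangle at node \<open>i\<close> of the tree that halves the first side if the sides are equal and the
  second side otherwise.  At even generations the rectangles are squares.\<close>

fun heap_pair :: "nat \<Rightarrow> nat \<times> nat" where
  "heap_pair i = (if i \<le> 1 then (1, 1) else
     let (a, b) = heap_pair (i div 2) in
     if floor_log a = floor_log b then (2 * a + i mod 2, b) else (a, 2 * b + i mod 2))"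

declare heap_pair.simps [simp del]

lemma heap_pair_1: "heap_pair 1 = (1, 1)" "heap_pair (Suc 0) = (1, 1)"
  by (simp_all add: heap_pair.simps)

lemma heap_pair_child:
  assumes "i \<ge> 1" "heap_pair i = (a, b)"
  shows "heap_pair (2 * i) = (if floor_log a = floor_log b then (2 * a, b) else (a, 2 * b))"
    and "heap_pair (Suc (2 * i)) = (if floor_log a = floor_log b then (Suc (2 * a), b) else (a, Suc (2 * b)))"
  using assms by (subst heap_pair.simps; simp)+

lemma heap_pair_inv:
  assumes "i \<ge> 1"
  shows "fst (heap_pair i) \<ge> 1 \<and> snd (heap_pair i) \<ge> 1
    \<and> floor_log (fst (heap_pair i)) + floor_log (snd (heap_pair i)) = floor_log i
    \<and> (floor_log (fst (heap_pair i)) = floor_log (snd (heap_pair i))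
       \<or> floor_log (fst (heap_pair i)) = Suc (floor_log (snd (heap_pair i))))"
  using assms
proof (induction i rule: less_induct)
  case (less i)
  show ?case
  proof (cases "i = 1")
    case False
    define j where "j = i div 2"
    have j: "j \<ge> 1" "j < i" "i = 2 * j \<or> i = Suc (2 * j)"
      using False less.prems by (auto simp: j_def)
    obtain a b where ab: "heap_pair j = (a, b)"
      by (cases "heap_pair j")
    have IH: "a \<ge> 1" "b \<ge> 1" "floor_log a + floor_log b = floor_log j"
      "floor_log a = floor_log b \<or> floor_log a = Suc (floor_log b)"
      using less.IH[OF j(2,1)] by (auto simp: ab)
    have "floor_log i = Suc (floor_log j)"
      using j by auto
    then show ?thesis
      using j(3) IH heap_pair_child[OF j(1) ab] by (auto split: if_splits)
  qed (simp add: heap_pair_1)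
qed

text \<open>Every square occurs: halving both sides of the square of the parents takes two generations.\<close>

lemma heap_pair_surj:
  assumes "a \<ge> 1" "b \<ge> 1" "floor_log a = floor_log b"
  shows "\<exists>i\<ge>1. heap_pair i = (a, b)"
  using assms
proof (induction a arbitrary: b rule: less_induct)
  case (less a)
  show ?case
  proof (cases "a = 1")
    case True
    then have "floor_log b = 0"
      using less.prems by simp
    then have "b = 1"
      using less.prems floor_log_exp2_gt[of b] by auto
    then show ?thesis
      using True heap_pair_1 by blast
  next
    case False
    define a' b' where "a' = a div 2" and "b' = b div 2"
    have a2: "a \<ge> 2"
      using False less.prems by auto
    have b2: "b \<ge> 2"
    proof (rule ccontr)
      assume "\<not> b \<ge> 2"
      then have "b = 1"
        using less.prems by simp
      then have "floor_log a = 0"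
        using less.prems by simp
      then show False
        using floor_log_rec[OF a2] by linarith
    qed
    have "floor_log a' = floor_log b'" "a' < a" "a' \<ge> 1" "b' \<ge> 1"
      using less.prems a2 b2 by (auto simp: a'_def b'_def)
    then obtain i where i: "i \<ge> 1" "heap_pair i = (a', b')"
      using less.IH[of a' b'] by blast
    have a: "a = 2 * a' \<or> a = Suc (2 * a')" and b: "b = 2 * b' \<or> b = Suc (2 * b')"
      by (auto simp: a'_def b'_def)
    obtain j where j: "j \<ge> 1" "heap_pair j = (a, b')"
      using a heap_pair_child[OF i] i \<open>floor_log a' = floor_log b'\<close> by (elim disjE) (auto intro: that[of "2 * i"] that[of "Suc (2 * i)"])
    have "floor_log a \<noteq> floor_log b'"
      using less.prems(3) floor_log_rec[OF b2, folded b'_def] by linarith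
    then show ?thesis
      using b heap_pair_child[OF j] j by (elim disjE) (auto intro: exI[of _ "2 * j"] exI[of _ "Suc (2 * j)"])
  qed
qed

definition square :: "nat \<Rightarrow> (real \<times> real) set" where
  "square i = node (fst (heap_pair i)) \<times> node (snd (heap_pair i))"

lemma indicator_rectangle: "indicator (A \<times> B) = tensor (indicator A) (indicator B)"
  by (auto simp: tensor_def indicator_def fun_eq_iff)

lemma node_borel: "node i \<in> sets borel"
  by (simp add: node_def)

lemma integral_rectangle:
  "i \<ge> 1 \<Longrightarrow> j \<ge> 1 \<Longrightarrow> (\<integral>x. indicator (node i \<times> node j) x \<partial>unit_cube) = mass i * mass j"
  unfolding indicator_rectangle
  by (subst integral_tensor)
     (auto simp: interval.measure_space intro!: borel_measurable_indicator node_borel)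

interpretation square: dyadic_sets square
proof
  fix i :: nat assume i: "i \<ge> 1"
  obtain a b where ab: "heap_pair i = (a, b)"
    by (cases "heap_pair i")
  have inv: "a \<ge> 1" "b \<ge> 1" "floor_log a + floor_log b = floor_log i"
    using heap_pair_inv[OF i] by (auto simp: ab)
  show "square i \<in> sets borel"
    unfolding square_def by (intro borel_Times node_borel)
  show "square i = square (2 * i) \<union> square (Suc (2 * i))" "square (2 * i) \<inter> square (Suc (2 * i)) = {}"
    unfolding square_def heap_pair_child[OF i ab] ab
    using interval.split[OF inv(1)] interval.split[OF inv(2)] interval.disjoint[OF inv(1)] interval.disjoint[OF inv(2)]
    by auto
  have "(\<integral>x. indicator (square i) x \<partial>unit_cube) = mass a * mass b"
    unfolding square_def ab fst_conv snd_conv by (rule integral_rectangle[OF inv(1,2)])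
  also have "\<dots> = mass i"
    unfolding mass_def inv(3)[symmetric] by (simp add: power_add)
  finally show "(\<integral>x. indicator (square i) x \<partial>unit_cube) = mass i" .
qed

lemma lower_approx_borel: "lower_approx a n \<in> borel_measurable borel"
  unfolding lower_approx_def by (intro borel_measurable_sum borel_measurable_indicator node_borel)

interpretation square: dyadic_tree square
proof
  fix V :: "(real \<times> real) L1 set" and u
  assume V: "closed V" "subspace V" and chi: "\<And>i. i \<ge> 1 \<Longrightarrow> to_L1 (indicator (square i)) \<in> V"
  have rect: "to_L1 (tensor (indicator (node i)) (indicator (node j))) \<in> V" if ij: "i \<in> lev n" "j \<in> lev n" for i j n
  proof -
    have "floor_log i = n" "floor_log j = n"
      using ij floor_log_eqI lev_ge_1 by (auto simp: lev_def)
    then obtain k where "k \<ge> 1" "heap_pair k = (i, j)"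
      using heap_pair_surj[OF lev_ge_1[OF ij(1)] lev_ge_1[OF ij(2)]] by auto
    then show ?thesis
      using chi[of k] by (simp add: square_def indicator_rectangle)
  qed
  have bm_rect: "bounded_measurable (tensor (indicator (node i)) (indicator (node j)))" for i j
    by (intro bounded_measurable_tensor borel_measurable_indicator node_borel) (auto simp: indicator_def)
  have bm: "bounded_measurable (tensor (lower_approx a n) (lower_approx b n))" for a b n
    using lower_approx_bounds by (intro bounded_measurable_tensor lower_approx_borel) auto
  have AE1: "AE x in unit_cube. x \<in> node 1 \<times> node 1"
    using square.AE_root by (simp add: square_def heap_pair_1)
  show "u \<in> V"
  proof (rule L1_dense[OF V])
    have "to_L1 (\<lambda>_. 1) = to_L1 (indicator (square 1) :: real \<times> real \<Rightarrow> real)"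
    proof (rule to_L1_cong_AE)
      show "AE x in unit_cube. 1 = (indicator (square 1) x :: real)"
        using square.AE_root by eventually_elim simp
    qed (auto intro!: integrable_bounded_measurable square.bounded_measurable_ind)
    then show "to_L1 (\<lambda>_. 1) \<in> V"
      using chi[of 1] by simp
    fix c :: "real \<times> real"
    obtain a b where c: "c = (a, b)"
      by (cases c)
    have mem: "to_L1 (tensor (lower_approx a n) (lower_approx b n)) \<in> V" for n
    proof -
      define I J where "I = {i. i \<in> lev n \<and> left_end i \<le> a}" and "J = {i. i \<in> lev n \<and> left_end i \<le> b}"
      have "tensor (lower_approx a n) (lower_approx b n)
          = (\<lambda>x. \<Sum>i\<in>I. \<Sum>j\<in>J. tensor (indicator (node i)) (indicator (node j)) x)"
        by (auto simp: tensor_def lower_approx_def I_def J_def sum_product fun_eq_iff)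
      then have "to_L1 (tensor (lower_approx a n) (lower_approx b n))
          = to_L1 (\<lambda>x. \<Sum>i\<in>I. \<Sum>j\<in>J. tensor (indicator (node i)) (indicator (node j)) x)"
        by simp
      also have "\<dots> = (\<Sum>i\<in>I. to_L1 (\<lambda>x. \<Sum>j\<in>J. tensor (indicator (node i)) (indicator (node j)) x))"
        by (intro to_L1_sum[symmetric] integrable_bounded_measurable bounded_measurable_sum bm_rect)
      also have "\<dots> = (\<Sum>i\<in>I. \<Sum>j\<in>J. to_L1 (tensor (indicator (node i)) (indicator (node j))))"
        by (intro sum.cong refl to_L1_sum[symmetric] integrable_bounded_measurable bm_rect)
      also have "\<dots> \<in> V"
        by (intro subspace_sum[OF V(2)] rect[of _ n]) (auto simp: I_def J_def)
      finally show ?thesis .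
    qed
    have ind: "indicator {..c} = tensor (indicator {..a}) (indicator {..b})"
      by (auto simp: tensor_def c indicator_def fun_eq_iff)
    have "(\<lambda>n. to_L1 (tensor (lower_approx a n) (lower_approx b n))) \<longlonglongrightarrow> to_L1 (indicator {..c})"
    proof (rule to_L1_dominated[where w = "\<lambda>_. 1"])
      show "AE x in unit_cube. (\<lambda>n. tensor (lower_approx a n) (lower_approx b n) x) \<longlonglongrightarrow> indicator {..c} x"
        using AE1
      proof eventually_elim
        case (elim x)
        then show ?case
          unfolding ind tensor_def by (auto intro!: tendsto_mult lower_approx_tendsto)
      qed
      show "AE x in unit_cube. \<bar>tensor (lower_approx a n) (lower_approx b n) x\<bar> \<le> 1" for n
        using lower_approx_bounds[of a n] lower_approx_bounds[of b n]
        by (intro AE_I2) (auto simp: tensor_def abs_mult intro!: mult_le_one split: prod.splits)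
    qed (auto intro!: bm integrable_bounded_measurable bounded_measurable_indicator)
    then show "to_L1 (indicator {..c}) \<in> V"
      by (rule closed_sequentially[OF V(1) mem])
  qed
qed

section \<open>The Haar bases\<close>

lemma (in dyadic_tree) inj_on_nodes: "inj_on A {1..}"
proof (rule inj_onI)
  fix i j assume ij: "i \<in> {1..}" "j \<in> {1..}" "A i = A j"
  show "i = j"
  proof (rule ccontr)
    assume "i \<noteq> j"
    have "mass i = mass j"
      using measure[of i] measure[of j] ij by simp
    then have "(2::real) ^ floor_log i = 2 ^ floor_log j"
      by (simp add: mass_def)
    then have "floor_log i = floor_log j"
      by simp
    then have "i \<in> lev (floor_log i)" "j \<in> lev (floor_log i)"
      using floor_log_exp2_le[of i] floor_log_exp2_gt[of i] floor_log_exp2_le[of j] floor_log_exp2_gt[of j] ij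
      by (auto simp: lev_def)
    then show False
      using lev_disjoint[OF _ _ \<open>i \<noteq> j\<close>] nonempty[of i] ij by auto
  qed
qed

lemma (in dyadic_tree) large_diagonal_haar:
  assumes "\<And>i. i \<ge> 1 \<Longrightarrow> \<delta> * mass i \<le> \<bar>pairing (h i) (T (e i))\<bar>"
  shows "large_diagonal T \<delta>"
  unfolding large_diagonal_def
proof (intro allI exI conjI ballI)
  fix N K assume K: "K \<in> lev N"
  show "adapted (2 ^ Suc N) (h K)"
    using K by (intro adapted_mono[OF adapted_h]) (auto simp: lev_def)
  show "\<bar>h K x\<bar> = indicator (A K) x" for x
    by (intro abs_h lev_ge_1[OF K])
  show "\<delta> * mass K \<le> \<bar>pairing (h K) (T (to_L1 (h K)))\<bar>"
    by (intro assms lev_ge_1[OF K])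
qed auto

definition interval_of :: "nat \<Rightarrow> real set" where
  "interval_of i = (if i = 0 then {} else node i)"

lemma haar_interval_of: "haar (interval_of i) = interval.h i"
proof (cases "i = 0")
  case True
  then show ?thesis
    by (simp add: haar_def interval_of_def interval.h_0 node_1 del: One_nat_def)
next
  case False
  then have i: "i \<ge> 1"
    by simp
  have lt: "left_end i < left_end i + mass i"
    using mass_pos[of i] by linarith
  have eq: "(left_end i + (left_end i + mass i)) / 2 = left_end i + mass i / 2"
    "left_end i + mass i / 2 + mass i / 2 = left_end i + mass i"
    by (simp_all add: field_simps)
  have "left_half (node i) = node (2 * i)" "right_half (node i) = node (Suc (2 * i))"
    unfolding left_half_def right_half_def node_def left_end_twice[OF i] left_end_twice_Suc[OF i]
      mass_twice[OF i] mass_twice_Suc[OF i] cInf_atLeastLessThan[OF lt] cSup_atLeastLessThan[OF lt] eq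
    by (rule refl)+
  moreover have "node i \<noteq> {}"
    by (rule interval.nonempty[OF i])
  ultimately show ?thesis
    using False by (simp add: haar_def interval_of_def interval.h_pos[OF i])
qed

lemma bij_interval_of: "bij_betw interval_of UNIV dyadic_intervals_plus"
proof (rule bij_betw_imageI)
  show "inj interval_of"
  proof (rule injI)
    fix i j assume eq: "interval_of i = interval_of j"
    show "i = j"
      using eq interval.nonempty[of i] interval.nonempty[of j] inj_onD[OF interval.inj_on_nodes, of i j]
      by (cases "i = 0"; cases "j = 0") (auto simp: interval_of_def)
  qed
  have "dyadic_intervals = node ` {1..}"
  proof (intro equalityI subsetI)
    fix I assume "I \<in> dyadic_intervals"
    then obtain i j :: nat where I: "I = {(real i - 1) / 2 ^ j ..< real i / 2 ^ j}" "1 \<le> i" "i \<le> 2 ^ j"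
      by (auto simp: dyadic_intervals_def)
    \<comment> \<open>the intervals of a generation are numbered from \<open>1\<close>, the nodes from \<open>2 ^ j\<close>\<close>
    define k where "k = 2 ^ j + (i - 1)"
    have "floor_log k = j"
      using I by (intro floor_log_eqI) (auto simp: k_def)
    then have "mass k = 1 / 2 ^ j"
      by (simp add: mass_def)
    moreover have "real k = 2 ^ j + (real i - 1)"
      using I by (simp add: k_def of_nat_diff)
    ultimately have "left_end k = (real i - 1) / 2 ^ j" "left_end k + mass k = real i / 2 ^ j"
      by (simp_all add: left_end_def field_simps)
    then have "I = node k"
      by (simp add: I(1) node_def)
    moreover have "k \<ge> 1"
      unfolding k_def by (rule trans_le_add1) simp
    ultimately show "I \<in> node ` {1..}"
      by auto
  next
    fix I assume "I \<in> node ` {1..}"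
    then obtain k where k: "I = node k" "k \<ge> 1"
      by auto
    define j i where "j = floor_log k" and "i = k - 2 ^ j + 1"
    have "2 ^ j \<le> k" "k < 2 * 2 ^ j"
      using floor_log_exp2_le[of k] floor_log_exp2_gt[of k] k by (auto simp: j_def)
    then have i: "1 \<le> i" "i \<le> 2 ^ j" "real i = real k - 2 ^ j + 1"
      by (auto simp: i_def of_nat_diff)
    have "left_end k = (real i - 1) / 2 ^ j" "left_end k + mass k = real i / 2 ^ j"
      by (simp_all add: left_end_def mass_def j_def[symmetric] i(3) field_simps)
    then have "I = {(real i - 1) / 2 ^ j ..< real i / 2 ^ j}"
      by (simp add: k(1) node_def)
    then show "I \<in> dyadic_intervals"
      using i unfolding dyadic_intervals_def by blast
  qed
  moreover have "range interval_of = insert {} (node ` {1..})"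
    by (auto simp: interval_of_def image_def Suc_le_eq)
  ultimately show "range interval_of = dyadic_intervals_plus"
    by (simp add: dyadic_intervals_plus_def)
qed

lemma normalized_haar_interval_of: "normalized_haar (interval_of i) = (1 / mass i) *\<^sub>R interval.e i"
  unfolding normalized_haar_def haar_interval_of interval.norm_e by (simp add: divide_inverse)

lemma bounded_functional_pairing:
  "bounded_measurable \<phi> \<Longrightarrow> bounded_functional UNIV norm (pairing \<phi>)"
  using bounded_linear_pairing bounded_functional_UNIV by blast

lemma pairing_haar_normalized:
  "pairing (interval.h i) ((1 / mass j) *\<^sub>R interval.e j) = (if i = j then 1 else 0)"
  using bounded_linear.linear[OF bounded_linear_pairing[OF interval.unsigned.bounded_measurable_signed_haar], THEN linear_scale, of i "1 / mass j" "interval.e j"]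
  by (simp add: interval.pairing_h_e)

lemma INF_bound:
  fixes f :: "'b \<Rightarrow> real"
  assumes "(INF k\<in>K. \<bar>f k\<bar>) = \<delta>" "k \<in> K"
  shows "\<delta> \<le> \<bar>f k\<bar>"
proof -
  have "bdd_below ((\<lambda>k. \<bar>f k\<bar>) ` K)"
    by (rule bdd_belowI2[where m = 0]) simp
  then show ?thesis
    using cINF_lower[of "\<lambda>k. \<bar>f k\<bar>" K k] assms by simp
qed

lemma factorization_propertyI:
  assumes "bij_betw \<pi> UNIV K" "normalized_schauder_basis X N (e \<circ> \<pi>)"
    and "biorthogonal_functionals X N K e e'"
    and "\<And>T. bounded_operator X N T \<Longrightarrow> 0 < (INF k\<in>K. \<bar>e' k (T (e k))\<bar>) \<Longrightarrow>
      \<exists>R S. bounded_operator X N R \<and> bounded_operator X N S \<and> (\<forall>x\<in>X. x = S (T (R x)))"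
  shows "factorization_property X N K e"
  unfolding factorization_property_def using assms by blast

theorem haar_L1_factorization:
  "factorization_property (UNIV :: real L1 set) norm dyadic_intervals_plus normalized_haar"
proof (rule factorization_propertyI[where e' = "\<lambda>I. pairing (haar I)"])
  interpret banach_on "UNIV :: real L1 set" norm
    by (rule banach_on_UNIV)
  note bm = interval.unsigned.bounded_measurable_signed_haar
  show "bij_betw interval_of UNIV dyadic_intervals_plus"
    by (rule bij_interval_of)
  show "normalized_schauder_basis UNIV norm (normalized_haar \<circ> interval_of)"
  proof (rule normalized_schauder_basisI)
    fix k l x
    show "norm ((normalized_haar \<circ> interval_of) k) = 1"
      by (simp add: normalized_haar_interval_of interval.norm_e)
    show "bounded_functional UNIV norm (pairing (interval.h k))"
      by (intro bounded_functional_pairing bm)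
    show "pairing (interval.h k) ((normalized_haar \<circ> interval_of) l) = (if k = l then 1 else 0)"
      by (simp only: o_apply normalized_haar_interval_of pairing_haar_normalized)
    have "(\<lambda>n. norm (x - interval.expansion n x)) \<longlonglongrightarrow> norm (x - x)"
      by (intro tendsto_intros interval.expansion_tendsto)
    then show "(\<lambda>n. norm (x - (\<Sum>k<n. pairing (interval.h k) x *\<^sub>R (normalized_haar \<circ> interval_of) k))) \<longlonglongrightarrow> 0"
      by (simp add: haar_transfer_def normalized_haar_interval_of)
  qed simp
  show "biorthogonal_functionals UNIV norm dyadic_intervals_plus normalized_haar (\<lambda>I. pairing (haar I))"
    unfolding biorthogonal_functionals_def bij_betw_imp_surj_on[OF bij_interval_of, symmetric]
  proof (intro conjI ballI)
    fix I J assume "I \<in> range interval_of" "J \<in> range interval_of"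
    then obtain i j where ij: "I = interval_of i" "J = interval_of j"
      by blast
    show "bounded_functional UNIV norm (pairing (haar I))"
      unfolding ij haar_interval_of by (intro bounded_functional_pairing bm)
    show "pairing (haar I) (normalized_haar J) = (if I = J then 1 else 0)"
      unfolding ij haar_interval_of normalized_haar_interval_of pairing_haar_normalized
      using bij_betw_imp_inj_on[OF bij_interval_of] by (auto dest: injD)
  qed
  fix T :: "real L1 \<Rightarrow> real L1"
  assume T: "bounded_operator UNIV norm T"
    and pos: "0 < (INF I\<in>dyadic_intervals_plus. \<bar>pairing (haar I) (T (normalized_haar I))\<bar>)"
  define \<delta> where "\<delta> = (INF I\<in>dyadic_intervals_plus. \<bar>pairing (haar I) (T (normalized_haar I))\<bar>)"
  have lin: "bounded_linear T"
    using T by (simp add: bounded_operator_UNIV)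
  have "\<delta> * mass i \<le> \<bar>pairing (interval.h i) (T (interval.e i))\<bar>" for i
  proof -
    have "interval_of i \<in> dyadic_intervals_plus"
      using bij_betw_imp_surj_on[OF bij_interval_of] by blast
    from INF_bound[OF \<delta>_def[symmetric] this]
    have "\<delta> \<le> \<bar>pairing (interval.h i) (T ((1 / mass i) *\<^sub>R interval.e i))\<bar>"
      unfolding haar_interval_of normalized_haar_interval_of .
    also have "\<dots> = \<bar>pairing (interval.h i) (T (interval.e i))\<bar> / mass i"
      using bounded_linear.linear[OF lin, THEN linear_scale]
        bounded_linear.linear[OF bounded_linear_pairing[OF bm], THEN linear_scale] by (simp add: abs_mult)
    finally show ?thesis
      by (simp add: le_divide_eq)
  qed
  then have "interval.large_diagonal T \<delta>"
    by (rule interval.large_diagonal_haar)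
  then show "\<exists>R S. bounded_operator UNIV norm R \<and> bounded_operator UNIV norm S \<and> (\<forall>x\<in>UNIV. x = S (T (R x)))"
    using pos by (intro interval.L1_identity_factors[OF lin]) (auto simp: \<delta>_def)
qed

text \<open>The enumeration by \<open>prod_decode\<close> runs through the Haar functions of each coordinate in their usual order.  So in
  every coordinate a partial sum is a Haar partial sum of \<open>x c\<close>, and dominated convergence applies.\<close>

theorem haar_lp_factorization:
  assumes p: "1 \<le> p"
  shows "factorization_property (lp_space p) (lp_norm p) ((UNIV :: nat set) \<times> dyadic_intervals_plus)
    (\<lambda>(n, I). unit_tensor n (normalized_haar I))"
proof -
  interpret banach_on "lp_space p :: (nat \<Rightarrow> real L1) set" "lp_norm p"
    by (rule banach_on_lp[OF p])
  note bm = interval.unsigned.bounded_measurable_signed_haar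
  define \<pi> where "\<pi> k = (fst (prod_decode k), interval_of (snd (prod_decode k)))" for k
  define \<Phi> where "\<Phi> = (\<lambda>(c :: nat, I) (x :: nat \<Rightarrow> real L1). pairing (haar I) (x c))"
  define E where "E = (\<lambda>(c :: nat, I). unit_tensor c (normalized_haar I))"
  have \<pi>: "bij_betw \<pi> UNIV (UNIV \<times> dyadic_intervals_plus)"
  proof -
    have "bij_betw (map_prod id interval_of) (UNIV \<times> UNIV) (UNIV \<times> dyadic_intervals_plus)"
      by (intro bij_betw_map_prod bij_betw_id bij_interval_of)
    then have "bij_betw (map_prod id interval_of \<circ> prod_decode) UNIV (UNIV \<times> dyadic_intervals_plus)"
      using bij_betw_trans[OF bij_prod_decode] by simp
    then show ?thesis
      by (simp add: \<pi>_def[abs_def] comp_def map_prod_def split_beta)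
  qed
  have \<Phi>_functional: "bounded_functional (lp_space p) (lp_norm p) (\<Phi> (c, interval_of i))" for c i
  proof -
    interpret b: bounded_linear "pairing (interval.h i)"
      by (rule bounded_linear_pairing[OF bm])
    have "\<bar>pairing (interval.h i) (x c)\<bar> \<le> 1 * lp_norm p x" if "x \<in> lp_space p" for x
    proof -
      have "\<bar>pairing (interval.h i) (x c)\<bar> \<le> 1 * norm (x c)"
        using order_trans[OF abs_pairing_le[OF bm] norm_mult_L1_le[OF bm interval.unsigned.abs_signed_haar_le]] .
      then show ?thesis
        using norm_le_lp_norm[OF p that, of c] by simp
    qed
    then show ?thesis
      unfolding bounded_functional_def \<Phi>_def haar_interval_of split
      by (auto simp: b.add b.scaleR plus_fun_def scaleR_fun_def intro!: exI[of _ 1])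
  qed
  have biorth: "\<Phi> (c, interval_of i) (E (d, interval_of j)) = (if c = d \<and> i = j then 1 else 0)" for c d i j
    using pairing_haar_normalized[of i j] bounded_linear.linear[OF bounded_linear_pairing[OF bm[of i]], THEN linear_0]
    by (auto simp: \<Phi>_def E_def haar_interval_of normalized_haar_interval_of unit_tensor_def)
  have basis: "normalized_schauder_basis (lp_space p) (lp_norm p) (E \<circ> \<pi>)"
  proof (rule normalized_schauder_basisI)
    fix k l
    show "(E \<circ> \<pi>) k \<in> lp_space p" "lp_norm p ((E \<circ> \<pi>) k) = 1"
      by (simp_all add: E_def \<pi>_def unit_tensor_lp[OF p] normalized_haar_interval_of interval.norm_e)
    show "bounded_functional (lp_space p) (lp_norm p) (\<Phi> (\<pi> k))"
      unfolding \<pi>_def by (rule \<Phi>_functional)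
    show "\<Phi> (\<pi> k) ((E \<circ> \<pi>) l) = (if k = l then 1 else 0)"
      unfolding o_apply \<pi>_def biorth by (auto simp: prod_eq_iff[symmetric] prod_decode_eq)
  next
    fix x :: "nat \<Rightarrow> real L1" assume x: "x \<in> lp_space p"
    \<comment> \<open>the number of Haar functions of coordinate \<open>c\<close> among the first \<open>n\<close> basis vectors\<close>
    define m where "m n c = (LEAST i. n \<le> prod_encode (c, i))" for n c
    have m: "i < m n c \<longleftrightarrow> prod_encode (c, i) < n" for i n c
    proof
      show "i < m n c \<Longrightarrow> prod_encode (c, i) < n"
        using not_less_Least[of i "\<lambda>i. n \<le> prod_encode (c, i)"] by (auto simp: m_def)
      have "n \<le> prod_encode (c, m n c)"
        unfolding m_def by (rule LeastI[of "\<lambda>i. n \<le> prod_encode (c, i)" n]) (rule le_prod_encode_2)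
      then show "prod_encode (c, i) < n \<Longrightarrow> i < m n c"
        using prod_encode_strict_mono[of "m n c" i c] by (cases "m n c = i") (auto simp: not_less[symmetric] neq_iff)
    qed
    have partial: "(\<Sum>k<n. \<Phi> (\<pi> k) x *\<^sub>R (E \<circ> \<pi>) k) c = interval.expansion (m n c) (x c)" for n c
    proof -
      have "(\<Sum>k<n. \<Phi> (\<pi> k) x *\<^sub>R (E \<circ> \<pi>) k) c = (\<Sum>k<n. (\<Phi> (\<pi> k) x *\<^sub>R (E \<circ> \<pi>) k) c)"
        by (rule sum_fun_eval)
      also have "\<dots> = (\<Sum>k\<in>(\<lambda>i. prod_encode (c, i)) ` {..<m n c}. (\<Phi> (\<pi> k) x *\<^sub>R (E \<circ> \<pi>) k) c)"
      proof (rule sum.mono_neutral_right)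
        show "\<forall>k\<in>{..<n} - (\<lambda>i. prod_encode (c, i)) ` {..<m n c}. (\<Phi> (\<pi> k) x *\<^sub>R (E \<circ> \<pi>) k) c = 0"
        proof
          fix k assume k: "k \<in> {..<n} - (\<lambda>i. prod_encode (c, i)) ` {..<m n c}"
          have "fst (prod_decode k) \<noteq> c"
          proof
            assume c: "fst (prod_decode k) = c"
            then have "k = prod_encode (c, snd (prod_decode k))"
              by auto
            then show False
              using k m[of "snd (prod_decode k)" n c] by auto
          qed
          then show "(\<Phi> (\<pi> k) x *\<^sub>R (E \<circ> \<pi>) k) c = 0"
            by (simp add: E_def \<pi>_def scaleR_fun_def unit_tensor_def)
        qed
      qed (auto simp: m)
      also have "\<dots> = (\<Sum>i<m n c. (\<Phi> (\<pi> (prod_encode (c, i))) x *\<^sub>R (E \<circ> \<pi>) (prod_encode (c, i))) c)"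
        by (subst sum.reindex) (auto simp: inj_on_def)
      also have "\<dots> = interval.expansion (m n c) (x c)"
        unfolding haar_transfer_def
        by (intro sum.cong refl) (simp add: \<Phi>_def E_def \<pi>_def scaleR_fun_def unit_tensor_def haar_interval_of normalized_haar_interval_of)
      finally show ?thesis .
    qed
    show "(\<lambda>n. lp_norm p (x - (\<Sum>k<n. \<Phi> (\<pi> k) x *\<^sub>R (E \<circ> \<pi>) k))) \<longlonglongrightarrow> 0"
    proof (rule lp_dominated[OF p x])
      fix n c
      have "norm (x c - interval.expansion (m n c) (x c)) \<le> norm (x c) + norm (interval.expansion (m n c) (x c))"
        by (rule norm_triangle_ineq4)
      also have "\<dots> \<le> 2 * norm (x c)"
        using interval.norm_expansion_le[of "m n c" "x c"] by simp
      finally show "norm ((x - (\<Sum>k<n. \<Phi> (\<pi> k) x *\<^sub>R (E \<circ> \<pi>) k)) c) \<le> 2 * norm (x c)"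
        by (simp only: minus_apply partial)
    next
      fix c
      have "filterlim (\<lambda>n. m n c) at_top sequentially"
        unfolding filterlim_at_top eventually_sequentially
      proof safe
        fix j
        show "\<exists>N. \<forall>n\<ge>N. j \<le> m n c"
        proof (intro exI allI impI)
          fix n assume n: "Suc (prod_encode (c, j)) \<le> n"
          then show "j \<le> m n c"
            using m[of j n c] by simp
        qed
      qed
      from filterlim_compose[OF interval.expansion_tendsto this]
      have "(\<lambda>n. interval.expansion (m n c) (x c)) \<longlonglongrightarrow> x c" .
      from tendsto_diff[OF tendsto_const[of "x c"] this]
      show "(\<lambda>n. (x - (\<Sum>k<n. \<Phi> (\<pi> k) x *\<^sub>R (E \<circ> \<pi>) k)) c) \<longlonglongrightarrow> 0"
        by (simp only: minus_apply partial diff_self)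
    qed
  qed
  have "factorization_property (lp_space p) (lp_norm p) (UNIV \<times> dyadic_intervals_plus) E"
  proof (rule factorization_propertyI[where e' = \<Phi>])
    show "bij_betw \<pi> UNIV (UNIV \<times> dyadic_intervals_plus)" "normalized_schauder_basis (lp_space p) (lp_norm p) (E \<circ> \<pi>)"
      by (rule \<pi> basis)+
    show "biorthogonal_functionals (lp_space p) (lp_norm p) (UNIV \<times> dyadic_intervals_plus) E \<Phi>"
      unfolding biorthogonal_functionals_def bij_betw_imp_surj_on[OF bij_interval_of, symmetric]
    proof (intro conjI ballI)
      fix k l :: "nat \<times> real set" assume "k \<in> UNIV \<times> range interval_of" "l \<in> UNIV \<times> range interval_of"
      then obtain c d i j where kl: "k = (c, interval_of i)" "l = (d, interval_of j)"
        by blast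
      show "bounded_functional (lp_space p) (lp_norm p) (\<Phi> k)"
        unfolding kl by (rule \<Phi>_functional)
      show "\<Phi> k (E l) = (if k = l then 1 else 0)"
        unfolding kl biorth using bij_betw_imp_inj_on[OF bij_interval_of] by (auto dest: injD)
    qed
    fix T :: "(nat \<Rightarrow> real L1) \<Rightarrow> nat \<Rightarrow> real L1"
    assume T: "bounded_operator (lp_space p) (lp_norm p) T"
      and pos: "0 < (INF k\<in>UNIV \<times> dyadic_intervals_plus. \<bar>\<Phi> k (T (E k))\<bar>)"
    define \<delta> where "\<delta> = (INF k\<in>UNIV \<times> dyadic_intervals_plus. \<bar>\<Phi> k (T (E k))\<bar>)"
    have "interval.large_diagonal (\<lambda>u. T (unit_tensor c u) c) \<delta>" for c
    proof (rule interval.large_diagonal_haar)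
      fix i :: nat
      have "(c, interval_of i) \<in> UNIV \<times> dyadic_intervals_plus"
        using bij_betw_imp_surj_on[OF bij_interval_of] by blast
      from INF_bound[OF \<delta>_def[symmetric] this]
      have "\<delta> \<le> \<bar>pairing (interval.h i) (T (unit_tensor c ((1 / mass i) *\<^sub>R interval.e i)) c)\<bar>"
        unfolding \<Phi>_def E_def split haar_interval_of normalized_haar_interval_of .
      also have "unit_tensor c ((1 / mass i) *\<^sub>R interval.e i) = (1 / mass i) *\<^sub>R unit_tensor c (interval.e i)"
        by (auto simp: unit_tensor_def scaleR_fun_def)
      also have "T \<dots> = (1 / mass i) *\<^sub>R T (unit_tensor c (interval.e i))"
        using T unit_tensor_lp(1)[OF p] unfolding bounded_operator_def by blast
      also have "\<bar>pairing (interval.h i) (\<dots> c)\<bar> = \<bar>pairing (interval.h i) (T (unit_tensor c (interval.e i)) c)\<bar> / mass i"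
        using bounded_linear.linear[OF bounded_linear_pairing[OF bm[of i]], THEN linear_scale]
        by (simp add: scaleR_fun_def abs_mult)
      finally show "\<delta> * mass i \<le> \<bar>pairing (interval.h i) (T (unit_tensor c (interval.e i)) c)\<bar>"
        by (simp add: le_divide_eq)
    qed
    then show "\<exists>R S. bounded_operator (lp_space p) (lp_norm p) R \<and> bounded_operator (lp_space p) (lp_norm p) S
        \<and> (\<forall>x\<in>lp_space p. x = S (T (R x)))"
      using pos T by (intro interval.lp_identity_factors[OF p]) (auto simp: \<delta>_def)
  qed
  then show ?thesis
    by (simp add: E_def)
qed

section \<open>The bi-parameter Haar system\<close>

definition haar_tensor :: "nat \<Rightarrow> nat \<Rightarrow> real \<times> real \<Rightarrow> real" where
  "haar_tensor i j = tensor (interval.h i) (interval.h j)"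

lemma haar2_interval_of: "haar2 (interval_of i) (interval_of j) = haar_tensor i j"
  by (simp add: haar2_def haar_tensor_def tensor_def haar_interval_of)

lemma h_borel: "interval.h i \<in> borel_measurable borel"
  using haar_measurable[of "interval_of i"] by (simp add: haar_interval_of)

lemma abs_h_le: "\<bar>interval.h i s\<bar> \<le> 1"
  by (rule interval.unsigned.abs_signed_haar_le)

lemma bounded_measurable_haar_tensor: "bounded_measurable (haar_tensor i j)"
  unfolding haar_tensor_def by (intro bounded_measurable_tensor h_borel abs_h_le)

lemma integrable_haar_tensor: "integrable unit_cube (haar_tensor i j)"
  by (intro integrable_bounded_measurable bounded_measurable_haar_tensor)

lemma abs_haar_tensor:
  "\<bar>haar_tensor i j x\<bar> = indicator (node (max 1 i) \<times> node (max 1 j)) x"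
proof -
  have "\<bar>interval.h k s\<bar> = indicator (node (max 1 k)) s" for k s
    using interval.abs_h[of k s] by (cases "k = 0") (auto simp: interval.h_0 max_def)
  then show ?thesis
    by (simp add: haar_tensor_def tensor_def indicator_rectangle abs_mult split: prod.splits)
qed

lemma mass_max_1: "mass (max 1 i) = mass i"
  by (cases "i = 0") (auto simp: max_def)

lemma norm_haar_tensor: "norm (to_L1 (haar_tensor i j)) = mass i * mass j"
  using integral_rectangle[of "max 1 i" "max 1 j"]
  by (simp only: norm_to_L1[OF integrable_haar_tensor] abs_haar_tensor mass_max_1)

lemma pairing_haar_tensor:
  "pairing (haar_tensor i j) (to_L1 (haar_tensor k l)) = (if i = k \<and> j = l then mass i * mass j else 0)"
proof -
  have "pairing (haar_tensor i j) (to_L1 (haar_tensor k l))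
      = (\<integral>x. haar_tensor i j x * haar_tensor k l x \<partial>unit_cube)"
    by (rule pairing_to_L1[OF bounded_measurable_haar_tensor integrable_haar_tensor])
  also have "(\<lambda>x. haar_tensor i j x * haar_tensor k l x)
      = tensor (\<lambda>s. interval.h i s * interval.h k s) (\<lambda>t. interval.h j t * interval.h l t)"
    by (auto simp: haar_tensor_def tensor_def)
  also have "(\<integral>x. \<dots> x \<partial>unit_cube)
      = (\<integral>s. interval.h i s * interval.h k s \<partial>unit_cube) * (\<integral>t. interval.h j t * interval.h l t \<partial>unit_cube)"
    by (intro integral_tensor borel_measurable_times h_borel) (auto simp: abs_mult intro!: mult_le_one abs_h_le)
  finally show ?thesis
    by (simp add: interval.integral_h_h)
qed

text \<open>Pointwise form of the averaging identity: the kernel of a partial sum is that of a conditional expectation.  In this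
  form two variables can be multiplied.\<close>

lemma haar_kernel:
  assumes "n \<ge> 1"
  shows "(\<Sum>i<n. interval.h i s * interval.h i s' / mass i)
    = (\<Sum>i=n..<2*n. indicator (node i) s * indicator (node i) s' / mass i)"
proof -
  have "{..<n} = insert 0 {1..<n}"
    using assms by auto
  then have "(\<Sum>i<n. interval.h i s * interval.h i s' / mass i)
      = indicator (node 1) s * indicator (node 1) s' + (\<Sum>i=1..<n. interval.h i s * interval.h i s' / mass i)"
    by (simp add: interval.h_0)
  also have "(\<Sum>i=1..<n. interval.h i s * interval.h i s' / mass i)
      = (\<Sum>i=1..<n. ((indicator (node (2*i)) s - indicator (node (Suc (2*i))) s) / mass i) *\<^sub>R
          (indicator (node (2*i)) s' - indicator (node (Suc (2*i))) s'))"
    by (intro sum.cong) (auto simp: interval.h_pos)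
  finally show ?thesis
    using heap_telescope[of "\<lambda>i. indicator (node i) s" "\<lambda>i. indicator (node i) s' :: real",
        OF interval.indicator_split interval.indicator_split assms] by simp
qed

text \<open>Fix a point of the node in the kernel: exactly one leaf contains it.\<close>

lemma indicator_eq_haar_sum:
  assumes "a \<ge> 1"
  obtains c where "\<And>s. indicator (node a) s = (\<Sum>i<a. c i * interval.h i s)"
proof -
  obtain s\<^sub>0 where s0: "s\<^sub>0 \<in> node a"
    using interval.nonempty[OF assms] by auto
  have "indicator (node a) s = (\<Sum>i<a. (mass a * interval.h i s\<^sub>0 / mass i) * interval.h i s)" for s
  proof -
    have "(\<Sum>i<a. interval.h i s\<^sub>0 * interval.h i s / mass i)
        = (\<Sum>i=a..<2*a. if i = a then indicator (node a) s / mass a else 0)"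
      unfolding haar_kernel[OF assms]
    proof (intro sum.cong refl)
      fix i assume i: "i \<in> {a..<2*a}"
      show "indicator (node i) s\<^sub>0 * indicator (node i) s / mass i = (if i = a then indicator (node a) s / mass a else 0)"
        using interval.leaves_disjoint[OF assms i, of a] s0 assms by (auto simp: indicator_def)
    qed
    also have "\<dots> = indicator (node a) s / mass a"
      using assms by simp
    finally have "indicator (node a) s = mass a * (\<Sum>i<a. interval.h i s\<^sub>0 * interval.h i s / mass i)"
      by simp
    then show ?thesis
      by (simp add: sum_distrib_left mult.assoc)
  qed
  then show ?thesis
    by (rule that)
qed

lemma haar_tensor_dense:
  assumes V: "closed V" "subspace V" and mem: "\<And>i j. to_L1 (haar_tensor i j) \<in> V"
  shows "u \<in> V"
proof (rule square.dense[OF V])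
  fix k :: nat assume k: "k \<ge> 1"
  obtain a b where ab: "heap_pair k = (a, b)"
    by (cases "heap_pair k")
  have "a \<ge> 1" "b \<ge> 1"
    using heap_pair_inv[OF k] by (auto simp: ab)
  then obtain c d where c: "\<And>s. indicator (node a) s = (\<Sum>i<a. c i * interval.h i s)"
    and d: "\<And>t. indicator (node b) t = (\<Sum>j<b. d j * interval.h j t)"
    using indicator_eq_haar_sum by metis
  have bm: "bounded_measurable (\<lambda>x. (c i * d j) * haar_tensor i j x)" for i j
    by (intro bounded_measurable_mult bounded_measurable_const bounded_measurable_haar_tensor)
  have "indicator (square k) = (\<lambda>x. \<Sum>i<a. \<Sum>j<b. (c i * d j) * haar_tensor i j x)"
    by (auto simp: square_def ab indicator_rectangle tensor_def haar_tensor_def c d sum_product fun_eq_iff mult_ac)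
  then have "to_L1 (indicator (square k)) = to_L1 (\<lambda>x. \<Sum>i<a. \<Sum>j<b. (c i * d j) * haar_tensor i j x)"
    by (rule arg_cong)
  also have "\<dots> = (\<Sum>i<a. to_L1 (\<lambda>x. \<Sum>j<b. (c i * d j) * haar_tensor i j x))"
    by (intro to_L1_sum[symmetric] integrable_bounded_measurable bounded_measurable_sum bm)
  also have "\<dots> = (\<Sum>i<a. \<Sum>j<b. to_L1 (\<lambda>x. (c i * d j) * haar_tensor i j x))"
    by (intro sum.cong refl to_L1_sum[symmetric] integrable_bounded_measurable bm)
  also have "\<dots> = (\<Sum>i<a. \<Sum>j<b. (c i * d j) *\<^sub>R to_L1 (haar_tensor i j))"
    by (intro sum.cong refl to_L1_scaleR[symmetric] integrable_haar_tensor)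
  also have "\<dots> \<in> V"
    by (intro subspace_sum[OF V(2)] subspace_scale[OF V(2)] mem)
  finally show "to_L1 (indicator (square k)) \<in> V" .
qed

definition tensor_coeff :: "(real \<times> real) L1 \<Rightarrow> nat \<times> nat \<Rightarrow> (real \<times> real) L1" where
  "tensor_coeff u = (\<lambda>(i, j). (pairing (haar_tensor i j) u / (mass i * mass j)) *\<^sub>R to_L1 (haar_tensor i j))"

text \<open>The kernel of the sum over a rectangle of indices is the product of two kernels of conditional expectations, so the
  sum is an average over a grid of disjoint rectangles.\<close>

lemma norm_rectangular_sum_le:
  "norm (\<Sum>q\<in>{..<n} \<times> {..<m}. tensor_coeff u q) \<le> norm u"
proof (cases "n = 0 \<or> m = 0")
  case True
  then show ?thesis
    by auto
next
  case False
  then have n: "n \<ge> 1" and m: "m \<ge> 1"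
    by auto
  define R where "R i j = (tensor (indicator (node i)) (indicator (node j)) :: real \<times> real \<Rightarrow> real)" for i j
  have bm_R: "bounded_measurable (R i j)" for i j
    unfolding R_def by (intro bounded_measurable_tensor borel_measurable_indicator node_borel) (auto simp: indicator_def)
  have kernel: "(\<Sum>i<n. \<Sum>j<m. haar_tensor i j y * haar_tensor i j x / (mass i * mass j))
      = (\<Sum>i=n..<2*n. \<Sum>j=m..<2*m. R i j y * R i j x / (mass i * mass j))" for x y
  proof -
    obtain s t s' t' where xy: "y = (s, t)" "x = (s', t')"
      by (cases x; cases y) auto
    have "(\<Sum>i<n. \<Sum>j<m. haar_tensor i j y * haar_tensor i j x / (mass i * mass j))
        = (\<Sum>i<n. interval.h i s * interval.h i s' / mass i) * (\<Sum>j<m. interval.h j t * interval.h j t' / mass j)"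
      unfolding sum_product by (intro sum.cong refl) (simp add: xy haar_tensor_def tensor_def)
    also have "\<dots> = (\<Sum>i=n..<2*n. \<Sum>j=m..<2*m. R i j y * R i j x / (mass i * mass j))"
      unfolding haar_kernel[OF n] haar_kernel[OF m] sum_product
      by (intro sum.cong refl) (simp add: xy R_def tensor_def)
    finally show ?thesis .
  qed
  have pairing_kernel: "pairing (\<lambda>y. \<Sum>i\<in>I. \<Sum>j\<in>J. f i j y * f i j x / (mass i * mass j)) u
      = (\<Sum>i\<in>I. \<Sum>j\<in>J. pairing (f i j) u / (mass i * mass j) * f i j x)"
    if "\<And>i j. bounded_measurable (f i j)" for f :: "nat \<Rightarrow> nat \<Rightarrow> real \<times> real \<Rightarrow> real" and I J x
  proof -
    have bm: "bounded_measurable (\<lambda>y. f i j x / (mass i * mass j) * f i j y)" for i j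
      by (intro bounded_measurable_mult bounded_measurable_const that)
    have "pairing (\<lambda>y. \<Sum>i\<in>I. \<Sum>j\<in>J. f i j y * f i j x / (mass i * mass j)) u
        = pairing (\<lambda>y. \<Sum>i\<in>I. \<Sum>j\<in>J. f i j x / (mass i * mass j) * f i j y) u"
      by (simp add: mult.commute)
    also have "\<dots> = (\<Sum>i\<in>I. pairing (\<lambda>y. \<Sum>j\<in>J. f i j x / (mass i * mass j) * f i j y) u)"
      by (intro pairing_sum_left bounded_measurable_sum bm)
    also have "\<dots> = (\<Sum>i\<in>I. \<Sum>j\<in>J. pairing (\<lambda>y. f i j x / (mass i * mass j) * f i j y) u)"
      by (intro sum.cong refl pairing_sum_left bm)
    also have "\<dots> = (\<Sum>i\<in>I. \<Sum>j\<in>J. pairing (f i j) u / (mass i * mass j) * f i j x)"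
      by (intro sum.cong refl) (simp only: pairing_cmult_left, simp)
    finally show ?thesis .
  qed
  have to_L1_double_sum: "(\<Sum>i\<in>I. \<Sum>j\<in>J. c i j *\<^sub>R to_L1 (f i j)) = to_L1 (\<lambda>x. \<Sum>i\<in>I. \<Sum>j\<in>J. c i j * f i j x)"
    if bm: "\<And>i j. bounded_measurable (f i j)" for f :: "nat \<Rightarrow> nat \<Rightarrow> real \<times> real \<Rightarrow> real" and I J and c :: "nat \<Rightarrow> nat \<Rightarrow> real"
  proof -
    have bm': "bounded_measurable (\<lambda>x. c i j * f i j x)" for i j
      by (intro bounded_measurable_mult bounded_measurable_const bm)
    have "(\<Sum>i\<in>I. \<Sum>j\<in>J. c i j *\<^sub>R to_L1 (f i j)) = (\<Sum>i\<in>I. \<Sum>j\<in>J. to_L1 (\<lambda>x. c i j * f i j x))"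
      by (intro sum.cong refl to_L1_scaleR integrable_bounded_measurable bm)
    also have "\<dots> = (\<Sum>i\<in>I. to_L1 (\<lambda>x. \<Sum>j\<in>J. c i j * f i j x))"
      by (intro sum.cong refl to_L1_sum integrable_bounded_measurable bm')
    also have "\<dots> = to_L1 (\<lambda>x. \<Sum>i\<in>I. \<Sum>j\<in>J. c i j * f i j x)"
      by (intro to_L1_sum integrable_bounded_measurable bounded_measurable_sum bm')
    finally show ?thesis .
  qed
  have "(\<Sum>q\<in>{..<n} \<times> {..<m}. tensor_coeff u q)
      = (\<Sum>i<n. \<Sum>j<m. (pairing (haar_tensor i j) u / (mass i * mass j)) *\<^sub>R to_L1 (haar_tensor i j))"
    by (simp add: tensor_coeff_def sum.cartesian_product)
  also have "\<dots> = (\<Sum>i=n..<2*n. \<Sum>j=m..<2*m. (pairing (R i j) u / (mass i * mass j)) *\<^sub>R to_L1 (R i j))"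
    unfolding to_L1_double_sum[OF bounded_measurable_haar_tensor] to_L1_double_sum[OF bm_R]
      pairing_kernel[OF bounded_measurable_haar_tensor, symmetric] pairing_kernel[OF bm_R, symmetric] kernel ..
  also have "norm \<dots> \<le> (\<Sum>i=n..<2*n. \<Sum>j=m..<2*m. norm (mult_L1 (R i j) u))"
  proof (intro sum_norm_le)
    fix i j assume ij: "i \<in> {n..<2*n}" "j \<in> {m..<2*m}"
    have "norm (to_L1 (R i j)) = (\<integral>x. \<bar>R i j x\<bar> \<partial>unit_cube)"
      by (intro norm_to_L1 integrable_bounded_measurable bm_R)
    also have "\<dots> = (\<integral>x. indicator (node i \<times> node j) x \<partial>unit_cube)"
      unfolding indicator_rectangle by (intro Bochner_Integration.integral_cong) (auto simp: R_def tensor_def)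
    also have "\<dots> = mass i * mass j"
      using ij n m by (intro integral_rectangle) auto
    finally have "norm (to_L1 (R i j)) = mass i * mass j" .
    then show "norm ((pairing (R i j) u / (mass i * mass j)) *\<^sub>R to_L1 (R i j)) \<le> norm (mult_L1 (R i j) u)"
      using abs_pairing_le[OF bm_R, of i j u] by (simp add: abs_mult)
  qed
  also have "\<dots> = (\<integral>x. (\<Sum>i=n..<2*n. \<Sum>j=m..<2*m. \<bar>R i j x\<bar> * \<bar>rep_L1 u x\<bar>) \<partial>unit_cube)"
  proof -
    have int: "integrable unit_cube (\<lambda>x. \<bar>R i j x\<bar> * \<bar>rep_L1 u x\<bar>)" for i j
      using integrable_abs[OF integrable_mult_rep_L1[OF bm_R, of i j u]] by (simp add: abs_mult)
    show ?thesis
      by (simp add: norm_mult_L1 bm_R int Bochner_Integration.integral_sum Bochner_Integration.integrable_sum)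
  qed
  also have "\<dots> \<le> (\<integral>x. \<bar>rep_L1 u x\<bar> \<partial>unit_cube)"
  proof (rule integral_mono)
    show "integrable unit_cube (\<lambda>x. \<Sum>i=n..<2*n. \<Sum>j=m..<2*m. \<bar>R i j x\<bar> * \<bar>rep_L1 u x\<bar>)"
      using integrable_abs[OF integrable_mult_rep_L1[OF bm_R]]
      by (intro Bochner_Integration.integrable_sum) (simp add: abs_mult)
    show "integrable unit_cube (\<lambda>x. \<bar>rep_L1 u x\<bar>)"
      by (intro integrable_abs rep_L1_integrable)
    fix x :: "real \<times> real"
    obtain s t where x: "x = (s, t)"
      by (cases x)
    have "(\<Sum>i=n..<2*n. \<Sum>j=m..<2*m. \<bar>R i j x\<bar>) = (\<Sum>i=n..<2*n. indicator (node i) s) * (\<Sum>j=m..<2*m. indicator (node j) t)"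
      unfolding sum_product by (intro sum.cong refl) (simp add: x R_def tensor_def abs_mult)
    also have "\<dots> \<le> 1"
      unfolding interval.sum_indicator_leaves[OF n] interval.sum_indicator_leaves[OF m] by (simp add: indicator_def)
    finally have "(\<Sum>i=n..<2*n. \<Sum>j=m..<2*m. \<bar>R i j x\<bar>) * \<bar>rep_L1 u x\<bar> \<le> 1 * \<bar>rep_L1 u x\<bar>"
      by (intro mult_right_mono) auto
    then show "(\<Sum>i=n..<2*n. \<Sum>j=m..<2*m. \<bar>R i j x\<bar> * \<bar>rep_L1 u x\<bar>) \<le> \<bar>rep_L1 u x\<bar>"
      by (simp add: sum_distrib_right)
  qed
  finally show ?thesis
    by (simp add: norm_L1_eq)
qed

text \<open>The enumeration runs through the shells \<open>max i j = n\<close>, first along the row \<open>(0, n), \<dots>, (n - 1, n)\<close> and then along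
  \<open>(n, 0), \<dots>, (n, n)\<close>.\<close>

fun shell_next :: "nat \<times> nat \<Rightarrow> nat \<times> nat" where
  "shell_next (i, j) = (if i < j then (if Suc i = j then (j, 0) else (Suc i, j))
     else if j < i then (i, Suc j) else (0, Suc i))"

definition shell :: "nat \<Rightarrow> nat \<times> nat" where
  "shell k = (shell_next ^^ k) (0, 0)"

lemma shell_0: "shell 0 = (0, 0)" and shell_Suc: "shell (Suc k) = shell_next (shell k)"
  by (simp_all add: shell_def)

text \<open>The pairs that precede a given one in this enumeration.\<close>

definition before :: "nat \<times> nat \<Rightarrow> (nat \<times> nat) set" where
  "before = (\<lambda>(i, j). if i < j then {..<j} \<times> {..<j} \<union> {..<i} \<times> {j}
     else {..<i} \<times> {..<Suc i} \<union> {i} \<times> {..<j})"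

lemma before_next: "before (shell_next q) = insert q (before q)"
proof (cases q)
  case (Pair i j)
  consider "i < j" "Suc i = j" | "i < j" "Suc i \<noteq> j" | "j < i" | "i = j"
    by linarith
  then show ?thesis
    by cases (auto simp: Pair before_def less_Suc_eq)
qed

lemma image_shell: "shell ` {..<k} = before (shell k)"
proof (induction k)
  case 0
  show ?case
    by (simp add: shell_0 before_def)
next
  case (Suc k)
  then show ?case
    by (simp add: shell_Suc before_next lessThan_Suc)
qed

lemma inj_shell: "inj shell"
proof (rule linorder_injI)
  fix k l :: nat assume "k < l"
  have "shell l \<notin> before (shell l)"
    by (cases "shell l") (auto simp: before_def)
  then show "shell k \<noteq> shell l"
    using \<open>k < l\<close> unfolding image_shell[symmetric] by (metis imageI lessThan_iff)
qed

lemma surj_shell: "surj shell"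
proof -
  have row: "\<exists>k'. shell k' = (j, 0)" if "shell k = (i, j)" "i < j" for i j k
    using that
  proof (induction "j - i" arbitrary: i k)
    case (Suc d)
    have next': "shell (Suc k) = (if Suc i = j then (j, 0) else (Suc i, j))"
      using Suc.prems by (simp add: shell_Suc)
    show ?case
    proof (cases "Suc i = j")
      case False
      then show ?thesis
        using Suc.hyps(1)[of "Suc i" "Suc k"] Suc.hyps(2) Suc.prems next' by auto
    qed (use next' in auto)
  qed simp
  have column: "\<exists>k'. shell k' = (i, i)" if "shell k = (i, j)" "j \<le> i" for i j k
    using that
  proof (induction "i - j" arbitrary: j k)
    case 0
    then show ?case
      by auto
  next
    case (Suc d)
    then have "shell (Suc k) = (i, Suc j)"
      by (simp add: shell_Suc)
    then show ?case
      using Suc.hyps(1)[of "Suc j" "Suc k"] Suc.hyps(2) Suc.prems by auto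
  qed
  have diag: "\<exists>k. shell k = (n, n)" for n
  proof (induction n)
    case 0
    show ?case
      using shell_0 by blast
  next
    case (Suc n)
    then obtain k where "shell k = (n, n)"
      by blast
    then have "shell (Suc k) = (0, Suc n)"
      by (simp add: shell_Suc)
    then obtain k' where "shell k' = (Suc n, 0)"
      using row[of "Suc k" 0 "Suc n"] by auto
    then show ?case
      using column[of k' "Suc n" 0] by auto
  qed
  show ?thesis
    unfolding surj_def
  proof
    fix q :: "nat \<times> nat"
    obtain a b where q: "q = (a, b)"
      by (cases q)
    obtain k where "shell k = (Suc (max a b), Suc (max a b))"
      using diag by blast
    then have "q \<in> before (shell k)"
      by (auto simp: before_def q)
    then show "\<exists>k. q = shell k"
      unfolding image_shell[symmetric] by blast
  qed
qed

text \<open>The index set is a square or rectangle together with a piece of a row, and the sum over this piece is a difference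
  of two sums over rectangles.\<close>

lemma norm_shell_sum_le: "norm (\<Sum>k<n. tensor_coeff u (shell k)) \<le> 3 * norm u"
proof -
  define U where "U a b = (\<Sum>q\<in>{..<a} \<times> {..<b}. tensor_coeff u q)" for a b :: nat
  have U: "norm (U a b) \<le> norm u" for a b
    unfolding U_def by (rule norm_rectangular_sum_le)
  have three: "norm (x + (y - z)) \<le> 3 * norm u" if "norm x \<le> norm u" "norm y \<le> norm u" "norm z \<le> norm u" for x y z :: "(real \<times> real) L1"
    using norm_triangle_ineq[of x "y - z"] norm_triangle_ineq4[of y z] that by linarith
  obtain i j where ij: "shell n = (i, j)"
    by (cases "shell n")
  have "(\<Sum>k<n. tensor_coeff u (shell k)) = (\<Sum>q\<in>shell ` {..<n}. tensor_coeff u q)"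
    using inj_shell by (subst sum.reindex) (auto intro: inj_on_subset)
  also have "\<dots> = (\<Sum>q\<in>before (i, j). tensor_coeff u q)"
    by (simp add: image_shell ij)
  also have "norm \<dots> \<le> 3 * norm u"
  proof (cases "i < j")
    case True
    have "U i (Suc j) = U i j + (\<Sum>q\<in>{..<i} \<times> {j}. tensor_coeff u q)"
      unfolding U_def by (subst sum.union_disjoint[symmetric]) (auto intro!: sum.cong)
    moreover have "(\<Sum>q\<in>before (i, j). tensor_coeff u q) = U j j + (\<Sum>q\<in>{..<i} \<times> {j}. tensor_coeff u q)"
      unfolding U_def using True by (subst sum.union_disjoint[symmetric]) (auto simp: before_def)
    ultimately have "(\<Sum>q\<in>before (i, j). tensor_coeff u q) = U j j + (U i (Suc j) - U i j)"
      by simp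
    then show ?thesis
      using three[OF U U U] by metis
  next
    case False
    have "U (Suc i) j = U i j + (\<Sum>q\<in>{i} \<times> {..<j}. tensor_coeff u q)"
      unfolding U_def by (subst sum.union_disjoint[symmetric]) (auto intro!: sum.cong)
    moreover have "(\<Sum>q\<in>before (i, j). tensor_coeff u q) = U i (Suc i) + (\<Sum>q\<in>{i} \<times> {..<j}. tensor_coeff u q)"
      unfolding U_def using False by (subst sum.union_disjoint[symmetric]) (auto simp: before_def)
    ultimately have "(\<Sum>q\<in>before (i, j). tensor_coeff u q) = U i (Suc i) + (U (Suc i) j - U i j)"
      by simp
    then show ?thesis
      using three[OF U U U] by metis
  qed
  finally show ?thesis .
qed

lemma shell_sum_tendsto: "(\<lambda>n. \<Sum>k<n. tensor_coeff u (shell k)) \<longlonglongrightarrow> u"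
proof -
  define P where "P n u = (\<Sum>k<n. tensor_coeff u (shell k))" for n u
  have "bounded_linear (\<lambda>u. tensor_coeff u q)" for q
    unfolding tensor_coeff_def divide_inverse split_beta
    by (intro bounded_linear_scaleR_const bounded_linear_mult_const bounded_linear_pairing bounded_measurable_haar_tensor)
  then have "bounded_linear (P n)" for n
    unfolding P_def by (intro bounded_linear_sum)
  then interpret P: bounded_linear "P n" for n .
  have bound: "norm (P n u) \<le> 3 * norm u" for n u
    unfolding P_def by (rule norm_shell_sum_le)
  define V where "V = {u. (\<lambda>n. P n u) \<longlonglongrightarrow> u}"
  have sub: "subspace V"
    by (auto simp: subspace_def V_def P.zero P.add P.scaleR intro!: tendsto_add tendsto_scaleR)
  have cl: "closed V"
    unfolding closed_sequential_limits
  proof safe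
    fix f v assume f: "\<forall>m. f m \<in> V" and lim: "f \<longlonglongrightarrow> v"
    show "v \<in> V"
      unfolding V_def mem_Collect_eq
    proof (rule LIMSEQ_I)
      fix \<epsilon> :: real assume "\<epsilon> > 0"
      then obtain m where m: "norm (f m - v) < \<epsilon> / 8"
        using LIMSEQ_D[OF lim, of "\<epsilon> / 8"] by auto
      have "(\<lambda>n. P n (f m)) \<longlonglongrightarrow> f m"
        using f by (simp add: V_def)
      then obtain N where N: "\<And>n. n \<ge> N \<Longrightarrow> norm (P n (f m) - f m) < \<epsilon> / 2"
        using LIMSEQ_D[of _ "f m" "\<epsilon> / 2"] \<open>\<epsilon> > 0\<close> half_gt_zero by blast
      have "norm (P n v - v) < \<epsilon>" if "n \<ge> N" for n
      proof -
        have "P n v - v = P n (v - f m) + (P n (f m) - f m) + (f m - v)"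
          by (simp add: P.diff)
        then have "norm (P n v - v) \<le> norm (P n (v - f m)) + norm (P n (f m) - f m) + norm (f m - v)"
          by (metis norm_triangle_mono norm_triangle_ineq order_refl)
        then show ?thesis
          using bound[of n "v - f m"] N[OF that] m by (simp add: norm_minus_commute)
      qed
      then show "\<exists>N. \<forall>n\<ge>N. norm (P n v - v) < \<epsilon>"
        by blast
    qed
  qed
  have mem: "to_L1 (haar_tensor a b) \<in> V" for a b
  proof -
    obtain l where l: "shell l = (a, b)"
      using surj_shell by (metis surjD)
    have "P n (to_L1 (haar_tensor a b)) = to_L1 (haar_tensor a b)" if "n > l" for n
    proof -
      have "P n (to_L1 (haar_tensor a b)) = (\<Sum>k<n. if k = l then to_L1 (haar_tensor a b) else 0)"
        unfolding P_def
      proof (intro sum.cong refl)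
        fix k
        obtain i j where ij: "shell k = (i, j)"
          by (cases "shell k")
        have "(i = a \<and> j = b) \<longleftrightarrow> k = l"
          using injD[OF inj_shell, of k l] l ij by auto
        then show "tensor_coeff (to_L1 (haar_tensor a b)) (shell k) = (if k = l then to_L1 (haar_tensor a b) else 0)"
          by (auto simp: tensor_coeff_def ij pairing_haar_tensor)
      qed
      then show ?thesis
        using that by simp
    qed
    then have "\<forall>\<^sub>F n in sequentially. P n (to_L1 (haar_tensor a b)) = to_L1 (haar_tensor a b)"
      unfolding eventually_sequentially by (intro exI[of _ "Suc l"]) auto
    then show ?thesis
      unfolding V_def mem_Collect_eq by (rule tendsto_eventually)
  qed
  have "u \<in> V"
    by (rule haar_tensor_dense[OF cl sub mem])
  then show ?thesis
    by (simp add: V_def P_def)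
qed

text \<open>On a square \<open>K\<close> of generation \<open>2 * N\<close> the function \<open>h\<^sub>I \<otimes> h\<^sub>J\<close> is constant on the four quarters of \<open>K\<close>, that is, on the
  cells two generations later.\<close>

lemma large_diagonal_haar_tensor:
  assumes "\<And>i j. \<delta> * (mass i * mass j) \<le> \<bar>pairing (haar_tensor i j) (T (to_L1 (haar_tensor i j)))\<bar>"
  shows "square.large_diagonal T \<delta>"
  unfolding square.large_diagonal_def
proof
  fix N
  have "\<exists>s. square.adapted (2 ^ (2 * N + 2)) s \<and> (\<forall>x. \<bar>s x\<bar> = indicator (square K) x)
      \<and> \<delta> * mass K \<le> \<bar>pairing s (T (to_L1 s))\<bar>" if K: "K \<in> lev (2 * N)" for K
  proof (intro exI conjI allI)
    define a b where "a = fst (heap_pair K)" and "b = snd (heap_pair K)"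
    have "K \<ge> 1" and lev_K: "floor_log K = 2 * N"
      using lev_ge_1[OF K] floor_log_eqI[of K "2 * N"] K by (auto simp: lev_def)
    then have ab: "a \<ge> 1" "b \<ge> 1" "floor_log a + floor_log b = 2 * N"
        "floor_log a = floor_log b \<or> floor_log a = Suc (floor_log b)"
      using heap_pair_inv[of K] by (auto simp: a_def b_def)
    then have lev_ab: "floor_log a = N" "floor_log b = N"
      by presburger+
    have le: "Suc a \<le> 2 ^ Suc N" "Suc b \<le> 2 ^ Suc N"
      using floor_log_exp2_gt[of a] floor_log_exp2_gt[of b] by (simp_all add: lev_ab)
    show "square.adapted (2 ^ (2 * N + 2)) (haar_tensor a b)"
    proof (rule square.adaptedI)
      fix x assume "x \<notin> square 1"
      then show "haar_tensor a b x = 0"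
        using interval.adaptedD1[OF interval.adapted_h[of a]] interval.adaptedD1[OF interval.adapted_h[of b]]
        by (cases x) (auto simp: haar_tensor_def tensor_def square_def heap_pair_1)
    next
      fix L x y assume L: "2 ^ (2 * N + 2) \<le> L" and xy: "x \<in> square L" "y \<in> square L"
      define a' b' where "a' = fst (heap_pair L)" and "b' = snd (heap_pair L)"
      have "L \<ge> 1"
        using L one_le_power[of "2::nat" "2 * N + 2"] by linarith
      then have ab': "a' \<ge> 1" "b' \<ge> 1" "floor_log a' + floor_log b' = floor_log L"
        "floor_log a' = floor_log b' \<or> floor_log a' = Suc (floor_log b')"
        using heap_pair_inv[of L] by (auto simp: a'_def b'_def)
      have "2 * N + 2 \<le> floor_log L"
        using floor_log_le_iff[OF L] unfolding floor_log_power .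
      then have "Suc N \<le> floor_log a'" "Suc N \<le> floor_log b'"
        using ab'(3,4) by linarith+
      then have "(2::nat) ^ Suc N \<le> 2 ^ floor_log a'" "(2::nat) ^ Suc N \<le> 2 ^ floor_log b'"
        by (intro power_increasing; simp)+
      then have "Suc a \<le> a'" "Suc b \<le> b'"
        using le floor_log_exp2_le[of a'] floor_log_exp2_le[of b'] ab'(1,2) by linarith+
      moreover obtain s t s' t' where st: "x = (s, t)" "y = (s', t')"
        by (cases x; cases y) auto
      moreover have "s \<in> node a'" "s' \<in> node a'" "t \<in> node b'" "t' \<in> node b'"
        using xy by (auto simp: square_def st a'_def b'_def)
      ultimately have "interval.h a s = interval.h a s'" "interval.h b t = interval.h b t'"
        using interval.adaptedD2[OF interval.adapted_h[of a]] interval.adaptedD2[OF interval.adapted_h[of b]] by blast+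
      then show "haar_tensor a b x = haar_tensor a b y"
        by (simp add: haar_tensor_def tensor_def st)
    qed
    show "\<bar>haar_tensor a b x\<bar> = indicator (square K) x" for x
      using ab by (simp add: abs_haar_tensor square_def a_def[symmetric] b_def[symmetric] max_def)
    have "mass K = mass a * mass b"
      unfolding mass_def lev_K ab(3)[symmetric] by (simp add: power_add)
    then show "\<delta> * mass K \<le> \<bar>pairing (haar_tensor a b) (T (to_L1 (haar_tensor a b)))\<bar>"
      using assms[of a b] by simp
  qed
  then show "\<exists>n\<ge>N. \<exists>m\<ge>n. \<forall>K\<in>lev n. \<exists>s. square.adapted (2 ^ m) s \<and>
      (\<forall>x. \<bar>s x\<bar> = indicator (square K) x) \<and> \<delta> * mass K \<le> \<bar>pairing s (T (to_L1 s))\<bar>"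
    by (intro exI[of _ "2 * N"] conjI exI[of _ "2 * N + 2"] ballI) auto
qed

lemma normalized_haar2_interval_of:
  "normalized_haar2 (interval_of i, interval_of j) = (1 / (mass i * mass j)) *\<^sub>R to_L1 (haar_tensor i j)"
  unfolding normalized_haar2_def split haar2_interval_of norm_haar_tensor by (simp add: divide_inverse)

theorem haar2_L1_factorization:
  "factorization_property (UNIV :: (real \<times> real) L1 set) norm
    (dyadic_intervals_plus \<times> dyadic_intervals_plus) normalized_haar2"
proof -
  interpret banach_on "UNIV :: (real \<times> real) L1 set" norm
    by (rule banach_on_UNIV)
  note bm = bounded_measurable_haar_tensor
  define \<pi> where "\<pi> = map_prod interval_of interval_of \<circ> shell"
  define \<Phi> where "\<Phi> = (\<lambda>(I, J). pairing (haar2 I J))"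
  have \<Phi>: "\<Phi> (interval_of i, interval_of j) = pairing (haar_tensor i j)" for i j
    by (simp add: \<Phi>_def haar2_interval_of)
  have linear: "pairing (haar_tensor i j) (c *\<^sub>R u) = c * pairing (haar_tensor i j) u" for i j c u
    using bounded_linear.linear[OF bounded_linear_pairing[OF bm[of i j]], THEN linear_scale] by simp
  have biorth: "\<Phi> (interval_of i, interval_of j) (normalized_haar2 (interval_of k, interval_of l))
      = (if i = k \<and> j = l then 1 else 0)" for i j k l
    by (simp add: \<Phi> normalized_haar2_interval_of linear pairing_haar_tensor)
  have surj: "dyadic_intervals_plus = range interval_of"
    using bij_betw_imp_surj_on[OF bij_interval_of] by simp
  have inj: "interval_of i = interval_of j \<longleftrightarrow> i = j" for i j
    using bij_betw_imp_inj_on[OF bij_interval_of] by (auto dest: injD)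
  show ?thesis
  proof (rule factorization_propertyI[where e' = \<Phi>])
    have "bij_betw (map_prod interval_of interval_of) (UNIV \<times> UNIV) (dyadic_intervals_plus \<times> dyadic_intervals_plus)"
      by (intro bij_betw_map_prod bij_interval_of)
    moreover have "bij_betw shell UNIV UNIV"
      using inj_shell surj_shell by (rule bij_betw_imageI)
    ultimately show "bij_betw \<pi> UNIV (dyadic_intervals_plus \<times> dyadic_intervals_plus)"
      unfolding \<pi>_def using bij_betw_trans by fastforce
    show "normalized_schauder_basis UNIV norm (normalized_haar2 \<circ> \<pi>)"
    proof (rule normalized_schauder_basisI)
      fix k l
      obtain i j where ij: "shell k = (i, j)"
        by (cases "shell k")
      obtain i' j' where ij': "shell l = (i', j')"
        by (cases "shell l")
      show "norm ((normalized_haar2 \<circ> \<pi>) k) = 1"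
        by (simp add: \<pi>_def ij normalized_haar2_interval_of norm_haar_tensor)
      show "bounded_functional UNIV norm (\<Phi> (\<pi> k))"
        by (simp add: \<pi>_def ij \<Phi> bounded_functional_pairing bm)
      have "i = i' \<and> j = j' \<longleftrightarrow> k = l"
        using injD[OF inj_shell, of k l] ij ij' by auto
      then show "\<Phi> (\<pi> k) ((normalized_haar2 \<circ> \<pi>) l) = (if k = l then 1 else 0)"
        by (simp add: \<pi>_def ij ij' biorth)
    next
      fix x :: "(real \<times> real) L1"
      have "\<Phi> (\<pi> k) x *\<^sub>R (normalized_haar2 \<circ> \<pi>) k = tensor_coeff x (shell k)" for k
        by (cases "shell k") (simp add: \<pi>_def \<Phi> normalized_haar2_interval_of tensor_coeff_def)
      moreover have "(\<lambda>n. norm (x - (\<Sum>k<n. tensor_coeff x (shell k)))) \<longlonglongrightarrow> norm (x - x)"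
        by (intro tendsto_intros shell_sum_tendsto)
      ultimately show "(\<lambda>n. norm (x - (\<Sum>k<n. \<Phi> (\<pi> k) x *\<^sub>R (normalized_haar2 \<circ> \<pi>) k))) \<longlonglongrightarrow> 0"
        by simp
    qed simp
    show "biorthogonal_functionals UNIV norm (dyadic_intervals_plus \<times> dyadic_intervals_plus) normalized_haar2 \<Phi>"
      unfolding biorthogonal_functionals_def surj
    proof (intro conjI ballI)
      fix p q assume "p \<in> range interval_of \<times> range interval_of" "q \<in> range interval_of \<times> range interval_of"
      then obtain i j k l where pq: "p = (interval_of i, interval_of j)" "q = (interval_of k, interval_of l)"
        by blast
      show "bounded_functional UNIV norm (\<Phi> p)"
        unfolding pq \<Phi> by (intro bounded_functional_pairing bm)
      show "\<Phi> p (normalized_haar2 q) = (if p = q then 1 else 0)"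
        unfolding pq biorth by (simp add: inj)
    qed
    fix T :: "(real \<times> real) L1 \<Rightarrow> (real \<times> real) L1"
    assume T: "bounded_operator UNIV norm T"
      and pos: "0 < (INF q\<in>dyadic_intervals_plus \<times> dyadic_intervals_plus. \<bar>\<Phi> q (T (normalized_haar2 q))\<bar>)"
    define \<delta> where "\<delta> = (INF q\<in>dyadic_intervals_plus \<times> dyadic_intervals_plus. \<bar>\<Phi> q (T (normalized_haar2 q))\<bar>)"
    have lin: "bounded_linear T"
      using T by (simp add: bounded_operator_UNIV)
    have "\<delta> * (mass i * mass j) \<le> \<bar>pairing (haar_tensor i j) (T (to_L1 (haar_tensor i j)))\<bar>" for i j
    proof -
      have "(interval_of i, interval_of j) \<in> dyadic_intervals_plus \<times> dyadic_intervals_plus"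
        by (simp add: surj)
      from INF_bound[OF \<delta>_def[symmetric] this]
      have "\<delta> \<le> \<bar>pairing (haar_tensor i j) (T (to_L1 (haar_tensor i j)))\<bar> / (mass i * mass j)"
        using bounded_linear.linear[OF lin, THEN linear_scale]
        by (simp add: \<Phi> normalized_haar2_interval_of linear abs_mult)
      then show ?thesis
        by (simp add: le_divide_eq)
    qed
    then have "square.large_diagonal T \<delta>"
      by (rule large_diagonal_haar_tensor)
    then show "\<exists>R S. bounded_operator UNIV norm R \<and> bounded_operator UNIV norm S \<and> (\<forall>x\<in>UNIV. x = S (T (R x)))"
      using pos by (intro square.L1_identity_factors[OF lin]) (auto simp: \<delta>_def)
  qed
qed

theorem mainTheorem1:
  shows "factorization_property (UNIV :: real L1 set) norm dyadic_intervals_plus normalized_haar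
    \<and> factorization_property (UNIV :: (real \<times> real) L1 set) norm
        (dyadic_intervals_plus \<times> dyadic_intervals_plus) normalized_haar2
    \<and> (\<forall>p::real. 1 \<le> p \<longrightarrow>
        factorization_property (lp_space p) (lp_norm p)
          ((UNIV :: nat set) \<times> dyadic_intervals_plus)
          (\<lambda>(n, I). unit_tensor n (normalized_haar I)))"
  using haar_L1_factorization haar2_L1_factorization haar_lp_factorization by blast

end
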